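(* Let $\mathcal X\subset\mathbf R^n$ be a basic spectratope, and let the unit ball $\mathcal B_*$ of the norm conjugate to the norm $\|\cdot\|$ on $\mathbf R^\nu$ be a basic spectratope (data and notation as in the context); let $A\in\mathbf R^{m\times n}$, $B\in\mathbf R^{\nu\times n}$. Consider the convex optimization problem $$ \overline{\mathrm{Opt}}=\min_{H,\Upsilon,\Lambda}\left\{\phi_{\mathcal R}(\lambda[\Upsilon])+\phi_{\mathcal T}(\lambda[\Lambda]):\ \Upsilon_\ell\succeq0,\ \Lambda_k\succeq0\ \forall(\ell,k),\ \begin{bmatrix}\sum_\ell\mathcal S_\ell^*[\Upsilon_\ell]&\tfrac12(B-H^TA)\\ \tfrac12(B-H^TA)^T&\sum_k\mathcal R_k^*[\Lambda_k]\end{bmatrix}\succeq0\right\} $$ over $H\in\mathbf R^{m\times\nu}$, $\Upsilon=\{\Upsilon_\ell\in\mathbf S^{f_\ell}\}_{\ell\le L}$, $\Lambda=\{\Lambda_k\in\mathbf S^{d_k}\}_{k\le K}$. (i) The problem is solvable (the minimum is attained), and the risk $\mathrm{Risk}_{\|\cdot\|}[\widehat x_{H_*}|\mathcal X]$ of the linear estimate $\widehat x_{H_*}(\omega)=H_*^T\omega$ yielded by the $H$-component $H_*$ of an optimal solution does not exceed $\overline{\mathrm{Opt}}$. (ii) The linear estimate $\widehat x_{H_*}$ is near-optimal: $$ \mathrm{Risk}_{\|\cdot\|}[\widehat x_{H_*}|\mathcal X]\le\overline{\mathrm{Opt}}\le 2\ln(2D)\,\mathrm{Risk}_{\mathrm{opt}}[\mathcal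 X],\qquad D=\sum_kd_k+\sum_\ell f_\ell, $$ where $\mathrm{Risk}_{\mathrm{opt}}[\mathcal X]=\inf_{\widehat x}\mathrm{Risk}_{\|\cdot\|}[\widehat x|\mathcal X]$ is the minimax optimal risk, the infimum being taken over all possible estimates $\widehat x:\mathbf R^m\to\mathbf R^\nu$.
   Context: $\mathbf S^k$ is the space of symmetric $k\times k$ matrices; $U\succeq V$ means $U-V$ is positive semidefinite. A monotonic set in $\mathbf R^K$ is a convex compact set $\mathcal T\subset\mathbf R^K_+$ which contains a vector with all entries positive and satisfies: $0\le t'\le t\in\mathcal T$ (entrywise) implies $t'\in\mathcal T$. Signal set: $\mathcal X=\{x\in\mathbf R^n:\exists t\in\mathcal T: R_k^2[x]\preceq t_kI_{d_k},\,1\le k\le K\}$ is a basic spectratope: $R_k[x]=\sum_{i=1}^n x_iR^{ki}$ with $R^{ki}\in\mathbf S^{d_k}$, $\mathcal T\subset\mathbf R^K_+$ is monotonic, and for every $x\ne0$ one has $R_k[x]\neq0$ for some $k$. Norm: the unit ball of the conjugate norm $\|u\|_*=\max\{u^Tv:\|v\|\le1\}$ is the basic spectratope $\mathcal B_*=\{u\in\mathbf R^\nu:\exists r\in\mathcal R:S_\ell^2[u]\preceq r_\ell I_{f_\ell},1\le\ell\le L\}$, where $S_\ell[u]=\sum_{i=1}^\nu u_iS^{\ell i}$ with $S^{\ell i}\in\mathbf S^{f_\ell}$, $\mathcal R\subset\mathbf R^L_+$ is monotonic, and for every $u\ne0$ one has $S_\ell[u]\ne0$ for some $\ell$. Mappings: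 $[\mathcal R_k^*[\Lambda_k]]_{ij}=\frac12\mathrm{Tr}(\Lambda_k[R^{ki}R^{kj}+R^{kj}R^{ki}])$, $1\le i,j\le n$; $[\mathcal S_\ell^*[\Upsilon_\ell]]_{ij}=\frac12\mathrm{Tr}(\Upsilon_\ell[S^{\ell i}S^{\ell j}+S^{\ell j}S^{\ell i}])$, $1\le i,j\le\nu$; $\lambda[\{\Xi_1,\dots,\Xi_N\}]=[\mathrm{Tr}(\Xi_1);\dots;\mathrm{Tr}(\Xi_N)]$; $\phi_{\mathcal T}(g)=\max_{t\in\mathcal T}g^Tt$, $\phi_{\mathcal R}(g)=\max_{r\in\mathcal R}g^Tr$. Estimation problem: given the observation $\omega=Ax\in\mathbf R^m$ of an unknown signal $x\in\mathcal X$, recover $Bx$ (uncertain-but-bounded observation noise taking values in a spectratope is accommodated by including the noise in the signal $x$). The risk of an estimate $\widehat x:\mathbf R^m\to\mathbf R^\nu$ is $\mathrm{Risk}_{\|\cdot\|}[\widehat x|\mathcal X]=\sup_{x\in\mathcal X}\|Bx-\widehat x(Ax)\|$. *)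

theory Defs
  imports "HOL-Analysis.Analysis" "Jordan_Normal_Form.Matrix"
begin

text \<open>
  The vectors \<open>x\<close>, \<open>u\<close>, \<open>\<omega>\<close>, \<open>t\<close>, \<open>r\<close> and the matrices \<open>A\<close>, \<open>B\<close>, \<open>H\<close> live in spaces of fixed
  dimension and are indexed by finite types. The sizes \<open>d k\<close> of the matrices defining a spectratope
  vary with the index \<open>k\<close>, so these matrices are of type \<^typ>\<open>real mat\<close> with explicit carriers.
\<close>

no_notation vec_index (infixl "$" 100)
no_notation scalar_prod (infix "\<bullet>" 70)

definition sym_mats :: "nat \<Rightarrow> real mat set" where
  "sym_mats d = {M \<in> carrier_mat d d. transpose_mat M = M}"

definition psd_mat :: "real mat \<Rightarrow> bool" where
  "psd_mat M \<longleftrightarrow> M \<in> sym_mats (dim_row M) \<and>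
     (\<forall>v \<in> carrier_vec (dim_row M). 0 \<le> scalar_prod v (M *\<^sub>v v))"

definition loewner_le :: "real mat \<Rightarrow> real mat \<Rightarrow> bool" (infix "\<preceq>\<^sub>m" 50) where
  "V \<preceq>\<^sub>m U \<longleftrightarrow> psd_mat (U - V)"

definition trace_mat :: "real mat \<Rightarrow> real" where
  "trace_mat M = (\<Sum>i<dim_row M. M $$ (i, i))"

definition psd_matrix :: "real^'n^'n \<Rightarrow> bool" where
  "psd_matrix M \<longleftrightarrow> transpose M = M \<and> (\<forall>v. 0 \<le> v \<bullet> (M *v v))"

definition block_matrix ::
    "real^'p^'p \<Rightarrow> real^'q^'p \<Rightarrow> real^'p^'q \<Rightarrow> real^'q^'q \<Rightarrow> real^('p + 'q)^('p + 'q)" where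
  "block_matrix P Q Q' W = (\<chi> i j.
     (case i of
        Inl a \<Rightarrow> (case j of Inl b \<Rightarrow> P $ a $ b | Inr b \<Rightarrow> Q $ a $ b)
      | Inr a \<Rightarrow> (case j of Inl b \<Rightarrow> Q' $ a $ b | Inr b \<Rightarrow> W $ a $ b)))"

definition monotonic_set :: "(real^'k) set \<Rightarrow> bool" where
  "monotonic_set T \<longleftrightarrow>
     convex T \<and> compact T \<and> (\<forall>t\<in>T. \<forall>k. 0 \<le> t $ k) \<and> (\<exists>t\<in>T. \<forall>k. 0 < t $ k) \<and>
     (\<forall>t\<in>T. \<forall>t'. (\<forall>k. 0 \<le> t' $ k \<and> t' $ k \<le> t $ k) \<longrightarrow> t' \<in> T)"

text \<open>\<open>lin_comb_mat d M x\<close> is \<open>\<Sum>i. x\<^sub>i M\<^sup>i\<close>, written entrywise since \<^typ>\<open>real mat\<close> has no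
  additive monoid structure for big sums.\<close>

definition lin_comb_mat :: "nat \<Rightarrow> ('n \<Rightarrow> real mat) \<Rightarrow> real^'n \<Rightarrow> real mat" where
  "lin_comb_mat d M x = Matrix.mat d d (\<lambda>(a, b). \<Sum>i\<in>UNIV. x $ i * M i $$ (a, b))"

definition basic_spectratope_data ::
    "('k::finite \<Rightarrow> nat) \<Rightarrow> ('k \<Rightarrow> 'n::finite \<Rightarrow> real mat) \<Rightarrow> (real^'k) set \<Rightarrow> bool" where
  "basic_spectratope_data d R T \<longleftrightarrow>
     (\<forall>k. 0 < d k) \<and> (\<forall>k i. R k i \<in> sym_mats (d k)) \<and> monotonic_set T \<and>
     (\<forall>x. x \<noteq> 0 \<longrightarrow> (\<exists>k. lin_comb_mat (d k) (R k) x \<noteq> 0\<^sub>m (d k) (d k)))"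

definition basic_spectratope ::
    "('k::finite \<Rightarrow> nat) \<Rightarrow> ('k \<Rightarrow> 'n::finite \<Rightarrow> real mat) \<Rightarrow> (real^'k) set \<Rightarrow> (real^'n) set" where
  "basic_spectratope d R T =
     {x. \<exists>t\<in>T. \<forall>k. lin_comb_mat (d k) (R k) x * lin_comb_mat (d k) (R k) x
                     \<preceq>\<^sub>m (t $ k) \<cdot>\<^sub>m 1\<^sub>m (d k)}"

definition is_norm :: "(real^'v \<Rightarrow> real) \<Rightarrow> bool" where
  "is_norm N \<longleftrightarrow>
     (\<forall>v. 0 \<le> N v) \<and> (\<forall>v. N v = 0 \<longleftrightarrow> v = 0) \<and>
     (\<forall>c v. N (c *\<^sub>R v) = \<bar>c\<bar> * N v) \<and> (\<forall>v w. N (v + w) \<le> N v + N w)"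

text \<open>The suprema in \<open>conj_norm\<close> and \<open>support_fun\<close> are maxima, by compactness of the unit ball and
  of \<open>T\<close>.\<close>

definition conj_norm :: "(real^'v \<Rightarrow> real) \<Rightarrow> real^'v \<Rightarrow> real" where
  "conj_norm N u = (SUP v\<in>{v. N v \<le> 1}. u \<bullet> v)"

definition support_fun :: "(real^'k) set \<Rightarrow> real^'k \<Rightarrow> real" where
  "support_fun T g = (SUP t\<in>T. g \<bullet> t)"

text \<open>The mapping \<open>\<R>\<^sub>k\<^sup>*\<close> (and likewise \<open>\<S>\<^sub>\<ell>\<^sup>*\<close>), for the family \<open>M = (R\<^sup>k\<^sup>i)\<^sub>i\<close>.\<close>

definition adj_map :: "('n::finite \<Rightarrow> real mat) \<Rightarrow> real mat \<Rightarrow> real^'n^'n" where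
  "adj_map M X = (\<chi> i j. (1/2) * trace_mat (X * (M i * M j + M j * M i)))"

definition trace_vec :: "('k::finite \<Rightarrow> real mat) \<Rightarrow> real^'k" where
  "trace_vec X = (\<chi> k. trace_mat (X k))"

definition sdp_feasible ::
    "('k::finite \<Rightarrow> nat) \<Rightarrow> ('k \<Rightarrow> 'n::finite \<Rightarrow> real mat) \<Rightarrow>
     ('l::finite \<Rightarrow> nat) \<Rightarrow> ('l \<Rightarrow> 'v::finite \<Rightarrow> real mat) \<Rightarrow>
     real^'n^'m::finite \<Rightarrow> real^'n^'v \<Rightarrow>
     ((real^'v^'m) \<times> ('l \<Rightarrow> real mat) \<times> ('k \<Rightarrow> real mat)) set" where
  "sdp_feasible d R f S A B =
     {(H, Ups, Lam).
        (\<forall>l. Ups l \<in> sym_mats (f l) \<and> psd_mat (Ups l)) \<and>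
        (\<forall>k. Lam k \<in> sym_mats (d k) \<and> psd_mat (Lam k)) \<and>
        psd_matrix (block_matrix
          (\<Sum>l\<in>UNIV. adj_map (S l) (Ups l))
          ((1/2) *\<^sub>R (B - transpose H ** A))
          (transpose ((1/2) *\<^sub>R (B - transpose H ** A)))
          (\<Sum>k\<in>UNIV. adj_map (R k) (Lam k)))}"

definition sdp_objective ::
    "(real^'k) set \<Rightarrow> (real^'l) set \<Rightarrow>
     (real^'v^'m) \<times> ('l::finite \<Rightarrow> real mat) \<times> ('k::finite \<Rightarrow> real mat) \<Rightarrow> real" where
  "sdp_objective T Rset = (\<lambda>(H, Ups, Lam).
     support_fun Rset (trace_vec Ups) + support_fun T (trace_vec Lam))"

text \<open>Optimal values and risks are extended reals: the risk of an arbitrary estimate can be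
  infinite.\<close>

definition sdp_opt ::
    "('k::finite \<Rightarrow> nat) \<Rightarrow> ('k \<Rightarrow> 'n::finite \<Rightarrow> real mat) \<Rightarrow> (real^'k) set \<Rightarrow>
     ('l::finite \<Rightarrow> nat) \<Rightarrow> ('l \<Rightarrow> 'v::finite \<Rightarrow> real mat) \<Rightarrow> (real^'l) set \<Rightarrow>
     real^'n^'m::finite \<Rightarrow> real^'n^'v \<Rightarrow> ereal" where
  "sdp_opt d R T f S Rset A B =
     (INF z\<in>sdp_feasible d R f S A B. ereal (sdp_objective T Rset z))"

definition sdp_optimal ::
    "('k::finite \<Rightarrow> nat) \<Rightarrow> ('k \<Rightarrow> 'n::finite \<Rightarrow> real mat) \<Rightarrow> (real^'k) set \<Rightarrow>
     ('l::finite \<Rightarrow> nat) \<Rightarrow> ('l \<Rightarrow> 'v::finite \<Rightarrow> real mat) \<Rightarrow> (real^'l) set \<Rightarrow>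
     real^'n^'m::finite \<Rightarrow> real^'n^'v \<Rightarrow>
     real^'v^'m \<Rightarrow> ('l \<Rightarrow> real mat) \<Rightarrow> ('k \<Rightarrow> real mat) \<Rightarrow> bool" where
  "sdp_optimal d R T f S Rset A B H Ups Lam \<longleftrightarrow>
     (H, Ups, Lam) \<in> sdp_feasible d R f S A B \<and>
     (\<forall>z \<in> sdp_feasible d R f S A B.
        sdp_objective T Rset (H, Ups, Lam) \<le> sdp_objective T Rset z)"

definition risk ::
    "(real^'v \<Rightarrow> real) \<Rightarrow> real^'n^'m \<Rightarrow> real^'n^'v \<Rightarrow> (real^'n) set \<Rightarrow>
     (real^'m \<Rightarrow> real^'v) \<Rightarrow> ereal" where
  "risk N A B X xhat = (SUP x\<in>X. ereal (N (B *v x - xhat (A *v x))))"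

definition risk_opt ::
    "(real^'v \<Rightarrow> real) \<Rightarrow> real^'n^'m \<Rightarrow> real^'n^'v \<Rightarrow> (real^'n) set \<Rightarrow> ereal" where
  "risk_opt N A B X = (INF xhat. risk N A B X xhat)"

definition linear_estimate :: "real^'v^'m \<Rightarrow> real^'m \<Rightarrow> real^'v" where
  "linear_estimate H w = transpose H *v w"

end

theory Submission
  imports Defs "Jordan_Normal_Form.Determinant"
begin

no_notation vec_index (infixl "$" 100)
no_notation scalar_prod (infix "\<bullet>" 70)

text \<open>
  A feasible point of the semidefinite program bounds \<open>u\<^sup>T (B - H\<^sup>T A) x\<close> on \<open>\<B>\<^sub>* \<times> \<X>\<close> by its
  objective value, which is the upper bound on the risk.

  For the lower bound, let \<open>0 < \<gamma>\<close> be smaller than the optimal value. Separating the points of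
  objective at most \<open>\<gamma>\<close> from the semidefinite cone gives a dual solution: a positive semidefinite
  block matrix with blocks \<open>U\<close>, \<open>Z\<close>, \<open>V\<close> such that \<open>A Z\<^sup>T = 0\<close>, \<open>Tr (B Z\<^sup>T) = \<gamma>\<close>, and \<open>U\<close>, \<open>V\<close> obey the
  spectratope inequalities on average. A Schur complement factors it through vectors \<open>u\<^sub>a\<close> and
  \<open>x\<^sub>a \<in> ker A\<close>, which can be rotated so that the symmetric part of the matrix of the \<open>u\<^sub>k\<^sup>T B x\<^sub>l\<close> is
  diagonal. Then \<open>u = \<Sum> \<epsilon>\<^sub>a u\<^sub>a\<close> and \<open>x = \<Sum> \<epsilon>\<^sub>a x\<^sub>a\<close> satisfy \<open>u\<^sup>T B x = \<gamma>\<close> for all signs \<open>\<epsilon>\<close>, and the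
  matrix Khintchine inequality in the form \<open>E Tr X\<^sup>2\<^sup>p \<le> (2p - 1) E Tr X\<^sup>2\<^sup>p\<^sup>-\<^sup>2\<close>, summed to
  \<open>E Tr cosh (s X) \<le> D exp (s\<^sup>2 / 2)\<close>, provides signs with \<open>u / s \<in> \<B>\<^sub>*\<close>, \<open>x / s \<in> \<X>\<close> for
  \<open>s\<^sup>2 = 2 ln (2D)\<close>. As \<open>x\<close> and \<open>-x\<close> give the same observation \<open>0\<close>, every estimate has risk at least
  \<open>\<parallel>B x / s\<parallel> \<ge> \<gamma> / s\<^sup>2\<close>.
\<close>

section \<open>Spectral decompositions\<close>

text \<open>The constant comes from using one potential for all blocks. Over all signs, the traces
  of cosh (s X), summed over the blocks, average at most D exp (s^2 / 2) = 2 D^2, while a single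
  eigenvalue of modulus s already contributes cosh (s^2) > exp (s^2) / 2 = 2 D^2. So one choice of
  signs bounds every block of u and of x at once. Each of u and x is then divided by s, which costs
  s^2 in the bilinear form and nothing more: after the rotation its off-diagonal terms cancel in
  pairs, so its value does not fluctuate and needs no concentration estimate.

  The moment inequality compares traces of powers of two matrices that need not commute; evenness of
  the power and a mixed pair of eigenbases reduce this to real numbers.

  Two obstacles come from H. The objective does not control it, so in the existence proof only H^T A
  converges. In the dual problem this freedom is useful: a linear functional bounded above along all
  H must vanish on every H^T A, which puts the rows of Z into the kernel of A. Taking the level
  strictly below the optimal value keeps the sublevel set disjoint from the cone, and interior
  points of the cone make the multiplier of the objective positive.\<close>

lemma bounded_family_convergent_subseq:
  fixes x :: "nat \<Rightarrow> 'i \<Rightarrow> real"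
  assumes "finite I" and "\<And>n i. i \<in> I \<Longrightarrow> \<bar>x n i\<bar> \<le> M"
  shows "\<exists>r l. strict_mono (r :: nat \<Rightarrow> nat) \<and> (\<forall>i\<in>I. (\<lambda>n. x (r n) i) \<longlonglongrightarrow> l i)"
  using assms
proof (induction I rule: finite_induct)
  case empty
  show ?case using strict_mono_id by (auto simp: id_def)
next
  case (insert j I)
  then obtain r l where r: "strict_mono (r :: nat \<Rightarrow> nat)" "\<And>i. i \<in> I \<Longrightarrow> (\<lambda>n. x (r n) i) \<longlonglongrightarrow> l i"
    by force
  have "bounded (range (\<lambda>n. x (r n) j))"
    using insert.prems[of j] by (auto simp: bounded_iff)
  then obtain c s where s: "strict_mono (s :: nat \<Rightarrow> nat)" "((\<lambda>n. x (r n) j) \<circ> s) \<longlonglongrightarrow> c"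
    using bounded_imp_convergent_subsequence by blast
  have "(\<lambda>n. x ((r \<circ> s) n) i) \<longlonglongrightarrow> (l(j := c)) i" if "i \<in> insert j I" for i
  proof (cases "i = j")
    case True
    then show ?thesis using s(2) by (simp add: o_def)
  next
    case False
    then show ?thesis using that LIMSEQ_subseq_LIMSEQ[OF r(2) s(1), of i] by (simp add: o_def)
  qed
  then show ?case using strict_mono_o[OF r(1) s(1)] by blast
qed

text \<open>Block sizes vary with the block index, so vectors are functions on \<open>nat\<close> of
  which only the entries below \<open>n\<close> count. Accordingly \<open>dotn n v v = 0\<close>
  makes \<open>v\<close> vanish only below \<open>n\<close>.\<close>

definition dotn :: "nat \<Rightarrow> (nat \<Rightarrow> real) \<Rightarrow> (nat \<Rightarrow> real) \<Rightarrow> real" where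
  "dotn n v w = (\<Sum>i<n. v i * w i)"

definition appn :: "nat \<Rightarrow> (nat \<Rightarrow> nat \<Rightarrow> real) \<Rightarrow> (nat \<Rightarrow> real) \<Rightarrow> nat \<Rightarrow> real" where
  "appn n a v = (\<lambda>i. \<Sum>j<n. a i j * v j)"

lemma dotn_commute: "dotn n v w = dotn n w v"
  by (simp add: dotn_def mult.commute)

lemma dotn_add_left: "dotn n (\<lambda>i. u i + v i) w = dotn n u w + dotn n v w"
  and dotn_scale_left: "dotn n (\<lambda>i. c * v i) w = c * dotn n v w"
  and dotn_diff_left: "dotn n (\<lambda>i. u i - v i) w = dotn n u w - dotn n v w"
  by (simp_all add: dotn_def sum_distrib_left sum.distrib sum_subtractf algebra_simps)

lemma dotn_add_right: "dotn n w (\<lambda>i. u i + v i) = dotn n w u + dotn n w v"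
  and dotn_scale_right: "dotn n w (\<lambda>i. c * v i) = c * dotn n w v"
  and dotn_diff_right: "dotn n w (\<lambda>i. u i - v i) = dotn n w u - dotn n w v"
  by (simp_all add: dotn_def sum_distrib_left sum.distrib sum_subtractf algebra_simps)

lemma dotn_self_nonneg: "0 \<le> dotn n v v"
  by (simp add: dotn_def sum_nonneg)

lemma dotn_self_eq_0_iff: "dotn n v v = 0 \<longleftrightarrow> (\<forall>i<n. v i = 0)"
  unfolding dotn_def by (subst sum_nonneg_eq_0_iff) auto

lemma appn_add: "appn n a (\<lambda>i. u i + v i) = (\<lambda>i. appn n a u i + appn n a v i)"
  and appn_scale: "appn n a (\<lambda>i. c * v i) = (\<lambda>i. c * appn n a v i)"
  by (simp_all add: appn_def sum_distrib_left sum.distrib sum_subtractf algebra_simps)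

lemma dotn_appn_symmetric:
  assumes "\<And>i j. i < n \<Longrightarrow> j < n \<Longrightarrow> a i j = a j i"
  shows "dotn n (appn n a v) w = dotn n v (appn n a w)"
proof -
  have "dotn n (appn n a v) w = (\<Sum>i<n. \<Sum>j<n. a i j * v j * w i)"
    by (simp add: dotn_def appn_def sum_distrib_right)
  also have "\<dots> = (\<Sum>j<n. \<Sum>i<n. a i j * v j * w i)"
    by (rule sum.swap)
  also have "\<dots> = dotn n v (appn n a w)"
    unfolding dotn_def appn_def sum_distrib_left
    by (intro sum.cong refl) (use assms in \<open>auto simp: mult_ac\<close>)
  finally show ?thesis .
qed

text \<open>Padding the \<open>m\<close> constraint rows with zero rows gives a square matrix with a
  vanishing row, hence a singular one.\<close>

lemma exists_nonzero_orthogonal: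
  fixes u :: "nat \<Rightarrow> nat \<Rightarrow> real"
  assumes "m < n"
  shows "\<exists>w. dotn n w w \<noteq> 0 \<and> (\<forall>k<m. dotn n (u k) w = 0)"
proof -
  define M where "M = Matrix.mat n n (\<lambda>(k, i). if k < m then u k i else 0)"
  have M: "M \<in> carrier_mat n n" by (simp add: M_def)
  have "det M = 0"
  proof -
    have "M = mat\<^sub>r n n (\<lambda>i. if i = m then 0\<^sub>v n else Matrix.row M i)"
      using assms by (intro eq_matI) (auto simp: M_def)
    then show ?thesis using det_row_0[of m n "Matrix.row M"] assms M by fastforce
  qed
  then obtain v where v: "v \<in> carrier_vec n" "v \<noteq> 0\<^sub>v n" "M *\<^sub>v v = 0\<^sub>v n"
    using det_0_iff_vec_prod_zero[OF M] by blast
  define w where "w i = vec_index v i" for i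
  have "\<exists>i<n. w i \<noteq> 0" using v by (auto simp: w_def vec_eq_iff)
  moreover have "dotn n (u k) w = 0" if "k < m" for k
  proof -
    have "vec_index (M *\<^sub>v v) k = 0" using v(3) that assms by simp
    then show ?thesis
      using that assms v(1) by (simp add: M_def scalar_prod_def dotn_def w_def lessThan_atLeast0)
  qed
  ultimately show ?thesis using dotn_self_eq_0_iff by metis
qed

text \<open>The entries beyond \<open>n\<close> are free, so this unit sphere is not compact as a
  set of functions. A maximizing sequence converges entrywise below \<open>n\<close> along a
  subsequence, which is all that the forms see. With constraints this yields the next eigenvector;
  with \<open>m = 0\<close> it yields the largest eigenvalue of a dual block.\<close>

lemma exists_constrained_max:
  fixes u :: "nat \<Rightarrow> nat \<Rightarrow> real"
  assumes "m < n"
  shows "\<exists>v. dotn n v v = 1 \<and> (\<forall>k<m. dotn n (u k) v = 0) \<and>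
    (\<forall>w. dotn n w w = 1 \<and> (\<forall>k<m. dotn n (u k) w = 0) \<longrightarrow>
         dotn n w (appn n a w) \<le> dotn n v (appn n a v))"
proof -
  define S where "S = {w. dotn n w w = 1 \<and> (\<forall>k<m. dotn n (u k) w = 0)}"
  define q where "q w = dotn n w (appn n a w)" for w
  obtain w where w: "dotn n w w \<noteq> 0" "\<And>k. k < m \<Longrightarrow> dotn n (u k) w = 0"
    using exists_nonzero_orthogonal[OF assms] by metis
  have "0 < dotn n w w" using w(1) dotn_self_nonneg[of n w] by linarith
  then have "(\<lambda>i. (1 / sqrt (dotn n w w)) * w i) \<in> S"
    unfolding S_def mem_Collect_eq dotn_scale_left dotn_scale_right by (simp add: w(2))
  then have ne: "q ` S \<noteq> {}" by auto
  have le1: "\<bar>v i\<bar> \<le> 1" if "v \<in> S" "i < n" for v i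
  proof -
    have "v i * v i \<le> dotn n v v"
      unfolding dotn_def by (rule member_le_sum) (use that in auto)
    then have "(v i)\<^sup>2 \<le> 1" using that by (simp add: S_def power2_eq_square)
    then show ?thesis by (simp add: abs_square_le_1)
  qed
  have bdd: "bdd_above (q ` S)"
  proof (rule bdd_aboveI2)
    fix v assume v: "v \<in> S"
    have "q v \<le> (\<Sum>i<n. \<Sum>j<n. \<bar>a i j\<bar>)"
      unfolding q_def dotn_def appn_def sum_distrib_left
    proof (intro sum_mono)
      fix i j assume "i \<in> {..<n}" "j \<in> {..<n}"
      then have "\<bar>v i\<bar> * \<bar>v j\<bar> \<le> 1 * 1" by (intro mult_mono le1 v) auto
      then have "\<bar>a i j\<bar> * (\<bar>v i\<bar> * \<bar>v j\<bar>) \<le> \<bar>a i j\<bar>"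
        using mult_left_mono[of "\<bar>v i\<bar> * \<bar>v j\<bar>" 1 "\<bar>a i j\<bar>"] by simp
      then show "v i * (a i j * v j) \<le> \<bar>a i j\<bar>"
        using abs_ge_self[of "v i * (a i j * v j)"] by (simp add: abs_mult mult_ac)
    qed
    then show "q v \<le> (\<Sum>i<n. \<Sum>j<n. \<bar>a i j\<bar>)" .
  qed
  have "\<exists>v\<in>S. Sup (q ` S) - 1 / real (Suc k) < q v" for k
    using less_cSup_iff[OF ne bdd, of "Sup (q ` S) - 1 / real (Suc k)"] by auto
  then obtain x where x: "\<And>k. x k \<in> S" "\<And>k. Sup (q ` S) - 1 / real (Suc k) < q (x k)"
    by metis
  obtain r l where r: "strict_mono (r :: nat \<Rightarrow> nat)"
    and l: "\<And>i. i \<in> {..<n} \<Longrightarrow> (\<lambda>k. x (r k) i) \<longlonglongrightarrow> l i"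
    using bounded_family_convergent_subseq[of "{..<n}" x 1] le1 x(1) by force
  have dlim: "(\<lambda>k. dotn n c (x (r k))) \<longlonglongrightarrow> dotn n c l" for c
    unfolding dotn_def by (intro tendsto_intros l)
  have "(\<lambda>k. dotn n (x (r k)) (x (r k))) \<longlonglongrightarrow> dotn n l l"
    unfolding dotn_def by (intro tendsto_intros l)
  then have "dotn n l l = 1"
    using x(1) by (simp add: S_def LIMSEQ_const_iff)
  moreover have "dotn n (u k) l = 0" if "k < m" for k
    using dlim[of "u k"] x(1) that by (simp add: S_def LIMSEQ_const_iff)
  ultimately have lS: "l \<in> S" by (simp add: S_def)
  have qlim: "(\<lambda>k. q (x (r k))) \<longlonglongrightarrow> q l"
    unfolding q_def dotn_def appn_def by (intro tendsto_intros l) auto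
  have "(\<lambda>k. Sup (q ` S) - 1 / real (Suc (r k))) \<longlonglongrightarrow> Sup (q ` S) - 0"
    using LIMSEQ_subseq_LIMSEQ[OF LIMSEQ_inverse_real_of_nat r]
    by (intro tendsto_intros) (simp add: o_def inverse_eq_divide)
  then have "Sup (q ` S) \<le> q l"
    using LIMSEQ_le[OF _ qlim, of "\<lambda>k. Sup (q ` S) - 1 / real (Suc (r k))" "Sup (q ` S)"] x(2)
    by (auto intro: less_imp_le)
  moreover have "q w \<le> Sup (q ` S)" if "w \<in> S" for w
    using bdd that by (simp add: cSup_upper)
  ultimately have "\<forall>w\<in>S. q w \<le> q l" using order_trans by blast
  then show ?thesis using lS unfolding S_def q_def by (intro exI[of _ l]) auto
qed

text \<open>First-order optimality without derivatives: for a small step in the direction of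
  \<open>b\<close> the linear term outweighs the quadratic one.\<close>

lemma linear_term_zero_if_quadratic_nonpos:
  fixes b c :: real
  assumes "\<And>t. t * b + t\<^sup>2 * c \<le> 0"
  shows "b = 0"
proof (rule ccontr)
  assume "b \<noteq> 0"
  define e where "e = 1 / (\<bar>c\<bar> + 1)"
  have e: "0 < e" "e * \<bar>c\<bar> < 1" by (auto simp: e_def field_simps)
  then have "- 1 < e * c" using mult_left_mono[of "-\<bar>c\<bar>" c e] by linarith
  then have "0 < e * b\<^sup>2 * (1 + e * c)" using e \<open>b \<noteq> 0\<close> by simp
  moreover have "(e * b) * b + (e * b)\<^sup>2 * c = e * b\<^sup>2 * (1 + e * c)"
    by (simp add: power2_eq_square algebra_simps)
  ultimately show False using assms[of "e * b"] by linarith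
qed

text \<open>A maximizer of the Rayleigh quotient on the orthogonal complement of the earlier
  eigenvectors is the next eigenvector.\<close>

lemma orthonormal_eigenvectors:
  fixes a :: "nat \<Rightarrow> nat \<Rightarrow> real"
  assumes sym: "\<And>i j. i < n \<Longrightarrow> j < n \<Longrightarrow> a i j = a j i" and "m \<le> n"
  shows "\<exists>u lam. (\<forall>k<m. \<forall>l<m. dotn n (u k) (u l) = (if k = l then 1 else 0)) \<and>
    (\<forall>k<m. \<forall>i<n. appn n a (u k) i = lam k * u k i)"
  using \<open>m \<le> n\<close>
proof (induction m)
  case 0
  show ?case by simp
next
  case (Suc m)
  then obtain u lam
    where u: "\<forall>k<m. \<forall>l<m. dotn n (u k) (u l) = (if k = l then 1 else 0)"
      and "\<forall>k<m. \<forall>i<n. appn n a (u k) i = lam k * u k i"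
    by auto
  then have lam: "appn n a (u k) i = lam k * u k i" if "k < m" "i < n" for k i
    using that by blast
  have "m < n" using Suc by simp
  from exists_constrained_max[OF this, of u a] obtain v where v1: "dotn n v v = 1"
    and v0: "\<forall>k<m. dotn n (u k) v = 0"
    and vmax: "\<forall>w. dotn n w w = 1 \<and> (\<forall>k<m. dotn n (u k) w = 0) \<longrightarrow>
         dotn n w (appn n a w) \<le> dotn n v (appn n a v)"
    by blast
  have v: "dotn n v v = 1" "\<And>k. k < m \<Longrightarrow> dotn n (u k) v = 0" using v1 v0 by auto
  have vu: "dotn n v (u k) = 0" if "k < m" for k using v(2)[OF that] dotn_commute by metis
  have max: "dotn n w (appn n a w) \<le> dotn n v (appn n a v)"
    if "dotn n w w = 1" "\<And>k. k < m \<Longrightarrow> dotn n (u k) w = 0" for w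
    using vmax that by blast
  define c where "c = dotn n v (appn n a v)"
  \<comment> \<open>The homogeneous form of maximality, so that perturbations need not be
    normalized.\<close>
  have max': "dotn n w (appn n a w) \<le> c * dotn n w w" if "\<And>k. k < m \<Longrightarrow> dotn n (u k) w = 0" for w
  proof (cases "dotn n w w = 0")
    case True
    then have "\<forall>i<n. w i = 0" by (simp only: dotn_self_eq_0_iff)
    then have "dotn n w (appn n a w) = 0" by (simp add: dotn_def)
    then show ?thesis using True by simp
  next
    case False
    then have pos: "0 < dotn n w w" using dotn_self_nonneg[of n w] by linarith
    define s where "s = 1 / sqrt (dotn n w w)"
    have s: "s * s * dotn n w w = 1" "0 < s" using pos by (auto simp: s_def)
    have "dotn n (\<lambda>i. s * w i) (appn n a (\<lambda>i. s * w i)) \<le> c" unfolding c_def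
      by (rule max) (use s that in \<open>auto simp: dotn_scale_left dotn_scale_right\<close>)
    then have "s * s * dotn n w (appn n a w) \<le> s * s * (c * dotn n w w)"
      using s by (simp add: dotn_scale_left dotn_scale_right appn_scale mult_ac)
    then show ?thesis using s(2) by (simp add: mult_le_cancel_left)
  qed
  \<comment> \<open>The residual of the eigenvalue equation. It is orthogonal to \<open>v\<close>
    and to the earlier eigenvectors, hence an admissible direction, and the first-order term along
    it is twice its own squared norm.\<close>
  define w where "w = (\<lambda>i. appn n a v i - c * v i)"
  have wu: "dotn n (u k) w = 0" if "k < m" for k
  proof -
    have "dotn n (u k) (appn n a v) = dotn n (appn n a (u k)) v"
      by (simp add: dotn_appn_symmetric sym)
    also have "\<dots> = dotn n (\<lambda>i. lam k * u k i) v"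
      using lam[OF that] by (simp add: dotn_def)
    finally show ?thesis
      using v(2)[OF that] by (simp add: w_def dotn_diff_right dotn_scale_right dotn_scale_left)
  qed
  have wv: "dotn n w v = 0"
    using v(1) by (simp add: w_def dotn_diff_left dotn_scale_left c_def dotn_commute)
  have vw: "dotn n v w = 0" using wv dotn_commute by metis
  have vaw: "dotn n v (appn n a w) = dotn n w (appn n a v)"
    using dotn_appn_symmetric[of n a w v] sym by (simp add: dotn_commute)
  have "t * (2 * dotn n w (appn n a v)) + t\<^sup>2 * (dotn n w (appn n a w) - c * dotn n w w) \<le> 0" for t
  proof -
    have "dotn n (\<lambda>i. v i + t * w i) (appn n a (\<lambda>i. v i + t * w i))
        \<le> c * dotn n (\<lambda>i. v i + t * w i) (\<lambda>i. v i + t * w i)"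
      by (rule max') (simp add: dotn_add_right dotn_scale_right wu v(2))
    moreover have "dotn n (\<lambda>i. v i + t * w i) (\<lambda>i. v i + t * w i) = 1 + t\<^sup>2 * dotn n w w"
      using wv v(1) vw by (simp add: dotn_add_right dotn_scale_right dotn_add_left dotn_scale_left power2_eq_square algebra_simps)
    ultimately show ?thesis
      by (simp add: appn_add appn_scale dotn_add_right dotn_scale_right dotn_add_left dotn_scale_left
          vaw vw wv v(1) c_def[symmetric] power2_eq_square algebra_simps)
  qed
  then have "2 * dotn n w (appn n a v) = 0"
    by (rule linear_term_zero_if_quadratic_nonpos)
  then have "dotn n w (appn n a v) = 0" by simp
  moreover have "dotn n w w = dotn n w (appn n a v) - c * dotn n w v"
    unfolding w_def by (simp add: dotn_diff_right dotn_scale_right)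
  ultimately have "dotn n w w = 0" using wv by simp
  then have ev: "appn n a v i = c * v i" if "i < n" for i
    using that by (auto simp: dotn_self_eq_0_iff w_def)
  show ?case
  proof (intro exI conjI allI impI)
    fix k l assume "k < Suc m" "l < Suc m"
    then show "dotn n ((u(m := v)) k) ((u(m := v)) l) = (if k = l then 1 else 0)"
      using u v vu by (auto simp: less_Suc_eq)
  next
    fix k i assume "k < Suc m" "i < n"
    then show "appn n a ((u(m := v)) k) i = (lam(m := c)) k * (u(m := v)) k i"
      using lam ev by (auto simp: less_Suc_eq)
  qed
qed

text \<open>The rows \<open>u k\<close> are the eigenvectors. Completeness stands next to
  orthonormality so that Parseval's identity follows without a dimension argument.\<close>

definition spectral_decomposition ::
    "nat \<Rightarrow> (nat \<Rightarrow> nat \<Rightarrow> real) \<Rightarrow> (nat \<Rightarrow> nat \<Rightarrow> real) \<Rightarrow> (nat \<Rightarrow> real) \<Rightarrow> bool" where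
  "spectral_decomposition n a u lam \<longleftrightarrow>
    (\<forall>k<n. \<forall>l<n. (\<Sum>i<n. u k i * u l i) = (if k = l then 1 else 0)) \<and>
    (\<forall>i<n. \<forall>j<n. (\<Sum>k<n. u k i * u k j) = (if i = j then 1 else 0)) \<and>
    (\<forall>i<n. \<forall>j<n. a i j = (\<Sum>k<n. lam k * (u k i * u k j)))"

lemma exists_spectral_decomposition:
  fixes a :: "nat \<Rightarrow> nat \<Rightarrow> real"
  assumes sym: "\<And>i j. i < n \<Longrightarrow> j < n \<Longrightarrow> a i j = a j i"
  shows "\<exists>u lam. spectral_decomposition n a u lam"
proof -
  obtain u lam where u: "\<forall>k<n. \<forall>l<n. dotn n (u k) (u l) = (if k = l then 1 else 0)"
    and "\<forall>k<n. \<forall>i<n. appn n a (u k) i = lam k * u k i"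
    using orthonormal_eigenvectors[of n a n] sym by blast
  then have lam: "appn n a (u k) i = lam k * u k i" if "k < n" "i < n" for k i
    using that by blast
  \<comment> \<open>For a square matrix, orthonormal rows force orthonormal columns, which is the
    completeness relation.\<close>
  define M where "M = Matrix.mat n n (\<lambda>(k, i). u k i)"
  have M: "M \<in> carrier_mat n n" "transpose_mat M \<in> carrier_mat n n" by (auto simp: M_def)
  have "M * transpose_mat M = 1\<^sub>m n"
  proof (rule eq_matI)
    fix k l assume "k < dim_row (1\<^sub>m n :: real mat)" "l < dim_col (1\<^sub>m n :: real mat)"
    then show "(M * transpose_mat M) $$ (k, l) = 1\<^sub>m n $$ (k, l)"
      using u by (simp add: M_def scalar_prod_def dotn_def lessThan_atLeast0)
  qed (auto simp: M_def)
  then have MM: "transpose_mat M * M = 1\<^sub>m n"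
    by (rule mat_mult_left_right_inverse[OF M])
  have comp: "(\<Sum>k<n. u k i * u k j) = (if i = j then 1 else 0)" if "i < n" "j < n" for i j
  proof -
    have "(transpose_mat M * M) $$ (i, j) = (if i = j then 1 else 0)" using MM that by simp
    then show ?thesis using that by (simp add: M_def scalar_prod_def lessThan_atLeast0)
  qed
  have "a i j = (\<Sum>k<n. lam k * (u k i * u k j))" if ij: "i < n" "j < n" for i j
  proof -
    have "a i j = (\<Sum>l<n. a i l * (\<Sum>k<n. u k l * u k j))"
      using ij by (simp add: comp if_distrib sum.delta' cong: if_cong)
    also have "\<dots> = (\<Sum>l<n. \<Sum>k<n. a i l * u k l * u k j)"
      by (simp add: sum_distrib_left mult_ac)
    also have "\<dots> = (\<Sum>k<n. \<Sum>l<n. a i l * u k l * u k j)"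
      by (rule sum.swap)
    also have "\<dots> = (\<Sum>k<n. appn n a (u k) i * u k j)"
      by (simp add: appn_def sum_distrib_right)
    finally show ?thesis using ij by (simp add: lam mult_ac)
  qed
  then show ?thesis using u comp unfolding dotn_def spectral_decomposition_def by blast
qed

lemma spectral_decomposition_finite:
  fixes a :: "'i::finite \<Rightarrow> 'i \<Rightarrow> real"
  assumes sym: "\<And>i j. a i j = a j i"
  shows "\<exists>u lam. (\<forall>k l. (\<Sum>i\<in>UNIV. u k i * u l i) = (if k = (l::'i) then 1 else 0)) \<and>
    (\<forall>i j. (\<Sum>k\<in>UNIV. u k i * u k j) = (if i = (j::'i) then 1 else 0)) \<and>
    (\<forall>i j. a i j = (\<Sum>k\<in>UNIV. lam k * (u k i * u k j)))"
proof -
  define n where "n = CARD('i)"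
  obtain g :: "nat \<Rightarrow> 'i" where g: "bij_betw g {..<n} UNIV"
    using ex_bij_betw_nat_finite[of "UNIV :: 'i set"] by (auto simp: n_def lessThan_atLeast0)
  define h where "h = the_inv_into {..<n} g"
  have h: "bij_betw h UNIV {..<n}" unfolding h_def by (rule bij_betw_the_inv_into[OF g])
  have gh: "g (h i) = i" for i
    unfolding h_def by (rule f_the_inv_into_f_bij_betw[OF g]) simp
  have hlt: "h i < n" for i using h by (auto simp: bij_betw_def)
  have hinj: "h i = h j \<longleftrightarrow> i = j" for i j using gh by metis
  obtain u lam where
    u: "\<forall>k<n. \<forall>l<n. (\<Sum>i<n. u k i * u l i) = (if k = l then 1 else 0)"
    and c: "\<forall>i<n. \<forall>j<n. (\<Sum>k<n. u k i * u k j) = (if i = j then 1 else 0)"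
    and d: "\<forall>i<n. \<forall>j<n. a (g i) (g j) = (\<Sum>k<n. lam k * (u k i * u k j))"
    using exists_spectral_decomposition[of n "\<lambda>i j. a (g i) (g j)"] sym
    unfolding spectral_decomposition_def by blast
  have re: "(\<Sum>i\<in>UNIV. F (h i)) = (\<Sum>i<n. F i)" for F :: "nat \<Rightarrow> real"
    by (rule sum.reindex_bij_betw[OF h])
  show ?thesis
  proof (intro exI conjI allI)
    show "(\<Sum>i\<in>UNIV. u (h k) (h i) * u (h l) (h i)) = (if k = l then 1 else 0)" for k l
      by (subst re[of "\<lambda>i. u (h k) i * u (h l) i"]) (simp add: u hlt hinj)
    show "(\<Sum>k\<in>UNIV. u (h k) (h i) * u (h k) (h j)) = (if i = j then 1 else 0)" for i j
      by (subst re[of "\<lambda>k. u k (h i) * u k (h j)"]) (simp add: c hlt hinj)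
    show "a i j = (\<Sum>k\<in>UNIV. lam (h k) * (u (h k) (h i) * u (h k) (h j)))" for i j
      using re[of "\<lambda>k. lam k * (u k (h i) * u k (h j))"] d[rule_format, of "h i" "h j"]
      by (simp add: hlt gh)
  qed
qed

section \<open>Moments of Rademacher matrix series\<close>

lemma spectral_decomposition_symmetric:
  assumes "spectral_decomposition n a u lam" "i < n" "j < n"
  shows "a i j = a j i"
  using assms by (simp add: spectral_decomposition_def mult_ac)

lemma spectral_decomposition_eigen:
  assumes "spectral_decomposition n a u lam" "k < n" "i < n"
  shows "appn n a (u k) i = lam k * u k i"
proof -
  have "appn n a (u k) i = (\<Sum>j<n. \<Sum>l<n. lam l * (u l i * u l j) * u k j)"
    using assms by (simp add: appn_def spectral_decomposition_def sum_distrib_right)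
  also have "\<dots> = (\<Sum>l<n. \<Sum>j<n. lam l * (u l i * u l j) * u k j)"
    by (rule sum.swap)
  also have "\<dots> = (\<Sum>l<n. lam l * u l i * (\<Sum>j<n. u l j * u k j))"
    by (simp add: sum_distrib_left mult_ac)
  also have "\<dots> = (\<Sum>l<n. lam l * u l i * (if l = k then 1 else 0))"
    using assms by (intro sum.cong refl) (simp add: spectral_decomposition_def)
  also have "\<dots> = lam k * u k i" using assms by (simp add: if_distrib sum.delta' cong: if_cong)
  finally show ?thesis .
qed

lemma spectral_decomposition_parseval:
  assumes "spectral_decomposition n a u lam"
  shows "dotn n v w = (\<Sum>k<n. dotn n (u k) v * dotn n (u k) w)"
proof -
  have "(\<Sum>k<n. dotn n (u k) v * dotn n (u k) w) = (\<Sum>k<n. \<Sum>i<n. \<Sum>j<n. u k i * v i * (u k j * w j))"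
    by (simp add: dotn_def sum_product)
  also have "\<dots> = (\<Sum>i<n. \<Sum>k<n. \<Sum>j<n. u k i * v i * (u k j * w j))"
    by (rule sum.swap)
  also have "\<dots> = (\<Sum>i<n. \<Sum>j<n. \<Sum>k<n. u k i * v i * (u k j * w j))"
    by (intro sum.cong refl sum.swap)
  also have "\<dots> = (\<Sum>i<n. \<Sum>j<n. v i * w j * (\<Sum>k<n. u k i * u k j))"
    by (simp add: sum_distrib_left mult_ac)
  also have "\<dots> = (\<Sum>i<n. \<Sum>j<n. v i * w j * (if i = j then 1 else 0))"
    using assms by (intro sum.cong refl) (simp add: spectral_decomposition_def)
  also have "\<dots> = dotn n v w" by (simp add: dotn_def if_distrib sum.delta' cong: if_cong)
  finally show ?thesis by simp
qed

lemma spectral_decomposition_dotn_appn: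
  assumes "spectral_decomposition n a u lam" "k < n"
  shows "dotn n (u k) (appn n a v) = lam k * dotn n (u k) v"
proof -
  have "dotn n (u k) (appn n a v) = dotn n (appn n a (u k)) v"
    using spectral_decomposition_symmetric[OF assms(1)] by (metis dotn_appn_symmetric)
  also have "\<dots> = dotn n (\<lambda>i. lam k * u k i) v"
    using spectral_decomposition_eigen[OF assms] by (simp add: dotn_def)
  finally show ?thesis by (simp add: dotn_scale_left)
qed

lemma spectral_decomposition_norm_appn:
  assumes "spectral_decomposition n a u lam"
  shows "dotn n (appn n a v) (appn n a v) = (\<Sum>k<n. (lam k)\<^sup>2 * (dotn n (u k) v)\<^sup>2)"
  unfolding spectral_decomposition_parseval[OF assms, of "appn n a v"]
  by (intro sum.cong refl)
    (simp add: spectral_decomposition_dotn_appn[OF assms] power2_eq_square mult_ac)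

lemma spectral_decomposition_unit:
  assumes "spectral_decomposition n a u lam" "k < n"
  shows "dotn n (u k) (u k) = 1"
  using assms by (simp add: spectral_decomposition_def dotn_def)

text \<open>The trapezoid bound for the integral of the convex function \<open>t ^ r\<close> between
  \<open>y\<close> and \<open>x\<close>, multiplied by \<open>x - y\<close>. Algebraically, the
  quotient of differences is a sum of mixed products, and the terms with index \<open>i\<close> and
  \<open>r - i\<close> together are at most \<open>x ^ r + y ^ r\<close>.\<close>

lemma power_diff_times_diff_le:
  fixes x y :: real
  assumes "even r"
  shows "(x ^ Suc r - y ^ Suc r) * (x - y) \<le> real (Suc r) / 2 * (x ^ r + y ^ r) * (x - y)\<^sup>2"
proof -
  define s where "s = (\<Sum>i<Suc r. y ^ (r - i) * x ^ i)"
  have pair: "y ^ (r - i) * x ^ i + y ^ i * x ^ (r - i) \<le> x ^ r + y ^ r" if "i < Suc r" for i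
  proof -
    \<comment> \<open>Evenness of \<open>r\<close> allows passing to moduli, where the differences
      of the powers \<open>i\<close> and \<open>r - i\<close> have the same sign.\<close>
    define a b where "a = \<bar>x\<bar>" and "b = \<bar>y\<bar>"
    have ab: "0 \<le> a" "0 \<le> b" by (auto simp: a_def b_def)
    have "0 \<le> (a ^ i - b ^ i) * (a ^ (r - i) - b ^ (r - i))"
    proof (cases "a \<le> b")
      case True
      then show ?thesis using ab by (intro mult_nonpos_nonpos) (auto intro: power_mono)
    next
      case False
      then show ?thesis using ab by (intro mult_nonneg_nonneg) (auto intro: power_mono)
    qed
    moreover have "a ^ i * a ^ (r - i) = a ^ r" "b ^ i * b ^ (r - i) = b ^ r"
      using that by (simp_all flip: power_add)
    ultimately have "b ^ (r - i) * a ^ i + b ^ i * a ^ (r - i) \<le> a ^ r + b ^ r"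
      by (simp add: algebra_simps)
    moreover have "a ^ r = x ^ r" "b ^ r = y ^ r" using assms by (auto simp: a_def b_def power_even_abs)
    moreover have "y ^ (r - i) * x ^ i \<le> b ^ (r - i) * a ^ i" "y ^ i * x ^ (r - i) \<le> b ^ i * a ^ (r - i)"
      using abs_ge_self[of "y ^ (r - i) * x ^ i"] abs_ge_self[of "y ^ i * x ^ (r - i)"]
      by (simp_all add: abs_mult power_abs a_def b_def)
    ultimately show ?thesis by linarith
  qed
  have "s = (\<Sum>i<Suc r. y ^ i * x ^ (r - i))"
    unfolding s_def
    by (subst sum.nat_diff_reindex[symmetric]) (auto intro!: sum.cong)
  then have "2 * s = (\<Sum>i<Suc r. y ^ (r - i) * x ^ i + y ^ i * x ^ (r - i))"
    by (simp add: s_def sum.distrib)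
  also have "\<dots> \<le> (\<Sum>i<Suc r. x ^ r + y ^ r)" by (intro sum_mono pair) simp
  finally have "s \<le> real (Suc r) / 2 * (x ^ r + y ^ r)" by simp
  then have "(x - y)\<^sup>2 * s \<le> (x - y)\<^sup>2 * (real (Suc r) / 2 * (x ^ r + y ^ r))"
    by (intro mult_left_mono) auto
  moreover have "x ^ Suc r - y ^ Suc r = (x - y) * s"
    unfolding s_def by (subst power_diff_sumr2) simp
  ultimately show ?thesis by (simp add: power2_eq_square mult_ac)
qed

text \<open>Both sides are diagonal in the entries of \<open>h\<close> with respect to the two eigenbases \<open>u\<close> and \<open>v\<close>,
  so that the claim reduces to the scalar inequality above. No operator convexity is needed.\<close>

lemma trace_power_difference_le:
  assumes u: "spectral_decomposition n a u lam" and v: "spectral_decomposition n b v mu"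
    and diff: "\<And>i j. i < n \<Longrightarrow> j < n \<Longrightarrow> a i j - b i j = 2 * h i j"
    and "even r"
  shows "(\<Sum>k<n. lam k ^ Suc r * dotn n (u k) (appn n h (u k))) -
      (\<Sum>l<n. mu l ^ Suc r * dotn n (v l) (appn n h (v l)))
    \<le> real (Suc r) * ((\<Sum>k<n. lam k ^ r * dotn n (appn n h (u k)) (appn n h (u k))) +
      (\<Sum>l<n. mu l ^ r * dotn n (appn n h (v l)) (appn n h (v l))))"
proof -
  define c where "c k l = dotn n (u k) (v l)" for k l
  define g where "g k l = dotn n (u k) (appn n h (v l))" for k l
  have sym: "h i j = h j i" if "i < n" "j < n" for i j
    using diff[of i j] diff[of j i] that spectral_decomposition_symmetric[OF u that]
      spectral_decomposition_symmetric[OF v that] by simp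
  have g': "dotn n (v l) (appn n h (u k)) = g k l" for k l
    using dotn_appn_symmetric[of n h "v l" "u k"] sym by (simp add: g_def dotn_commute)
  \<comment> \<open>In the mixed entry of \<open>a - b\<close>, the eigenvector equation of
    \<open>a\<close> applies on the left and that of \<open>b\<close> on the right. This makes
    \<open>h\<close> explicit although \<open>a\<close> and \<open>b\<close> have no common
    eigenbasis.\<close>
  have gc: "g k l = (lam k - mu l) * c k l / 2" if "k < n" "l < n" for k l
  proof -
    have "2 * g k l = dotn n (u k) (\<lambda>i. appn n a (v l) i - appn n b (v l) i)"
      unfolding g_def appn_def dotn_def
      by (simp add: sum_distrib_left sum_subtractf[symmetric] left_diff_distrib[symmetric] diff mult_ac)
    also have "\<dots> = lam k * c k l - dotn n (u k) (\<lambda>i. mu l * v l i)"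
      unfolding dotn_diff_right c_def spectral_decomposition_dotn_appn[OF u that(1)]
      using spectral_decomposition_eigen[OF v that(2)] by (simp add: dotn_def)
    finally show ?thesis by (simp add: dotn_scale_right c_def algebra_simps)
  qed
  have uu: "dotn n (u k) (appn n h (u k)) = (\<Sum>l<n. c k l * g k l)" for k
    using spectral_decomposition_parseval[OF v, of "u k" "appn n h (u k)"]
    by (simp add: g' c_def dotn_commute)
  have vv: "dotn n (v l) (appn n h (v l)) = (\<Sum>k<n. c k l * g k l)" for l
    using spectral_decomposition_parseval[OF u, of "v l" "appn n h (v l)"]
    by (simp add: g_def c_def)
  have hu: "dotn n (appn n h (u k)) (appn n h (u k)) = (\<Sum>l<n. (g k l)\<^sup>2)" for k
    unfolding spectral_decomposition_parseval[OF v, of "appn n h (u k)"] g' by (simp add: power2_eq_square)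
  have hv: "dotn n (appn n h (v l)) (appn n h (v l)) = (\<Sum>k<n. (g k l)\<^sup>2)" for l
    unfolding spectral_decomposition_parseval[OF u, of "appn n h (v l)"] g_def by (simp add: power2_eq_square)
  have "(\<Sum>k<n. lam k ^ Suc r * dotn n (u k) (appn n h (u k))) -
      (\<Sum>l<n. mu l ^ Suc r * dotn n (v l) (appn n h (v l)))
    = (\<Sum>k<n. \<Sum>l<n. lam k ^ Suc r * (c k l * g k l)) - (\<Sum>l<n. \<Sum>k<n. mu l ^ Suc r * (c k l * g k l))"
    unfolding uu vv by (simp add: sum_distrib_left)
  also have "\<dots> = (\<Sum>k<n. \<Sum>l<n. lam k ^ Suc r * (c k l * g k l) - mu l ^ Suc r * (c k l * g k l))"
    by (subst (2) sum.swap) (simp add: sum_subtractf)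
  also have "\<dots> \<le> (\<Sum>k<n. \<Sum>l<n. real (Suc r) * (lam k ^ r * (g k l)\<^sup>2 + mu l ^ r * (g k l)\<^sup>2))"
  proof (intro sum_mono)
    fix k l assume "k \<in> {..<n}" "l \<in> {..<n}"
    then have e: "g k l = (lam k - mu l) * c k l / 2" by (simp add: gc)
    have "(c k l)\<^sup>2 / 2 * ((lam k ^ Suc r - mu l ^ Suc r) * (lam k - mu l))
        \<le> (c k l)\<^sup>2 / 2 * (real (Suc r) / 2 * (lam k ^ r + mu l ^ r) * (lam k - mu l)\<^sup>2)"
      by (intro mult_left_mono power_diff_times_diff_le assms) auto
    moreover have "lam k ^ Suc r * (c k l * g k l) - mu l ^ Suc r * (c k l * g k l)
        = (c k l)\<^sup>2 / 2 * ((lam k ^ Suc r - mu l ^ Suc r) * (lam k - mu l))"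
    proof -
      have cg: "c k l * g k l = (c k l)\<^sup>2 / 2 * (lam k - mu l)" unfolding e by (simp add: power2_eq_square)
      have "P * (C * t) - Q * (C * t) = C * ((P - Q) * t)" for P Q C t :: real
        by (simp add: algebra_simps)
      then show ?thesis unfolding cg .
    qed
    moreover have "real (Suc r) * (lam k ^ r * (g k l)\<^sup>2 + mu l ^ r * (g k l)\<^sup>2)
        = (c k l)\<^sup>2 / 2 * (real (Suc r) / 2 * (lam k ^ r + mu l ^ r) * (lam k - mu l)\<^sup>2)"
    proof -
      have "(g k l)\<^sup>2 = (lam k - mu l)\<^sup>2 * (c k l)\<^sup>2 / 4"
        unfolding e by (simp add: power_divide power_mult_distrib)
      moreover have "N * (L * (t * C / 4) + M * (t * C / 4)) = C / 2 * (N / 2 * (L + M) * t)"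
        for N L M t C :: real by (simp add: algebra_simps)
      ultimately show ?thesis by (simp only:)
    qed
    ultimately show "lam k ^ Suc r * (c k l * g k l) - mu l ^ Suc r * (c k l * g k l)
        \<le> real (Suc r) * (lam k ^ r * (g k l)\<^sup>2 + mu l ^ r * (g k l)\<^sup>2)" by linarith
  qed
  also have "\<dots> = real (Suc r) * ((\<Sum>k<n. \<Sum>l<n. lam k ^ r * (g k l)\<^sup>2) + (\<Sum>k<n. \<Sum>l<n. mu l ^ r * (g k l)\<^sup>2))"
    by (simp add: sum_distrib_left sum.distrib distrib_left del: of_nat_Suc)
  also have "(\<Sum>k<n. \<Sum>l<n. mu l ^ r * (g k l)\<^sup>2) = (\<Sum>l<n. \<Sum>k<n. mu l ^ r * (g k l)\<^sup>2)"
    by (rule sum.swap)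
  finally show ?thesis unfolding hu hv by (simp add: sum_distrib_left del: of_nat_Suc)
qed

section \<open>Averages over all sign vectors\<close>

definition set_sign :: "'j set \<Rightarrow> 'j \<Rightarrow> real" where
  "set_sign E j = (if j \<in> E then 1 else - 1)"

definition sign_sum :: "('j \<Rightarrow> nat \<Rightarrow> nat \<Rightarrow> real) \<Rightarrow> 'j set \<Rightarrow> nat \<Rightarrow> nat \<Rightarrow> real" where
  "sign_sum A E = (\<lambda>a b. \<Sum>j\<in>UNIV. set_sign E j * A j a b)"

text \<open>A sign vector is encoded as the set of its positive positions. Turning sign
  \<open>j\<close> positive is then an \<open>insert\<close>, and the sets split into pairs that
  differ in \<open>j\<close> only.\<close>

lemma sum_all_sets_split:
  fixes F :: "'j::finite set \<Rightarrow> real"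
  shows "(\<Sum>E\<in>UNIV. F E) = (\<Sum>E\<in>Pow (- {j}). F (insert j E) + F E)"
proof -
  have U: "(UNIV :: 'j set set) = Pow (- {j}) \<union> insert j ` Pow (- {j})"
  proof -
    have "E \<in> Pow (- {j}) \<union> insert j ` Pow (- {j})" for E
    proof (cases "j \<in> E")
      case True
      then have "E = insert j (E - {j})" "E - {j} \<in> Pow (- {j})" by auto
      then show ?thesis by blast
    qed auto
    then show ?thesis by blast
  qed
  have inj: "inj_on (insert j) (Pow (- {j}))" by (auto simp: inj_on_def)
  have "(\<Sum>E\<in>UNIV. F E) = (\<Sum>E\<in>Pow (- {j}). F E) + (\<Sum>E\<in>insert j ` Pow (- {j}). F E)"
    by (subst U, rule sum.union_disjoint) auto
  also have "(\<Sum>E\<in>insert j ` Pow (- {j}). F E) = (\<Sum>E\<in>Pow (- {j}). F (insert j E))"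
    using sum.reindex[OF inj] by (simp add: o_def)
  finally show ?thesis by (simp add: sum.distrib)
qed

lemma sum_rotate3:
  "(\<Sum>E\<in>P. \<Sum>k\<in>Q. \<Sum>j\<in>R. F E k j) = (\<Sum>j\<in>R. \<Sum>E\<in>P. \<Sum>k\<in>Q. (F E k j :: real))"
proof -
  have "(\<Sum>E\<in>P. \<Sum>k\<in>Q. \<Sum>j\<in>R. F E k j) = (\<Sum>E\<in>P. \<Sum>j\<in>R. \<Sum>k\<in>Q. F E k j)"
    by (intro sum.cong refl sum.swap)
  also have "\<dots> = (\<Sum>j\<in>R. \<Sum>E\<in>P. \<Sum>k\<in>Q. F E k j)" by (rule sum.swap)
  finally show ?thesis .
qed

text \<open>The discrete analogue of Gaussian integration by parts: pairing the sign vectors that differ in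
  the sign \<open>j\<close> only produces trace differences as in the previous lemma.\<close>

lemma sign_sum_moment_step:
  fixes A :: "'j::finite \<Rightarrow> nat \<Rightarrow> nat \<Rightarrow> real"
  assumes u: "\<And>E. spectral_decomposition n (sign_sum A E) (u E) (lam E)"
    and le: "\<And>v. (\<Sum>j\<in>UNIV. dotn n (appn n (A j) v) (appn n (A j) v)) \<le> dotn n v v"
    and "even r"
  shows "(\<Sum>E\<in>UNIV. \<Sum>k<n. lam E k ^ Suc (Suc r)) \<le> real (Suc r) * (\<Sum>E\<in>UNIV. \<Sum>k<n. lam E k ^ r)"
proof -
  define g where "g j E = (\<Sum>k<n. lam E k ^ Suc r * dotn n (u E k) (appn n (A j) (u E k)))" for j E
  define q where "q j E = (\<Sum>k<n. lam E k ^ r * dotn n (appn n (A j) (u E k)) (appn n (A j) (u E k)))" for j E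
  \<comment> \<open>The Rayleigh quotient of a fixed eigenvector is linear in the signs. Only one of
    the \<open>r + 2\<close> factors \<open>lam E k\<close> is expanded in this way; the others, and
    the eigenvector, still depend on the signs and are handled by the pairing.\<close>
  have lam: "lam E k = (\<Sum>j\<in>UNIV. set_sign E j * dotn n (u E k) (appn n (A j) (u E k)))" if "k < n" for E k
  proof -
    have "lam E k = dotn n (u E k) (appn n (sign_sum A E) (u E k))"
      using spectral_decomposition_dotn_appn[OF u that] spectral_decomposition_unit[OF u that] by simp
    also have "\<dots> = (\<Sum>i<n. \<Sum>l<n. \<Sum>j\<in>UNIV. set_sign E j * (u E k i * (A j i l * u E k l)))"
      by (simp add: dotn_def appn_def sign_sum_def sum_distrib_left sum_distrib_right mult_ac)
    also have "\<dots> = (\<Sum>j\<in>UNIV. \<Sum>i<n. \<Sum>l<n. set_sign E j * (u E k i * (A j i l * u E k l)))"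
      by (rule sum_rotate3)
    finally show ?thesis by (simp add: dotn_def appn_def sum_distrib_left)
  qed
  have "(\<Sum>E\<in>UNIV. \<Sum>k<n. lam E k ^ Suc (Suc r)) = (\<Sum>E\<in>UNIV. \<Sum>k<n. lam E k ^ Suc r * lam E k)"
    by (simp add: mult_ac)
  also have "\<dots> = (\<Sum>E\<in>UNIV. \<Sum>k<n. lam E k ^ Suc r *
      (\<Sum>j\<in>UNIV. set_sign E j * dotn n (u E k) (appn n (A j) (u E k))))"
    by (intro sum.cong refl arg_cong2[of _ _ _ _ "(*)"] lam) auto
  also have "\<dots> = (\<Sum>E\<in>UNIV. \<Sum>k<n. \<Sum>j\<in>UNIV. set_sign E j *
      (lam E k ^ Suc r * dotn n (u E k) (appn n (A j) (u E k))))"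
    by (simp add: sum_distrib_left mult_ac)
  also have "\<dots> = (\<Sum>j\<in>UNIV. \<Sum>E\<in>UNIV. set_sign E j * g j E)"
    unfolding g_def sum_distrib_left by (rule sum_rotate3)
  also have "\<dots> \<le> (\<Sum>j\<in>UNIV. \<Sum>E\<in>UNIV. real (Suc r) * q j E)"
  proof (rule sum_mono)
    fix j :: 'j
    have "(\<Sum>E\<in>UNIV. set_sign E j * g j E) = (\<Sum>E\<in>Pow (- {j}). g j (insert j E) - g j E)"
      by (subst sum_all_sets_split[of _ j]) (auto simp: set_sign_def intro!: sum.cong)
    also have "\<dots> \<le> (\<Sum>E\<in>Pow (- {j}). real (Suc r) * q j (insert j E) + real (Suc r) * q j E)"
    proof (intro sum_mono)
      fix E assume E: "E \<in> Pow (- {j})"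
      \<comment> \<open>Flipping one sign shifts the matrix by twice \<open>A j\<close>, which is
        the factor 2 in the hypothesis of the trace comparison.\<close>
      have s: "set_sign (insert j E) k = set_sign E k + (if k = j then 2 else 0)" for k
        using E by (auto simp: set_sign_def)
      have "sign_sum A (insert j E) a b - sign_sum A E a b = 2 * A j a b" for a b
      proof -
        have "set_sign (insert j E) k * A k a b - set_sign E k * A k a b = (if k = j then 2 * A j a b else 0)" for k
          unfolding s by (simp add: algebra_simps)
        then show ?thesis
          by (simp add: sign_sum_def sum_subtractf[symmetric])
      qed
      then show "g j (insert j E) - g j E \<le> real (Suc r) * q j (insert j E) + real (Suc r) * q j E"
        unfolding g_def q_def
        using trace_power_difference_le[OF u[of "insert j E"] u[of E] _ \<open>even r\<close>, of "A j"]
        by (simp add: distrib_left del: of_nat_Suc)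
    qed
    also have "\<dots> = (\<Sum>E\<in>UNIV. real (Suc r) * q j E)"
      by (rule sum_all_sets_split[symmetric])
    finally show "(\<Sum>E\<in>UNIV. set_sign E j * g j E) \<le> (\<Sum>E\<in>UNIV. real (Suc r) * q j E)" .
  qed
  also have "\<dots> = real (Suc r) * (\<Sum>j\<in>UNIV. \<Sum>E\<in>UNIV. q j E)"
    by (simp only: sum_distrib_left)
  also have "(\<Sum>j\<in>UNIV. \<Sum>E\<in>UNIV. q j E) = (\<Sum>E\<in>UNIV. \<Sum>k<n. \<Sum>j\<in>UNIV.
      lam E k ^ r * dotn n (appn n (A j) (u E k)) (appn n (A j) (u E k)))"
    unfolding q_def by (rule sum_rotate3[symmetric])
  also have "real (Suc r) * (\<Sum>E\<in>UNIV. \<Sum>k<n. \<Sum>j\<in>UNIV.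
      lam E k ^ r * dotn n (appn n (A j) (u E k)) (appn n (A j) (u E k)))
    \<le> real (Suc r) * (\<Sum>E\<in>UNIV. \<Sum>k<n. lam E k ^ r)"
  proof (rule mult_left_mono, intro sum_mono)
    fix E :: "'j set" and k assume "k \<in> {..<n}"
    then have "(\<Sum>j\<in>UNIV. dotn n (appn n (A j) (u E k)) (appn n (A j) (u E k))) \<le> 1"
      using le[of "u E k"] spectral_decomposition_unit[OF u, of k E] by simp
    then show "(\<Sum>j\<in>UNIV. lam E k ^ r * dotn n (appn n (A j) (u E k)) (appn n (A j) (u E k))) \<le> lam E k ^ r"
      using mult_left_mono[OF _ zero_le_even_power[OF \<open>even r\<close>, of "lam E k"], of _ 1]
      unfolding sum_distrib_left[symmetric] by auto
  qed simp
  finally show ?thesis .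
qed

text \<open>Iteration from \<open>p = 0\<close>, where the sum counts eigenvalues, produces the
  product 1 * 3 * ... * (2p - 1), the moment of order \<open>2 * p\<close> of a standard Gaussian.
  Its factorial form is the one that cancels against the series of cosh.\<close>

lemma sign_sum_moment_bound:
  fixes A :: "'j::finite \<Rightarrow> nat \<Rightarrow> nat \<Rightarrow> real"
  assumes u: "\<And>E. spectral_decomposition n (sign_sum A E) (u E) (lam E)"
    and le: "\<And>v. (\<Sum>j\<in>UNIV. dotn n (appn n (A j) v) (appn n (A j) v)) \<le> dotn n v v"
  shows "(\<Sum>E\<in>UNIV. \<Sum>k<n. lam E k ^ (2 * p))
    \<le> real (CARD('j set)) * real n * (fact (2 * p) / (2 ^ p * fact p))"
proof (induction p)
  case 0
  show ?case by simp
next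
  case (Suc p)
  have "(\<Sum>E\<in>UNIV. \<Sum>k<n. lam E k ^ (2 * Suc p))
      \<le> real (Suc (2 * p)) * (\<Sum>E\<in>UNIV. \<Sum>k<n. lam E k ^ (2 * p))"
    using sign_sum_moment_step[OF u le, of "2 * p"] by simp
  also have "\<dots> \<le> real (Suc (2 * p)) *
      (real (CARD('j set)) * real n * (fact (2 * p) / (2 ^ p * fact p)))"
    by (intro mult_left_mono Suc.IH) simp
  also have "\<dots> = real (CARD('j set)) * real n * (fact (2 * Suc p) / (2 ^ Suc p * fact (Suc p)))"
  proof -
    have "fact (2 * Suc p) = real (2 * Suc p) * (real (Suc (2 * p)) * fact (2 * p))"
      by (simp add: algebra_simps)
    moreover have "2 ^ Suc p * fact (Suc p) = real (2 * Suc p) * (2 ^ p * fact p)"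
      by (simp add: algebra_simps)
    ultimately have "fact (2 * Suc p) / (2 ^ Suc p * fact (Suc p)) =
        (real (2 * Suc p) * (real (Suc (2 * p)) * fact (2 * p))) / (real (2 * Suc p) * (2 ^ p * fact p) :: real)"
      by (simp only:)
    also have "\<dots> = real (Suc (2 * p)) * (fact (2 * p) / (2 ^ p * fact p))"
      by (subst mult_divide_mult_cancel_left) simp_all
    finally show ?thesis by (simp del: of_nat_Suc power_Suc fact_Suc)
  qed
  finally show ?case .
qed

text \<open>The function cosh is used because its series has only even powers, whose moments are
  bounded. Termwise, the factorials \<open>fact (2 * p)\<close> cancel and the series of
  \<open>exp (s\<^sup>2 / 2)\<close> remains.\<close>

lemma sum_cosh_sign_sum_le:
  fixes A :: "'j::finite \<Rightarrow> nat \<Rightarrow> nat \<Rightarrow> real"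
  assumes u: "\<And>E. spectral_decomposition n (sign_sum A E) (u E) (lam E)"
    and le: "\<And>v. (\<Sum>j\<in>UNIV. dotn n (appn n (A j) v) (appn n (A j) v)) \<le> dotn n v v"
  shows "(\<Sum>E\<in>UNIV. \<Sum>k<n. cosh (s * lam E k)) \<le> real (CARD('j set)) * real n * exp (s\<^sup>2 / 2)"
proof (rule sums_le)
  let ?N = "real (CARD('j set)) * real n"
  show "(\<lambda>m. \<Sum>E\<in>UNIV. \<Sum>k<n. if even m then (s * lam E k) ^ m /\<^sub>R fact m else 0)
      sums (\<Sum>E\<in>UNIV. \<Sum>k<n. cosh (s * lam E k))"
    by (intro sums_sum cosh_converges)
  have "(\<lambda>m. ?N * ((s\<^sup>2 / 2) ^ m /\<^sub>R fact m)) sums (?N * exp (s\<^sup>2 / 2))"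
    by (intro sums_mult exp_converges)
  from sums_if[OF sums_zero this]
  show "(\<lambda>m. if even m then ?N * ((s\<^sup>2 / 2) ^ (m div 2) /\<^sub>R fact (m div 2)) else 0) sums (?N * exp (s\<^sup>2 / 2))"
    by simp
  show "(\<Sum>E\<in>UNIV. \<Sum>k<n. if even m then (s * lam E k) ^ m /\<^sub>R fact m else 0)
      \<le> (if even m then ?N * ((s\<^sup>2 / 2) ^ (m div 2) /\<^sub>R fact (m div 2)) else 0)" for m
  proof (cases "even m")
    case True
    then obtain p where m: "m = 2 * p" by blast
    have "(\<Sum>E\<in>UNIV. \<Sum>k<n. (s * lam E k) ^ m /\<^sub>R fact m)
        = s ^ (2 * p) / fact (2 * p) * (\<Sum>E\<in>UNIV. \<Sum>k<n. lam E k ^ (2 * p))"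
      by (simp add: m power_mult_distrib sum_distrib_left divide_inverse mult_ac)
    also have "\<dots> \<le> s ^ (2 * p) / fact (2 * p) * (?N * (fact (2 * p) / (2 ^ p * fact p)))"
      by (intro mult_left_mono sign_sum_moment_bound[OF u le]) (simp add: power_mult)
    also have "\<dots> = ?N * ((s\<^sup>2 / 2) ^ p /\<^sub>R fact p)"
    proof -
      have "(s\<^sup>2 / 2) ^ p = s ^ (2 * p) / 2 ^ p" by (simp only: power_divide power_mult)
      moreover have "x / F * (M * (F / (t * G))) = M * (x / t /\<^sub>R G)" if "F \<noteq> 0" for x F M t G :: real
        using that by (simp add: divide_inverse mult_ac)
      ultimately show ?thesis using fact_nonzero[of "2 * p", where 'a = real] by (simp only:)
    qed
    finally show ?thesis using True by (simp add: m)
  qed simp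
qed

lemma exp_abs_less_two_cosh: "exp \<bar>x\<bar> < 2 * cosh (x :: real)"
  by (cases "0 \<le> x") (simp_all add: cosh_def)

text \<open>An averaging argument: some sign vector has potential at most its mean bound
  \<open>D * (2 * D)\<close>. All terms of the potential are positive, so this bounds every
  eigenvalue of every block simultaneously.\<close>

lemma exists_signs_blocks_bounded_aux:
  fixes A :: "'b::finite \<Rightarrow> 'j::finite \<Rightarrow> nat \<Rightarrow> nat \<Rightarrow> real" and d :: "'b \<Rightarrow> nat"
  assumes sym: "\<And>b j i l. i < d b \<Longrightarrow> l < d b \<Longrightarrow> A b j i l = A b j l i"
    and le: "\<And>b v. (\<Sum>j\<in>UNIV. dotn (d b) (appn (d b) (A b j) v) (appn (d b) (A b j) v)) \<le> dotn (d b) v v"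
    and D: "D = (\<Sum>b\<in>UNIV. d b)" "0 < D"
  shows "\<exists>E. \<forall>b v. dotn (d b) (appn (d b) (sign_sum (A b) E) v) (appn (d b) (sign_sum (A b) E) v)
    \<le> 2 * ln (2 * real D) * dotn (d b) v v"
proof -
  have "\<exists>u lam. spectral_decomposition (d b) (sign_sum (A b) E) u lam" for b E
    by (rule exists_spectral_decomposition) (simp add: sign_sum_def sym)
  then obtain u lam where u: "\<And>b E. spectral_decomposition (d b) (sign_sum (A b) E) (u b E) (lam b E)"
    by metis
  \<comment> \<open>The choice with \<open>exp (s\<^sup>2 / 2) = 2 * D\<close>: twice the mean bound
    is then exactly \<open>exp (s\<^sup>2)\<close>, so that \<open>\<bar>s * lam\<bar>\<close> stays
    below \<open>s\<^sup>2\<close>.\<close>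
  define s where "s = sqrt (2 * ln (2 * real D))"
  have "1 < 2 * real D" using D(2) by simp
  then have "0 < ln (2 * real D)" by (rule ln_gt_zero)
  then have s2: "s\<^sup>2 = 2 * ln (2 * real D)" and s0: "0 < s" by (auto simp: s_def)
  have es: "exp (s\<^sup>2 / 2) = 2 * real D" using D(2) by (simp add: s2)
  define \<Phi> where "\<Phi> E = (\<Sum>b\<in>UNIV. \<Sum>k<d b. cosh (s * lam b E k))" for E
  have "(\<Sum>E\<in>UNIV. \<Phi> E) = (\<Sum>b\<in>UNIV. \<Sum>E\<in>UNIV. \<Sum>k<d b. cosh (s * lam b E k))"
    unfolding \<Phi>_def by (rule sum.swap)
  also have "\<dots> \<le> (\<Sum>b\<in>UNIV. real (CARD('j set)) * real (d b) * exp (s\<^sup>2 / 2))"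
    by (intro sum_mono sum_cosh_sign_sum_le[OF u] le)
  also have "\<dots> = (\<Sum>E::'j set\<in>UNIV. real D * (2 * real D))"
    by (simp add: D(1) es sum_distrib_left sum_distrib_right mult_ac)
  finally have "\<not> (\<forall>E::'j set. real D * (2 * real D) < \<Phi> E)"
    using sum_strict_mono[of UNIV "\<lambda>E::'j set. real D * (2 * real D)" \<Phi>] by force
  then obtain E where E: "\<Phi> E \<le> real D * (2 * real D)" by (meson not_le)
  have lam: "(lam b E k)\<^sup>2 \<le> s\<^sup>2" if "k < d b" for b k
  proof -
    have "cosh (s * lam b E k) \<le> (\<Sum>k<d b. cosh (s * lam b E k))"
      by (rule member_le_sum) (use that in auto)
    also have "\<dots> \<le> \<Phi> E"
      unfolding \<Phi>_def by (rule member_le_sum) (auto intro: sum_nonneg)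
    finally have "exp \<bar>s * lam b E k\<bar> < 2 * (real D * (2 * real D))"
      using E exp_abs_less_two_cosh[of "s * lam b E k"] by linarith
    also have "\<dots> = exp (s\<^sup>2 / 2 + s\<^sup>2 / 2)" unfolding exp_add es by simp
    finally have "\<bar>s * lam b E k\<bar> < s\<^sup>2" by simp
    then have "s * \<bar>lam b E k\<bar> < s * s" using s0 by (simp add: abs_mult power2_eq_square)
    then have "\<bar>lam b E k\<bar> \<le> \<bar>s\<bar>" using s0 by simp
    then show ?thesis by (simp only: abs_le_square_iff)
  qed
  show ?thesis
  proof (intro exI[of _ E] allI)
    fix b v
    have "dotn (d b) (appn (d b) (sign_sum (A b) E) v) (appn (d b) (sign_sum (A b) E) v)
        \<le> (\<Sum>k<d b. s\<^sup>2 * (dotn (d b) (u b E k) v)\<^sup>2)"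
      unfolding spectral_decomposition_norm_appn[OF u]
      by (intro sum_mono mult_right_mono lam) auto
    also have "\<dots> = s\<^sup>2 * dotn (d b) v v"
      unfolding spectral_decomposition_parseval[OF u[of b E], of v v]
      by (simp add: sum_distrib_left power2_eq_square)
    finally show "dotn (d b) (appn (d b) (sign_sum (A b) E) v) (appn (d b) (sign_sum (A b) E) v)
        \<le> 2 * ln (2 * real D) * dotn (d b) v v" by (simp add: s2)
  qed
qed

lemma appn_scale_matrix: "appn n (\<lambda>i j. c * a i j) v = (\<lambda>i. c * appn n a v i)"
  by (simp add: appn_def sum_distrib_left mult_ac)

text \<open>The bounds \<open>\<rho> b\<close> are coordinates of a point of a monotonic set and may
  vanish, so the reduction to bound 1 by rescaling needs a separate case.\<close>

lemma exists_signs_blocks_bounded: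
  fixes A :: "'b::finite \<Rightarrow> 'j::finite \<Rightarrow> nat \<Rightarrow> nat \<Rightarrow> real" and d :: "'b \<Rightarrow> nat"
  assumes sym: "\<And>b j i l. i < d b \<Longrightarrow> l < d b \<Longrightarrow> A b j i l = A b j l i"
    and le: "\<And>b v. (\<Sum>j\<in>UNIV. dotn (d b) (appn (d b) (A b j) v) (appn (d b) (A b j) v)) \<le> \<rho> b * dotn (d b) v v"
    and \<rho>: "\<And>b. 0 \<le> \<rho> b"
    and D: "D = (\<Sum>b\<in>UNIV. d b)" "0 < D"
  shows "\<exists>E. \<forall>b v. dotn (d b) (appn (d b) (sign_sum (A b) E) v) (appn (d b) (sign_sum (A b) E) v)
    \<le> 2 * ln (2 * real D) * \<rho> b * dotn (d b) v v"
proof -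
  \<comment> \<open>If \<open>\<rho> b = 0\<close>, division by zero gives 0 and the rescaled block
    is the zero matrix, which satisfies the normalized hypothesis.\<close>
  define A' where "A' b j = (\<lambda>i l. (1 / sqrt (\<rho> b)) * A b j i l)" for b j
  have sq: "1 / sqrt (\<rho> b) * (1 / sqrt (\<rho> b)) = 1 / \<rho> b" for b using \<rho>[of b] by simp
  have "(\<Sum>j\<in>UNIV. dotn (d b) (appn (d b) (A' b j) v) (appn (d b) (A' b j) v)) \<le> dotn (d b) v v" for b v
  proof -
    have "(\<Sum>j\<in>UNIV. dotn (d b) (appn (d b) (A' b j) v) (appn (d b) (A' b j) v))
        = (1 / \<rho> b) * (\<Sum>j\<in>UNIV. dotn (d b) (appn (d b) (A b j) v) (appn (d b) (A b j) v))"
      unfolding A'_def appn_scale_matrix dotn_scale_left dotn_scale_right mult.assoc[symmetric] sq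
      by (simp add: sum_distrib_left)
    also have "\<dots> \<le> (1 / \<rho> b) * (\<rho> b * dotn (d b) v v)"
      using \<rho>[of b] by (intro mult_left_mono le) auto
    also have "\<dots> \<le> dotn (d b) v v"
      using dotn_self_nonneg[of "d b" v] by (cases "\<rho> b = 0") auto
    finally show ?thesis .
  qed
  moreover have "A' b j i l = A' b j l i" if "i < d b" "l < d b" for b j i l
    using sym that by (simp add: A'_def)
  ultimately obtain E where E: "\<forall>b v. dotn (d b) (appn (d b) (sign_sum (A' b) E) v) (appn (d b) (sign_sum (A' b) E) v)
      \<le> 2 * ln (2 * real D) * dotn (d b) v v"
    using exists_signs_blocks_bounded_aux[OF _ _ D, of A'] by blast
  show ?thesis
  proof (intro exI[of _ E] allI)
    fix b v
    show "dotn (d b) (appn (d b) (sign_sum (A b) E) v) (appn (d b) (sign_sum (A b) E) v)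
      \<le> 2 * ln (2 * real D) * \<rho> b * dotn (d b) v v"
    proof (cases "\<rho> b = 0")
      \<comment> \<open>The original block is not recovered from the zero block; instead the
        hypothesis kills each \<open>A b j\<close> on its own, and with it every signed sum.\<close>
      case True
      have "dotn (d b) (appn (d b) (A b j) v) (appn (d b) (A b j) v) = 0" for j
      proof (rule order_antisym[OF _ dotn_self_nonneg])
        have "dotn (d b) (appn (d b) (A b j) v) (appn (d b) (A b j) v)
            \<le> (\<Sum>j\<in>UNIV. dotn (d b) (appn (d b) (A b j) v) (appn (d b) (A b j) v))"
          by (rule member_le_sum) (auto simp: dotn_self_nonneg)
        also have "\<dots> \<le> 0" using le[of b v] by (simp add: True)
        finally show "dotn (d b) (appn (d b) (A b j) v) (appn (d b) (A b j) v) \<le> 0" .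
      qed
      then have z: "appn (d b) (A b j) v i = 0" if "i < d b" for i j
        using that by (simp add: dotn_self_eq_0_iff)
      have "appn (d b) (sign_sum (A b) E) v i = (\<Sum>j\<in>UNIV. set_sign E j * appn (d b) (A b j) v i)" for i
        unfolding appn_def sign_sum_def sum_distrib_right sum_distrib_left
        by (subst sum.swap) (simp add: mult_ac)
      then have "dotn (d b) (appn (d b) (sign_sum (A b) E) v) (appn (d b) (sign_sum (A b) E) v) = 0"
        using z by (simp add: dotn_def)
      then show ?thesis using True by simp
    next
      case False
      have "A b j i l = sqrt (\<rho> b) * A' b j i l" for j i l using False \<rho>[of b] by (simp add: A'_def)
      then have "sign_sum (A b) E = (\<lambda>i l. sqrt (\<rho> b) * sign_sum (A' b) E i l)"
        by (simp add: sign_sum_def sum_distrib_left mult_ac)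
      then have "dotn (d b) (appn (d b) (sign_sum (A b) E) v) (appn (d b) (sign_sum (A b) E) v)
        = \<rho> b * dotn (d b) (appn (d b) (sign_sum (A' b) E) v) (appn (d b) (sign_sum (A' b) E) v)"
        using \<rho>[of b] by (simp add: appn_scale_matrix dotn_scale_left dotn_scale_right mult.assoc[symmetric])
      also have "\<dots> \<le> \<rho> b * (2 * ln (2 * real D) * dotn (d b) v v)"
        using E \<rho> by (intro mult_left_mono) blast+
      finally show ?thesis by (simp only: mult.left_commute mult.assoc)
    qed
  qed
qed

section \<open>Quadratic forms of the semidefinite program\<close>

definition mat_fun :: "real mat \<Rightarrow> nat \<Rightarrow> nat \<Rightarrow> real" where
  "mat_fun M = (\<lambda>a b. M $$ (a, b))"

definition lin_fun :: "('i::finite \<Rightarrow> real mat) \<Rightarrow> real^'i \<Rightarrow> nat \<Rightarrow> nat \<Rightarrow> real" where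
  "lin_fun M x = (\<lambda>a b. \<Sum>i\<in>UNIV. x $ i * M i $$ (a, b))"

text \<open>For fixed \<open>v\<close>, the entry \<open>c\<close> of the matrix
  \<open>lin_fun M x\<close> applied to \<open>v\<close> is linear in \<open>x\<close>; this is the
  vector representing that functional. It separates \<open>x\<close> from \<open>v\<close> in all
  later forms.\<close>

definition col_vec :: "nat \<Rightarrow> ('i::finite \<Rightarrow> real mat) \<Rightarrow> (nat \<Rightarrow> real) \<Rightarrow> nat \<Rightarrow> real^'i" where
  "col_vec d M v c = (\<chi> i. \<Sum>b<d. M i $$ (c, b) * v b)"

definition outer :: "real^'m \<Rightarrow> real^'n \<Rightarrow> real^'n^'m" where
  "outer a b = (\<chi> i j. a $ i * b $ j)"

text \<open>Bilinear forms become linear functionals of their matrix, which is how they pass through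
  sums, limits and separation.\<close>

lemma inner_outer: "M \<bullet> outer a b = a \<bullet> (M *v b)"
  by (simp add: inner_vec_def outer_def matrix_vector_mult_def sum_distrib_left mult_ac)

lemma outer_matrix_vector: "outer a b *v w = (b \<bullet> w) *\<^sub>R a"
  by (simp add: Finite_Cartesian_Product.vec_eq_iff outer_def matrix_vector_mult_def inner_vec_def
      sum_distrib_left mult_ac)

lemma norm_outer: "norm (outer a b) = norm a * norm b"
proof -
  have "outer a b \<bullet> outer a b = (a \<bullet> a) * (b \<bullet> b)"
    by (simp add: inner_outer outer_matrix_vector)
  then show ?thesis by (simp add: norm_eq_sqrt_inner real_sqrt_mult)
qed

lemma dotn_appn_lin_fun:
  "dotn d (appn d (lin_fun M x) v) (appn d (lin_fun M x) v) = (\<Sum>c<d. (x \<bullet> col_vec d M v c)\<^sup>2)"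
proof -
  have "appn d (lin_fun M x) v c = x \<bullet> col_vec d M v c" for c
    unfolding appn_def lin_fun_def col_vec_def inner_vec_def sum_distrib_right
    by (subst sum.swap) (simp add: sum_distrib_left mult_ac)
  then show ?thesis by (simp add: dotn_def power2_eq_square)
qed

lemma sym_matsD:
  assumes "M \<in> sym_mats d"
  shows "M \<in> carrier_mat d d" "dim_row M = d" "dim_col M = d"
    "a < d \<Longrightarrow> b < d \<Longrightarrow> M $$ (a, b) = M $$ (b, a)"
proof -
  show c: "M \<in> carrier_mat d d" "dim_row M = d" "dim_col M = d"
    using assms by (auto simp: sym_mats_def)
  have t: "transpose_mat M = M" using assms by (simp add: sym_mats_def)
  show "M $$ (a, b) = M $$ (b, a)" if "a < d" "b < d"
  proof -
    have "transpose_mat M $$ (a, b) = M $$ (b, a)" using that c by simp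
    then show ?thesis by (simp add: t)
  qed
qed

lemma sym_matsI:
  assumes "M \<in> carrier_mat d d" "\<And>a b. a < d \<Longrightarrow> b < d \<Longrightarrow> M $$ (a, b) = M $$ (b, a)"
  shows "M \<in> sym_mats d"
  using assms by (auto simp: sym_mats_def intro!: eq_matI)

lemma psd_mat_iff:
  assumes "M \<in> sym_mats d"
  shows "psd_mat M \<longleftrightarrow> (\<forall>v. 0 \<le> dotn d v (appn d (mat_fun M) v))"
proof -
  have M: "M \<in> carrier_mat d d" "dim_row M = d" using sym_matsD[OF assms] by auto
  have eq: "scalar_prod w (M *\<^sub>v w) = dotn d (vec_index w) (appn d (mat_fun M) (vec_index w))"
    if "w \<in> carrier_vec d" for w
    using that M by (simp add: scalar_prod_def dotn_def appn_def mat_fun_def lessThan_atLeast0)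
  have eq': "scalar_prod (Matrix.vec d v) (M *\<^sub>v Matrix.vec d v) = dotn d v (appn d (mat_fun M) v)" for v
    using M by (simp add: scalar_prod_def dotn_def appn_def mat_fun_def lessThan_atLeast0)
  show ?thesis
  proof
    assume "psd_mat M"
    then have "0 \<le> scalar_prod (Matrix.vec d v) (M *\<^sub>v Matrix.vec d v)" for v
      using M by (simp add: psd_mat_def)
    then show "\<forall>v. 0 \<le> dotn d v (appn d (mat_fun M) v)" by (simp only: eq') simp
  next
    assume "\<forall>v. 0 \<le> dotn d v (appn d (mat_fun M) v)"
    then show "psd_mat M" using assms M eq by (simp add: psd_mat_def)
  qed
qed

lemma dotn_cong:
  "(\<And>i. i < n \<Longrightarrow> v i = v' i) \<Longrightarrow> (\<And>i. i < n \<Longrightarrow> w i = w' i) \<Longrightarrow> dotn n v w = dotn n v' w'"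
  by (simp add: dotn_def)

text \<open>By symmetry of the matrix \<open>Y\<close>, the form of its square at \<open>v\<close>
  is the squared length of \<open>Y\<close> applied to \<open>v\<close>.\<close>

lemma square_loewner_le_iff:
  assumes "\<And>i. M i \<in> sym_mats d"
  shows "lin_comb_mat d M x * lin_comb_mat d M x \<preceq>\<^sub>m t \<cdot>\<^sub>m 1\<^sub>m d \<longleftrightarrow>
    (\<forall>v. dotn d (appn d (lin_fun M x) v) (appn d (lin_fun M x) v) \<le> t * dotn d v v)"
proof -
  let ?Y = "lin_comb_mat d M x" and ?y = "lin_fun M x"
  let ?Z = "t \<cdot>\<^sub>m 1\<^sub>m d - ?Y * ?Y"
  have Y: "?Y \<in> carrier_mat d d" "dim_row ?Y = d" "dim_col ?Y = d" by (auto simp: lin_comb_mat_def)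
  have y: "?Y $$ (a, b) = ?y a b" if "a < d" "b < d" for a b
    using that by (simp add: lin_comb_mat_def lin_fun_def)
  have ysym: "?y a b = ?y b a" if "a < d" "b < d" for a b
    using sym_matsD(4)[OF assms that] by (simp add: lin_fun_def)
  have Z: "?Z $$ (a, b) = t * (if a = b then 1 else 0) - (\<Sum>c<d. ?y a c * ?y c b)"
    if "a < d" "b < d" for a b
    using that Y by (simp add: scalar_prod_def lessThan_atLeast0 y)
  have "?Z \<in> sym_mats d"
  proof (rule sym_matsI)
    show "?Z $$ (a, b) = ?Z $$ (b, a)" if "a < d" "b < d" for a b
      unfolding Z[OF that] Z[OF that(2,1)] using ysym that by (auto simp: mult.commute intro!: sum.cong)
  qed (use Y in auto)
  moreover have "dotn d v (appn d (mat_fun ?Z) v) = t * dotn d v v - dotn d (appn d ?y v) (appn d ?y v)" for v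
  proof -
    have "appn d (mat_fun ?Z) v a = t * v a - appn d ?y (appn d ?y v) a" if "a < d" for a
    proof -
      have "appn d (mat_fun ?Z) v a = (\<Sum>b<d. t * (if a = b then 1 else 0) * v b) - (\<Sum>b<d. (\<Sum>c<d. ?y a c * ?y c b) * v b)"
        using that Z by (simp add: appn_def mat_fun_def left_diff_distrib sum_subtractf)
      also have "(\<Sum>b<d. t * (if a = b then 1 else 0) * v b) = t * v a"
        using that by (simp add: if_distrib if_distribR sum.delta cong: if_cong)
      also have "(\<Sum>b<d. (\<Sum>c<d. ?y a c * ?y c b) * v b) = appn d ?y (appn d ?y v) a"
        unfolding appn_def sum_distrib_left sum_distrib_right
        by (subst sum.swap) (simp add: mult_ac)
      finally show ?thesis .
    qed
    then have "dotn d v (appn d (mat_fun ?Z) v) = dotn d v (\<lambda>a. t * v a - appn d ?y (appn d ?y v) a)"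
      by (intro dotn_cong) auto
    also have "\<dots> = t * dotn d v v - dotn d (appn d ?y v) (appn d ?y v)"
      using dotn_appn_symmetric[of d ?y v "appn d ?y v"] ysym by (simp add: dotn_diff_right dotn_scale_right)
    finally show ?thesis .
  qed
  ultimately show ?thesis unfolding loewner_le_def by (subst psd_mat_iff[of _ d]) auto
qed

lemma basic_spectratope_iff:
  assumes "\<And>k i. R k i \<in> sym_mats (d k)"
  shows "x \<in> basic_spectratope d R T \<longleftrightarrow>
    (\<exists>t\<in>T. \<forall>k v. (\<Sum>c<d k. (x \<bullet> col_vec (d k) (R k) v c)\<^sup>2) \<le> t $ k * dotn (d k) v v)"
  by (simp add: basic_spectratope_def square_loewner_le_iff[OF assms] dotn_appn_lin_fun)

text \<open>Since \<open>X\<close> is symmetric, both orders of the product have the same trace and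
  the factor 1/2 disappears.\<close>

lemma adj_map_entry:
  assumes X: "X \<in> sym_mats d" and M: "\<And>i. M i \<in> sym_mats d"
  shows "adj_map M X $ i $ j = (\<Sum>a<d. \<Sum>b<d. \<Sum>c<d. X $$ (a, b) * (M i $$ (c, a) * M j $$ (c, b)))"
proof -
  note X' = sym_matsD[OF X] and M' = sym_matsD[OF M]
  define F where "F i j = (\<Sum>a<d. \<Sum>b<d. \<Sum>c<d. X $$ (a, b) * (M i $$ (c, a) * M j $$ (c, b)))" for i j
  have e: "(M i * M j) $$ (b, a) = (\<Sum>c<d. M i $$ (c, b) * M j $$ (c, a))" if "a < d" "b < d" for i j a b
    using that M'(1)[of i] M'(1)[of j] M'(4)[of b _ i] M'(2,3)
    by (auto simp: scalar_prod_def lessThan_atLeast0 intro!: sum.cong)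
  have FF: "F j i = F i j"
  proof -
    have "F j i = (\<Sum>b<d. \<Sum>a<d. \<Sum>c<d. X $$ (a, b) * (M j $$ (c, a) * M i $$ (c, b)))"
      unfolding F_def by (rule sum.swap)
    also have "\<dots> = F i j"
      unfolding F_def by (intro sum.cong refl) (use X'(4) in \<open>auto simp: mult_ac\<close>)
    finally show ?thesis .
  qed
  have "trace_mat (X * (M i * M j + M j * M i)) = (\<Sum>a<d. \<Sum>b<d. X $$ (a, b) * ((M i * M j) $$ (b, a) + (M j * M i) $$ (b, a)))"
    using X'(1) M'(1)[of i] M'(1)[of j] M'(2,3) X'(2,3)
    by (simp add: trace_mat_def scalar_prod_def lessThan_atLeast0)
  also have "\<dots> = F j i + F i j"
    unfolding F_def sum.distrib[symmetric]
    by (intro sum.cong refl) (simp add: e sum_distrib_left distrib_left sum.distrib mult_ac)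
  finally show ?thesis using FF by (simp add: adj_map_def F_def)
qed

lemma transpose_adj_map:
  assumes X: "X \<in> sym_mats d" and M: "\<And>i. M i \<in> sym_mats d"
  shows "transpose (adj_map M X) = adj_map M X"
proof -
  have "adj_map M X $ i $ j = adj_map M X $ j $ i" for i j
  proof -
    have "M i * M j + M j * M i = M j * M i + M i * M j"
      by (rule comm_add_mat[of _ d d]) (use sym_matsD(1)[OF M] in \<open>auto intro: mult_carrier_mat\<close>)
    then show ?thesis by (simp add: adj_map_def)
  qed
  then show ?thesis by (simp add: Finite_Cartesian_Product.transpose_def Finite_Cartesian_Product.vec_eq_iff)
qed

section \<open>Evaluation of the adjoint maps through rank one decompositions\<close>

definition rank_one :: "nat \<Rightarrow> real \<Rightarrow> (nat \<Rightarrow> real) \<Rightarrow> real mat" where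
  "rank_one d y v = Matrix.mat d d (\<lambda>(a, b). y * v a * v b)"

lemma rank_one_sym: "rank_one d y v \<in> sym_mats d"
  by (rule sym_matsI) (auto simp: rank_one_def)

lemma psd_rank_one:
  assumes "0 \<le> y"
  shows "psd_mat (rank_one d y v)"
proof -
  have "dotn d w (appn d (mat_fun (rank_one d y v)) w) = y * (dotn d v w)\<^sup>2" for w
    by (simp add: dotn_def appn_def mat_fun_def rank_one_def power2_eq_square sum_product
        sum_distrib_left mult_ac)
  then show ?thesis using assms by (simp add: psd_mat_iff[OF rank_one_sym])
qed

lemma trace_rank_one: "trace_mat (rank_one d y v) = y * dotn d v v"
  by (simp add: trace_mat_def rank_one_def dotn_def sum_distrib_left mult_ac)

text \<open>A term \<open>v k a * v k b\<close> of \<open>X\<close> contributes the outer squares of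
  the vectors \<open>col_vec d M (v k) c\<close>, and pairing with \<open>U\<close> evaluates its
  form on them. The index set and the weights are left general to cover spectral decompositions, the
  identity and a single rank one matrix.\<close>

lemma inner_adj_map_decomposed:
  assumes X: "X \<in> sym_mats d" and M: "\<And>i. M i \<in> sym_mats d"
    and dec: "\<And>a b. a < d \<Longrightarrow> b < d \<Longrightarrow> X $$ (a, b) = (\<Sum>k\<in>K. lam k * (v k a * v k b))"
  shows "U \<bullet> adj_map M X = (\<Sum>k\<in>K. lam k * (\<Sum>c<d. col_vec d M (v k) c \<bullet> (U *v col_vec d M (v k) c)))"
proof -
  have "adj_map M X $ i $ j = (\<Sum>k\<in>K. lam k * (\<Sum>c<d. col_vec d M (v k) c $ i * col_vec d M (v k) c $ j))" for i j
  proof -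
    have "adj_map M X $ i $ j = (\<Sum>a<d. \<Sum>b<d. \<Sum>c<d. \<Sum>k\<in>K. lam k * (v k a * v k b) * (M i $$ (c, a) * M j $$ (c, b)))"
      unfolding adj_map_entry[OF X M] by (intro sum.cong refl) (simp add: dec sum_distrib_right)
    also have "\<dots> = (\<Sum>a<d. \<Sum>k\<in>K. \<Sum>b<d. \<Sum>c<d. lam k * (v k a * v k b) * (M i $$ (c, a) * M j $$ (c, b)))"
      by (intro sum.cong refl sum_rotate3)
    also have "\<dots> = (\<Sum>k\<in>K. \<Sum>a<d. \<Sum>b<d. \<Sum>c<d. lam k * (v k a * v k b) * (M i $$ (c, a) * M j $$ (c, b)))"
      by (rule sum.swap)
    also have "\<dots> = (\<Sum>k\<in>K. \<Sum>c<d. \<Sum>a<d. \<Sum>b<d. lam k * (v k a * v k b) * (M i $$ (c, a) * M j $$ (c, b)))"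
      by (intro sum.cong refl sum_rotate3)
    also have "\<dots> = (\<Sum>k\<in>K. lam k * (\<Sum>c<d. col_vec d M (v k) c $ i * col_vec d M (v k) c $ j))"
    proof -
      have "col_vec d M (v k) c $ i * col_vec d M (v k) c $ j
          = (\<Sum>a<d. \<Sum>b<d. (v k a * v k b) * (M i $$ (c, a) * M j $$ (c, b)))" for k c
        unfolding col_vec_def vec_lambda_beta by (subst sum_product) (simp only: mult_ac)
      then show ?thesis by (simp only: sum_distrib_left mult.assoc)
    qed
    finally show ?thesis .
  qed
  then have "adj_map M X = (\<Sum>k\<in>K. lam k *\<^sub>R (\<Sum>c<d. outer (col_vec d M (v k) c) (col_vec d M (v k) c)))"
    by (simp add: Finite_Cartesian_Product.vec_eq_iff outer_def)
  then show ?thesis by (simp add: inner_sum_right inner_outer)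
qed

lemma inner_adj_map_rank_one:
  assumes M: "\<And>i. M i \<in> sym_mats d"
  shows "U \<bullet> adj_map M (rank_one d y v) = y * (\<Sum>c<d. col_vec d M v c \<bullet> (U *v col_vec d M v c))"
  by (subst inner_adj_map_decomposed[OF rank_one_sym M, where K = "{0::nat}" and lam = "\<lambda>_. y" and v = "\<lambda>_. v"])
    (auto simp: rank_one_def)

lemma psd_spectral_decomposition:
  assumes "X \<in> sym_mats d" "psd_mat X"
  shows "\<exists>u lam. spectral_decomposition d (mat_fun X) u lam \<and> (\<forall>k<d. 0 \<le> lam k)"
proof -
  have "mat_fun X a b = mat_fun X b a" if "a < d" "b < d" for a b
    using sym_matsD(4)[OF assms(1) that] by (simp add: mat_fun_def)
  then obtain u lam where u: "spectral_decomposition d (mat_fun X) u lam"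
    using exists_spectral_decomposition by blast
  have "0 \<le> lam k" if "k < d" for k
    using assms(2) spectral_decomposition_dotn_appn[OF u that, of "u k"] spectral_decomposition_unit[OF u that]
    unfolding psd_mat_iff[OF assms(1)] by (metis mult.right_neutral)
  then show ?thesis using u by blast
qed

lemma trace_spectral_decomposition:
  assumes u: "spectral_decomposition d (mat_fun X) u lam" and "X \<in> sym_mats d"
  shows "trace_mat X = (\<Sum>k<d. lam k)"
proof -
  have "trace_mat X = (\<Sum>a<d. \<Sum>k<d. lam k * (u k a * u k a))"
    using u sym_matsD(2)[OF assms(2)] by (simp add: trace_mat_def spectral_decomposition_def mat_fun_def)
  also have "\<dots> = (\<Sum>k<d. \<Sum>a<d. lam k * (u k a * u k a))" by (rule sum.swap)
  also have "\<dots> = (\<Sum>k<d. lam k * dotn d (u k) (u k))" by (simp add: dotn_def sum_distrib_left)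
  finally show ?thesis using spectral_decomposition_unit[OF u] by simp
qed

lemma adj_map_quadratic_form:
  assumes X: "X \<in> sym_mats d" and M: "\<And>i. M i \<in> sym_mats d"
    and dec: "\<And>a b. a < d \<Longrightarrow> b < d \<Longrightarrow> X $$ (a, b) = (\<Sum>k\<in>K. lam k * (v k a * v k b))"
  shows "x \<bullet> (adj_map M X *v x) = (\<Sum>k\<in>K. lam k * (\<Sum>c<d. (x \<bullet> col_vec d M (v k) c)\<^sup>2))"
proof -
  have "w \<bullet> (outer x x *v w) = (x \<bullet> w)\<^sup>2" for w
    unfolding outer_matrix_vector by (simp add: power2_eq_square inner_commute)
  moreover have "x \<bullet> (adj_map M X *v x) = outer x x \<bullet> adj_map M X"
    unfolding inner_outer[symmetric] by (rule inner_commute)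
  ultimately show ?thesis by (simp add: inner_adj_map_decomposed[OF X M dec])
qed

text \<open>On an eigenbasis of \<open>X\<close> the hypothesis is used at unit vectors only, so
  each eigenvalue is weighted by at most \<open>t\<close>.\<close>

lemma adj_map_form_le:
  assumes X: "X \<in> sym_mats d" "psd_mat X" and M: "\<And>i. M i \<in> sym_mats d"
    and le: "\<And>v. (\<Sum>c<d. (x \<bullet> col_vec d M v c)\<^sup>2) \<le> t * dotn d v v"
  shows "x \<bullet> (adj_map M X *v x) \<le> t * trace_mat X"
proof -
  obtain u lam where u: "spectral_decomposition d (mat_fun X) u lam" and lam: "\<forall>k<d. 0 \<le> lam k"
    using psd_spectral_decomposition[OF X] by blast
  have dec: "X $$ (a, b) = (\<Sum>k\<in>{..<d}. lam k * (u k a * u k b))" if "a < d" "b < d" for a b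
    using u that by (simp add: spectral_decomposition_def mat_fun_def)
  have form: "x \<bullet> (adj_map M X *v x) = (\<Sum>k<d. lam k * (\<Sum>c<d. (x \<bullet> col_vec d M (u k) c)\<^sup>2))"
    by (rule adj_map_quadratic_form[OF X(1) M]) (rule dec)
  have "x \<bullet> (adj_map M X *v x) \<le> (\<Sum>k<d. lam k * t)"
    unfolding form
  proof (intro sum_mono mult_left_mono)
    show "(\<Sum>c<d. (x \<bullet> col_vec d M (u k) c)\<^sup>2) \<le> t" if "k \<in> {..<d}" for k
      using le[of "u k"] spectral_decomposition_unit[OF u, of k] that by simp
  qed (use lam in auto)
  also have "\<dots> = t * trace_mat X"
    by (simp add: trace_spectral_decomposition[OF u X(1)] sum_distrib_left mult_ac)
  finally show ?thesis .
qed

lemma trace_psd_nonneg: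
  assumes "X \<in> sym_mats d" "psd_mat X"
  shows "0 \<le> trace_mat X"
  using psd_spectral_decomposition[OF assms] trace_spectral_decomposition[OF _ assms(1)]
  by (metis lessThan_iff sum_nonneg)

text \<open>This turns a bound on traces, the only thing that the objective sees, into compactness
  of the matrix variables.\<close>

lemma psd_entry_le_trace:
  assumes X: "X \<in> sym_mats d" "psd_mat X" and ab: "a < d" "b < d"
  shows "\<bar>X $$ (a, b)\<bar> \<le> trace_mat X"
proof -
  obtain u lam where u: "spectral_decomposition d (mat_fun X) u lam" and lam: "\<forall>k<d. 0 \<le> lam k"
    using psd_spectral_decomposition[OF X] by blast
  have le1: "\<bar>u k i\<bar> \<le> 1" if "k < d" "i < d" for k i
  proof -
    have "u k i * u k i \<le> dotn d (u k) (u k)"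
      unfolding dotn_def by (rule member_le_sum) (use that in auto)
    then have "(u k i)\<^sup>2 \<le> 1" using spectral_decomposition_unit[OF u that(1)] by (simp add: power2_eq_square)
    then show ?thesis by (simp add: abs_square_le_1)
  qed
  have "\<bar>X $$ (a, b)\<bar> = \<bar>\<Sum>k<d. lam k * (u k a * u k b)\<bar>"
    using u ab by (simp add: spectral_decomposition_def mat_fun_def)
  also have "\<dots> \<le> (\<Sum>k<d. \<bar>lam k * (u k a * u k b)\<bar>)" by (rule sum_abs)
  also have "\<dots> \<le> (\<Sum>k<d. lam k)"
  proof (rule sum_mono)
    fix k assume k: "k \<in> {..<d}"
    have "\<bar>u k a\<bar> * \<bar>u k b\<bar> \<le> 1 * 1" using k ab by (intro mult_mono le1) auto
    then have "lam k * (\<bar>u k a\<bar> * \<bar>u k b\<bar>) \<le> lam k * 1" using lam k by (intro mult_left_mono) auto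
    then show "\<bar>lam k * (u k a * u k b)\<bar> \<le> lam k" using lam k by (simp add: abs_mult)
  qed
  finally show ?thesis using trace_spectral_decomposition[OF u X(1)] by simp
qed

text \<open>\<open>P\<close> and \<open>W\<close> need not be symmetric. The cone of these triples then has interior points in the
  space of all triples, so that a functional separating it from another set is not trivial on it.\<close>

definition form_nonneg :: "real^'p^'p \<Rightarrow> real^'q^'p \<Rightarrow> real^'q^'q \<Rightarrow> bool" where
  "form_nonneg P Q W \<longleftrightarrow> (\<forall>u x. 0 \<le> u \<bullet> (P *v u) + 2 * (u \<bullet> (Q *v x)) + x \<bullet> (W *v x))"

lemma sum_UNIV_sum_type:
  fixes F :: "'a::finite + 'b::finite \<Rightarrow> real"
  shows "(\<Sum>i\<in>UNIV. F i) = (\<Sum>a\<in>UNIV. F (Inl a)) + (\<Sum>b\<in>UNIV. F (Inr b))"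
  by (simp add: UNIV_Plus_UNIV[symmetric] sum.Plus del: UNIV_Plus_UNIV)

lemma psd_block_matrix_iff:
  fixes P :: "real^'p::finite^'p" and Q :: "real^'q::finite^'p" and W :: "real^'q^'q"
  assumes "transpose P = P" "transpose W = W"
  shows "psd_matrix (block_matrix P Q (transpose Q) W) \<longleftrightarrow> form_nonneg P Q W"
proof -
  let ?M = "block_matrix P Q (transpose Q) W"
  have P: "P $ i $ j = P $ j $ i" for i j
    using arg_cong[OF assms(1), of "\<lambda>M. M $ i $ j"] by (simp add: Finite_Cartesian_Product.transpose_def)
  have W: "W $ i $ j = W $ j $ i" for i j
    using arg_cong[OF assms(2), of "\<lambda>M. M $ i $ j"] by (simp add: Finite_Cartesian_Product.transpose_def)
  have sym: "transpose ?M = ?M"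
    unfolding Finite_Cartesian_Product.vec_eq_iff
    by (auto simp: Finite_Cartesian_Product.transpose_def block_matrix_def P W split: sum.splits)
  have form: "v \<bullet> (?M *v v) = u \<bullet> (P *v u) + 2 * (u \<bullet> (Q *v x)) + x \<bullet> (W *v x)"
    if u: "\<And>i. v $ Inl i = u $ i" and x: "\<And>j. v $ Inr j = x $ j"
    for v :: "real^('p + 'q)" and u x
  proof -
    have "x \<bullet> (transpose Q *v u) = u \<bullet> (Q *v x)"
      by (metis dot_lmul_matrix inner_commute transpose_matrix_vector)
    moreover have "v \<bullet> (?M *v v) = u \<bullet> (P *v u) + u \<bullet> (Q *v x) + x \<bullet> (transpose Q *v u) + x \<bullet> (W *v x)"
      by (simp add: inner_vec_def matrix_vector_mult_def sum_UNIV_sum_type block_matrix_def u x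
          distrib_left sum.distrib)
    ultimately show ?thesis by simp
  qed
  show ?thesis
  proof
    assume psd: "psd_matrix ?M"
    show "form_nonneg P Q W"
      unfolding form_nonneg_def
    proof (intro allI)
      fix u x
      define v :: "real^('p + 'q)" where "v = (\<chi> i. case i of Inl a \<Rightarrow> u $ a | Inr b \<Rightarrow> x $ b)"
      have "0 \<le> v \<bullet> (?M *v v)" using psd by (simp add: psd_matrix_def)
      then show "0 \<le> u \<bullet> (P *v u) + 2 * (u \<bullet> (Q *v x)) + x \<bullet> (W *v x)"
        by (subst (asm) form[of v u x]) (auto simp: v_def)
    qed
  next
    assume nonneg: "form_nonneg P Q W"
    have "0 \<le> v \<bullet> (?M *v v)" for v
      using nonneg form[of v "\<chi> i. v $ Inl i" "\<chi> j. v $ Inr j"] by (simp add: form_nonneg_def)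
    then show "psd_matrix ?M" using sym by (simp add: psd_matrix_def)
  qed
qed

lemma transpose_sum:
  fixes F :: "'i \<Rightarrow> real^'n^'m"
  shows "transpose (\<Sum>i\<in>I. F i) = (\<Sum>i\<in>I. transpose (F i))"
  by (simp add: Finite_Cartesian_Product.vec_eq_iff Finite_Cartesian_Product.transpose_def)

lemma sdp_feasible_iff:
  assumes R: "\<And>k i. R k i \<in> sym_mats (d k)" and S: "\<And>l i. S l i \<in> sym_mats (f l)"
  shows "(H, Ups, Lam) \<in> sdp_feasible d R f S A B \<longleftrightarrow>
    (\<forall>l. Ups l \<in> sym_mats (f l) \<and> psd_mat (Ups l)) \<and>
    (\<forall>k. Lam k \<in> sym_mats (d k) \<and> psd_mat (Lam k)) \<and>
    form_nonneg (\<Sum>l\<in>UNIV. adj_map (S l) (Ups l)) ((1/2) *\<^sub>R (B - transpose H ** A))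
      (\<Sum>k\<in>UNIV. adj_map (R k) (Lam k))"
proof -
  have "transpose (\<Sum>l\<in>UNIV. adj_map (S l) (Ups l)) = (\<Sum>l\<in>UNIV. adj_map (S l) (Ups l))"
    if "\<forall>l. Ups l \<in> sym_mats (f l)"
    unfolding transpose_sum using that S by (intro sum.cong refl transpose_adj_map) auto
  moreover have "transpose (\<Sum>k\<in>UNIV. adj_map (R k) (Lam k)) = (\<Sum>k\<in>UNIV. adj_map (R k) (Lam k))"
    if "\<forall>k. Lam k \<in> sym_mats (d k)"
    unfolding transpose_sum using that R by (intro sum.cong refl transpose_adj_map) auto
  ultimately show ?thesis
    unfolding sdp_feasible_def by (auto simp: psd_block_matrix_iff)
qed

section \<open>Norms and the upper bound on the risk\<close>

lemma matrix_vector_mult_uminus: "(M :: real^'n^'m) *v (- x) = - (M *v x)"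
  by (rule linear_neg[OF matrix_vector_mul_linear])

lemma support_fun_upper:
  assumes "compact T" "t \<in> T"
  shows "g \<bullet> t \<le> support_fun T g"
proof -
  obtain C where "\<forall>x\<in>T. norm x \<le> C"
    using compact_imp_bounded[OF assms(1)] by (auto simp: bounded_iff)
  then have "g \<bullet> x \<le> norm g * C" if "x \<in> T" for x
    using that norm_cauchy_schwarz[of g x] mult_left_mono[of "norm x" C "norm g"] by fastforce
  then have "bdd_above ((\<lambda>t. g \<bullet> t) ` T)" by (rule bdd_aboveI2)
  then show ?thesis unfolding support_fun_def by (rule cSUP_upper2) (use assms in auto)
qed

lemma support_fun_least: "T \<noteq> {} \<Longrightarrow> (\<And>t. t \<in> T \<Longrightarrow> g \<bullet> t \<le> c) \<Longrightarrow> support_fun T g \<le> c"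
  unfolding support_fun_def by (rule cSUP_least) auto

section \<open>Arbitrary norms on \<open>real^'v\<close> and their conjugates\<close>

lemma is_normD:
  assumes "is_norm N"
  shows "0 \<le> N v" "N v = 0 \<longleftrightarrow> v = 0" "N 0 = 0" "v \<noteq> 0 \<Longrightarrow> 0 < N v"
    "N (c *\<^sub>R v) = \<bar>c\<bar> * N v" "N (v + w) \<le> N v + N w"
proof -
  have nonneg: "0 \<le> N v" and zero: "N v = 0 \<longleftrightarrow> v = 0" for v using assms unfolding is_norm_def by blast+
  show "0 \<le> N v" "N v = 0 \<longleftrightarrow> v = 0" "N 0 = 0" by (simp_all add: nonneg zero)
  show "0 < N v" if "v \<noteq> 0" using nonneg[of v] zero[of v] that by linarith
  show "N (c *\<^sub>R v) = \<bar>c\<bar> * N v" "N (v + w) \<le> N v + N w"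
    using assms unfolding is_norm_def by blast+
qed

lemma is_norm_le_norm:
  assumes N: "is_norm N"
  shows "\<exists>C\<ge>0. \<forall>v::real^'v. N v \<le> C * norm v"
proof (intro exI conjI allI)
  let ?C = "\<Sum>i\<in>UNIV. N (axis i 1 :: real^'v)"
  show "0 \<le> ?C" by (intro sum_nonneg is_normD[OF N])
  fix v :: "real^'v"
  have sub: "N (\<Sum>i\<in>I. g i) \<le> (\<Sum>i\<in>I. N (g i))" if "finite I" for I :: "'v set" and g
    using that
  proof (induction I rule: finite_induct)
    case empty
    then show ?case by (simp add: is_normD[OF N])
  next
    case (insert i I)
    have "N (g i + (\<Sum>i\<in>I. g i)) \<le> N (g i) + N (\<Sum>i\<in>I. g i)"
      by (rule is_normD[OF N])
    then show ?case using insert by simp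
  qed
  have "(\<Sum>i\<in>UNIV. v $ i *\<^sub>R axis i 1) = v"
    using basis_expansion[of v] by (simp add: scalar_mult_eq_scaleR)
  then have "N v \<le> (\<Sum>i\<in>UNIV. N (v $ i *\<^sub>R axis i 1))"
    using sub[of UNIV "\<lambda>i. v $ i *\<^sub>R axis i 1"] by simp
  also have "\<dots> \<le> (\<Sum>i\<in>UNIV. norm v * N (axis i 1))"
    unfolding is_normD(5)[OF N]
    by (intro sum_mono mult_right_mono is_normD(1)[OF N] component_le_norm_cart)
  finally show "N v \<le> ?C * norm v" by (simp add: sum_distrib_left sum_distrib_right mult_ac)
qed

lemma is_norm_continuous:
  fixes N :: "real^'v \<Rightarrow> real"
  assumes "is_norm N"
  shows "continuous_on UNIV N"
proof -
  obtain C where C: "C \<ge> 0" "\<And>v. N v \<le> C * norm v" using is_norm_le_norm[OF assms] by metis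
  have le: "N v \<le> N w + C * norm (v - w)" for v w
  proof -
    have "N (w + (v - w)) \<le> N w + N (v - w)" by (rule is_normD[OF assms])
    then show ?thesis using C(2)[of "v - w"] by simp
  qed
  have "\<bar>N v - N w\<bar> \<le> C * norm (v - w)" for v w
    using le[of v w] le[of w v] by (simp add: norm_minus_commute)
  then have "C-lipschitz_on UNIV N" using C(1) by (auto simp: lipschitz_on_def dist_norm)
  then show ?thesis by (rule lipschitz_on_continuous_on)
qed

lemma norm_le_is_norm:
  fixes N :: "real^'v \<Rightarrow> real"
  assumes "is_norm N"
  shows "\<exists>c>0. \<forall>v. c * norm v \<le> N v"
proof -
  have "axis undefined 1 \<in> (sphere 0 1 :: (real^'v) set)" by simp
  then have "\<exists>w\<in>sphere 0 1. \<forall>v\<in>sphere 0 1. N w \<le> N v"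
    by (intro continuous_attains_inf continuous_on_subset[OF is_norm_continuous[OF assms]]) auto
  then obtain w where w: "norm w = 1" "\<And>v. norm v = 1 \<Longrightarrow> N w \<le> N v" by auto
  have "w \<noteq> 0" using w(1) by auto
  then have pos: "0 < N w" by (rule is_normD[OF assms])
  have "N w * norm v \<le> N v" for v
  proof (cases "v = 0")
    case True
    then show ?thesis by (simp add: is_normD[OF assms])
  next
    case False
    have "N w \<le> N ((1 / norm v) *\<^sub>R v)" by (rule w(2)) (use False in simp)
    also have "\<dots> = N v / norm v" by (simp add: is_normD[OF assms])
    finally show ?thesis using False by (simp add: field_simps)
  qed
  then show ?thesis using pos by blast
qed

lemma inner_le_is_norm_if_conj_norm_le_1:
  assumes N: "is_norm N" and "conj_norm N u \<le> 1"
  shows "u \<bullet> v \<le> N v"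
proof (cases "v = 0")
  case True
  then show ?thesis by (simp add: is_normD[OF N])
next
  case False
  \<comment> \<open>\<open>conj_norm\<close> is a real supremum and bounds its members only if they
    are bounded above; this needs \<open>N\<close> to dominate a multiple of the Euclidean
    norm.\<close>
  obtain c where c: "c > 0" "\<And>v. c * norm v \<le> N v" using norm_le_is_norm[OF N] by metis
  have "u \<bullet> v \<le> norm u * (1 / c)" if "N v \<le> 1" for v
  proof -
    have "norm v \<le> 1 / c" using c(2)[of v] c(1) that by (simp add: field_simps)
    then show ?thesis
      using norm_cauchy_schwarz[of u v] mult_left_mono[of "norm v" "1 / c" "norm u"] by simp
  qed
  then have bdd: "bdd_above ((\<lambda>v. u \<bullet> v) ` {v. N v \<le> 1})" by (intro bdd_aboveI2) auto
  have pos: "0 < N v" using False by (rule is_normD[OF N])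
  then have "N ((1 / N v) *\<^sub>R v) \<le> 1" by (simp add: is_normD(5)[OF N])
  then have "u \<bullet> ((1 / N v) *\<^sub>R v) \<le> conj_norm N u"
    unfolding conj_norm_def by (intro cSUP_upper[OF _ bdd]) simp
  then have "(u \<bullet> v) / N v \<le> 1" using assms(2) by simp
  then show ?thesis using pos by simp
qed

text \<open>The bipolar argument. A functional separating \<open>v / c'\<close> from the unit ball
  of \<open>N\<close>, suitably normalized, has conjugate norm at most 1 and a value above
  \<open>c'\<close> at \<open>v\<close>. The intermediate \<open>c'\<close> makes division possible
  when \<open>c = 0\<close>.\<close>

lemma is_norm_le_if_conj_ball:
  fixes N :: "real^'v \<Rightarrow> real"
  assumes N: "is_norm N" and "0 \<le> c" and le: "\<And>u. conj_norm N u \<le> 1 \<Longrightarrow> u \<bullet> v \<le> c"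
  shows "N v \<le> c"
proof (rule ccontr)
  assume "\<not> N v \<le> c"
  then obtain c' where c': "c < c'" "c' < N v" using dense[of c "N v"] by auto
  then have "0 < c'" using \<open>0 \<le> c\<close> by simp
  define K where "K = {z. N z \<le> 1}"
  have "closed K"
    unfolding K_def by (rule closed_Collect_le[OF is_norm_continuous[OF N] continuous_on_const])
  moreover have "convex K"
    unfolding convex_def
  proof (intro ballI allI impI)
    fix x y :: "real^'v" and s t :: real
    assume "x \<in> K" "y \<in> K" and st: "0 \<le> s" "0 \<le> t" "s + t = 1"
    then have "N x \<le> 1" "N y \<le> 1" by (auto simp: K_def)
    then have le1: "s * N x \<le> s * 1" "t * N y \<le> t * 1" using st by (intro mult_left_mono; simp)+
    have "N (s *\<^sub>R x + t *\<^sub>R y) \<le> N (s *\<^sub>R x) + N (t *\<^sub>R y)" by (rule is_normD[OF N])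
    also have "\<dots> = s * N x + t * N y" using st by (simp add: is_normD(5)[OF N])
    finally show "s *\<^sub>R x + t *\<^sub>R y \<in> K" using le1 st by (simp add: K_def)
  qed
  moreover have "(1 / c') *\<^sub>R v \<notin> K"
    using c' \<open>0 < c'\<close> by (simp add: K_def is_normD(5)[OF N] field_simps)
  ultimately obtain a b where ab: "a \<bullet> ((1 / c') *\<^sub>R v) < b" "\<forall>z\<in>K. b < a \<bullet> z"
    using separating_hyperplane_closed_point by blast
  have z0: "0 \<in> K" by (simp add: K_def is_normD(3)[OF N])
  then have "b < a \<bullet> 0" using ab(2) by blast
  then have "b < 0" by simp
  \<comment> \<open>Since \<open>b < 0\<close>, dividing by \<open>b\<close> reverses the separating
    inequality and normalizes the bound on the ball to 1.\<close>
  have "conj_norm N ((1 / b) *\<^sub>R a) \<le> 1"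
    unfolding conj_norm_def
  proof (rule cSUP_least)
    show "{v. N v \<le> 1} \<noteq> {}" using z0 by (auto simp: K_def)
    show "((1 / b) *\<^sub>R a) \<bullet> z \<le> 1" if "z \<in> {v. N v \<le> 1}" for z
    proof -
      have "b < a \<bullet> z" using ab(2) that by (simp add: K_def)
      then show ?thesis using \<open>b < 0\<close> by (simp add: field_simps)
    qed
  qed
  then have "((1 / b) *\<^sub>R a) \<bullet> v \<le> c" by (rule le)
  moreover have "a \<bullet> v < b * c'" using ab(1) \<open>0 < c'\<close> by (simp add: field_simps)
  then have "c' < ((1 / b) *\<^sub>R a) \<bullet> v" using \<open>b < 0\<close> by (simp add: field_simps)
  ultimately show False using c'(1) by simp
qed

lemma basic_spectratope_dataD:
  assumes "basic_spectratope_data d R T"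
  shows "0 < d k" "R k i \<in> sym_mats (d k)" "monotonic_set T"
    "convex T" "compact T" "T \<noteq> {}" "t \<in> T \<Longrightarrow> 0 \<le> t $ k"
proof -
  note data = assms[unfolded basic_spectratope_data_def]
  show "0 < d k" by (rule data[THEN conjunct1, THEN spec])
  show "R k i \<in> sym_mats (d k)" by (rule data[THEN conjunct2, THEN conjunct1, THEN spec, THEN spec])
  show mono: "monotonic_set T" by (rule data[THEN conjunct2, THEN conjunct2, THEN conjunct1])
  note mono' = mono[unfolded monotonic_set_def]
  show "convex T" by (rule mono'[THEN conjunct1])
  show "compact T" by (rule mono'[THEN conjunct2, THEN conjunct1])
  show "0 \<le> t $ k" if "t \<in> T"
    using mono'[THEN conjunct2, THEN conjunct2, THEN conjunct1] that by simp
  show "T \<noteq> {}" using mono'[THEN conjunct2, THEN conjunct2, THEN conjunct2, THEN conjunct1] by auto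
qed

section \<open>Spectratopes and the bilinear bound from feasibility\<close>

lemma zero_mem_basic_spectratope:
  assumes "basic_spectratope_data d R T"
  shows "0 \<in> basic_spectratope d R T"
proof -
  obtain t where "t \<in> T" "\<forall>k. 0 \<le> t $ k" using basic_spectratope_dataD[OF assms] by blast
  then show ?thesis
    unfolding basic_spectratope_iff[of R d, OF basic_spectratope_dataD(2)[OF assms]]
    by (auto intro!: bexI[of _ t] mult_nonneg_nonneg dotn_self_nonneg)
qed

lemma uminus_mem_basic_spectratope:
  assumes "basic_spectratope_data d R T" "x \<in> basic_spectratope d R T"
  shows "- x \<in> basic_spectratope d R T"
  using assms(2) unfolding basic_spectratope_iff[of R d, OF basic_spectratope_dataD(2)[OF assms(1)]] by simp

lemma sum_adj_map_form_le:
  assumes data: "basic_spectratope_data d R T" and x: "x \<in> basic_spectratope d R T"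
    and X: "\<And>k. X k \<in> sym_mats (d k)" "\<And>k. psd_mat (X k)"
  shows "x \<bullet> ((\<Sum>k\<in>UNIV. adj_map (R k) (X k)) *v x) \<le> support_fun T (trace_vec X)"
proof -
  note D = basic_spectratope_dataD[OF data]
  have R: "\<And>k i. R k i \<in> sym_mats (d k)" by (rule D(2))
  obtain t where t: "t \<in> T" "\<And>k v. (\<Sum>c<d k. (x \<bullet> col_vec (d k) (R k) v c)\<^sup>2) \<le> t $ k * dotn (d k) v v"
    using x unfolding basic_spectratope_iff[of R d, OF R] by blast
  have "x \<bullet> ((\<Sum>k\<in>UNIV. adj_map (R k) (X k)) *v x) = (\<Sum>k\<in>UNIV. x \<bullet> (adj_map (R k) (X k) *v x))"
    by (simp add: inner_outer[symmetric] inner_sum_left)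
  also have "\<dots> \<le> (\<Sum>k\<in>UNIV. t $ k * trace_mat (X k))"
  proof (rule sum_mono)
    show "x \<bullet> (adj_map (R k) (X k) *v x) \<le> t $ k * trace_mat (X k)" for k
      by (rule adj_map_form_le[OF X R]) (rule t(2))
  qed
  also have "\<dots> = trace_vec X \<bullet> t" by (simp add: trace_vec_def inner_vec_def mult.commute)
  also have "\<dots> \<le> support_fun T (trace_vec X)" by (rule support_fun_upper[OF D(5) t(1)])
  finally show ?thesis .
qed

text \<open>The block form at \<open>(u, - x)\<close> has the opposite cross term, so nonnegativity
  bounds the bilinear form by the two diagonal ones.\<close>

lemma sdp_feasible_bilinear_bound:
  assumes R: "basic_spectratope_data d R T" and S: "basic_spectratope_data f S Rset"
    and feas: "(H, Ups, Lam) \<in> sdp_feasible d R f S A B"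
    and x: "x \<in> basic_spectratope d R T" and u: "u \<in> basic_spectratope f S Rset"
  shows "u \<bullet> ((B - transpose H ** A) *v x) \<le> sdp_objective T Rset (H, Ups, Lam)"
proof -
  let ?P = "\<Sum>l\<in>UNIV. adj_map (S l) (Ups l)" and ?W = "\<Sum>k\<in>UNIV. adj_map (R k) (Lam k)"
  let ?Q = "B - transpose H ** A"
  have U: "\<And>l. Ups l \<in> sym_mats (f l)" "\<And>l. psd_mat (Ups l)"
    and L: "\<And>k. Lam k \<in> sym_mats (d k)" "\<And>k. psd_mat (Lam k)"
    and form: "form_nonneg ?P ((1/2) *\<^sub>R ?Q) ?W"
    using feas
    unfolding sdp_feasible_iff[of R d S f, OF basic_spectratope_dataD(2)[OF R] basic_spectratope_dataD(2)[OF S]]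
    by auto
  have "0 \<le> u \<bullet> (?P *v u) + 2 * (u \<bullet> (((1/2) *\<^sub>R ?Q) *v (- x))) + (- x) \<bullet> (?W *v (- x))"
    using form unfolding form_nonneg_def by blast
  moreover have "u \<bullet> (((1/2) *\<^sub>R ?Q) *v (- x)) = - (u \<bullet> (?Q *v x)) / 2"
    by (simp add: matrix_vector_mult_uminus scaleR_matrix_vector_assoc[symmetric])
  moreover have "(- x) \<bullet> (?W *v (- x)) = x \<bullet> (?W *v x)" by (simp add: matrix_vector_mult_uminus)
  ultimately have "u \<bullet> (?Q *v x) \<le> u \<bullet> (?P *v u) + x \<bullet> (?W *v x)" by simp
  also have "\<dots> \<le> support_fun Rset (trace_vec Ups) + support_fun T (trace_vec Lam)"
    by (intro add_mono sum_adj_map_form_le[OF R x L] sum_adj_map_form_le[OF S u U])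
  finally show ?thesis by (simp add: sdp_objective_def)
qed

lemma risk_linear_estimate_le:
  assumes R: "basic_spectratope_data d R T" and S: "basic_spectratope_data f S Rset"
    and N: "is_norm N" and ball: "{u. conj_norm N u \<le> 1} = basic_spectratope f S Rset"
    and feas: "(H, Ups, Lam) \<in> sdp_feasible d R f S A B"
  shows "risk N A B (basic_spectratope d R T) (linear_estimate H) \<le> ereal (sdp_objective T Rset (H, Ups, Lam))"
  unfolding risk_def
proof (rule SUP_least)
  fix x assume x: "x \<in> basic_spectratope d R T"
  let ?c = "sdp_objective T Rset (H, Ups, Lam)"
  have "0 \<le> ?c"
    using sdp_feasible_bilinear_bound[OF R S feas x zero_mem_basic_spectratope[OF S]] by simp
  then have "N ((B - transpose H ** A) *v x) \<le> ?c"
    using sdp_feasible_bilinear_bound[OF R S feas x] ball by (intro is_norm_le_if_conj_ball[OF N]) auto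
  then show "ereal (N (B *v x - linear_estimate H (A *v x))) \<le> ereal ?c"
    by (simp add: linear_estimate_def matrix_vector_mult_diff_rdistrib matrix_vector_mul_assoc)
qed

lemma risk_ge_kernel_signal:
  assumes R: "basic_spectratope_data d R T" and N: "is_norm N"
    and x: "x \<in> basic_spectratope d R T" and "A *v x = 0"
  shows "ereal (N (B *v x)) \<le> risk N A B (basic_spectratope d R T) xhat"
proof -
  define p q where "p = B *v x - xhat 0" and "q = B *v (- x) - xhat 0"
  have "(1/2) *\<^sub>R p + (- (1/2)) *\<^sub>R q = B *v x"
    by (simp add: matrix_vector_mult_uminus p_def q_def algebra_simps flip: scaleR_left_distrib)
  then have "N (B *v x) = N ((1/2) *\<^sub>R p + (- (1/2)) *\<^sub>R q)" by simp
  also have "\<dots> \<le> N ((1/2) *\<^sub>R p) + N ((- (1/2)) *\<^sub>R q)"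
    by (rule is_normD[OF N])
  also have "\<dots> = (1/2) * N p + (1/2) * N q" unfolding is_normD(5)[OF N] by simp
  also have "\<dots> \<le> max (N p) (N q)" by simp
  finally have "ereal (N (B *v x)) \<le> max (ereal (N p)) (ereal (N q))" by (simp add: max_def split: if_splits)
  also have "\<dots> \<le> risk N A B (basic_spectratope d R T) xhat"
  proof (rule max.boundedI)
    show "ereal (N p) \<le> risk N A B (basic_spectratope d R T) xhat"
      unfolding risk_def by (rule SUP_upper2[OF x]) (simp add: p_def assms(4))
    show "ereal (N q) \<le> risk N A B (basic_spectratope d R T) xhat"
      unfolding risk_def
      by (rule SUP_upper2[OF uminus_mem_basic_spectratope[OF R x]])
        (simp add: q_def assms(4) matrix_vector_mult_uminus)
  qed
  finally show ?thesis .
qed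

section \<open>Attainment of the minimum\<close>

lemma positive_definite_coercive:
  fixes M :: "real^'n^'n"
  assumes pos: "\<And>u. u \<noteq> 0 \<Longrightarrow> 0 < u \<bullet> (M *v u)"
  shows "\<exists>\<delta>>0. \<forall>u. \<delta> * (norm u)\<^sup>2 \<le> u \<bullet> (M *v u)"
proof -
  have "axis undefined 1 \<in> (sphere 0 1 :: (real^'n) set)" by simp
  then have "\<exists>w\<in>sphere 0 1. \<forall>v\<in>sphere 0 1. w \<bullet> (M *v w) \<le> v \<bullet> (M *v v)"
    by (intro continuous_attains_inf continuous_intros) auto
  then obtain w where w: "norm w = 1" "\<And>v. norm v = 1 \<Longrightarrow> w \<bullet> (M *v w) \<le> v \<bullet> (M *v v)" by auto
  have "0 < w \<bullet> (M *v w)" using w(1) by (intro pos) auto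
  moreover have "w \<bullet> (M *v w) * (norm v)\<^sup>2 \<le> v \<bullet> (M *v v)" for v
  proof (cases "v = 0")
    case False
    have "w \<bullet> (M *v w) \<le> ((1 / norm v) *\<^sub>R v) \<bullet> (M *v ((1 / norm v) *\<^sub>R v))"
      by (rule w(2)) (use False in simp)
    also have "\<dots> = v \<bullet> (M *v v) / (norm v)\<^sup>2"
      by (simp add: matrix_vector_mult_scaleR power2_eq_square)
    finally show ?thesis using False by (simp add: field_simps)
  qed simp
  ultimately show ?thesis by blast
qed

lemma abs_form_le:
  fixes M :: "real^'n^'m"
  shows "\<bar>a \<bullet> (M *v b)\<bar> \<le> norm M * (norm a * norm b)"
  using Cauchy_Schwarz_ineq2[of M "outer a b"] by (simp add: inner_outer norm_outer)

text \<open>Positive definite diagonal blocks give an interior point of the cone. This is used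
  twice: a large multiple of such a point absorbs \<open>B\<close> and proves feasibility, and it
  makes the dual multiplier positive.\<close>

lemma form_nonneg_interior:
  fixes P0 :: "real^'p^'p" and W0 :: "real^'q^'q"
  assumes "\<And>u. u \<noteq> 0 \<Longrightarrow> 0 < u \<bullet> (P0 *v u)" and "\<And>x. x \<noteq> 0 \<Longrightarrow> 0 < x \<bullet> (W0 *v x)"
  shows "\<exists>e>0. \<forall>P Q W. norm P \<le> e \<and> norm Q \<le> e \<and> norm W \<le> e \<longrightarrow>
    form_nonneg (P0 + P) (Q :: real^'q^'p) (W0 + W)"
proof -
  obtain d1 where d1: "d1 > 0" "\<And>u. d1 * (norm u)\<^sup>2 \<le> u \<bullet> (P0 *v u)"
    using positive_definite_coercive[OF assms(1)] by metis
  obtain d2 where d2: "d2 > 0" "\<And>u. d2 * (norm u)\<^sup>2 \<le> u \<bullet> (W0 *v u)"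
    using positive_definite_coercive[OF assms(2)] by metis
  \<comment> \<open>Half of the coercivity constant: one \<open>e\<close> pays for the diagonal
    perturbation, another for this block's share of the cross term after
    \<open>2 a b \<le> a^2 + b^2\<close>.\<close>
  define e where "e = min d1 d2 / 2"
  have e: "e > 0" "2 * e \<le> d1" "2 * e \<le> d2" using d1(1) d2(1) by (auto simp: e_def)
  have "form_nonneg (P0 + P) Q (W0 + W)"
    if n: "norm P \<le> e" "norm Q \<le> e" "norm W \<le> e" for P W and Q :: "real^'q^'p"
    unfolding form_nonneg_def
  proof (intro allI)
    fix u :: "real^'p" and x :: "real^'q"
    have "\<bar>u \<bullet> (P *v u)\<bar> \<le> e * (norm u * norm u)"
      using abs_form_le[of u P u] mult_right_mono[OF n(1), of "norm u * norm u"] by simp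
    moreover have "\<bar>x \<bullet> (W *v x)\<bar> \<le> e * (norm x * norm x)"
      using abs_form_le[of x W x] mult_right_mono[OF n(3), of "norm x * norm x"] by simp
    moreover have "\<bar>u \<bullet> (Q *v x)\<bar> \<le> e * (norm u * norm x)"
      using abs_form_le[of u Q x] mult_right_mono[OF n(2), of "norm u * norm x"] by simp
    moreover have "2 * (e * (norm u * norm x)) \<le> e * (norm u)\<^sup>2 + e * (norm x)\<^sup>2"
    proof -
      have "0 \<le> e * (norm u - norm x)\<^sup>2" using e by simp
      then show ?thesis by (simp add: power2_eq_square algebra_simps)
    qed
    moreover have "2 * e * (norm u)\<^sup>2 \<le> d1 * (norm u)\<^sup>2" "2 * e * (norm x)\<^sup>2 \<le> d2 * (norm x)\<^sup>2"
      using e by (auto intro: mult_right_mono)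
    ultimately show "0 \<le> u \<bullet> ((P0 + P) *v u) + 2 * (u \<bullet> (Q *v x)) + x \<bullet> ((W0 + W) *v x)"
      using d1(2)[of u] d2(2)[of x]
      by (simp add: matrix_vector_mult_add_rdistrib inner_add_right power2_eq_square)
  qed
  then show ?thesis using e(1) by blast
qed

lemma form_nonneg_scaleR:
  assumes "form_nonneg P Q W" "0 \<le> c"
  shows "form_nonneg (c *\<^sub>R P) (c *\<^sub>R Q) (c *\<^sub>R W)"
  unfolding form_nonneg_def
proof (intro allI)
  fix u x
  have "0 \<le> c * (u \<bullet> (P *v u) + 2 * (u \<bullet> (Q *v x)) + x \<bullet> (W *v x))"
    using assms by (simp add: form_nonneg_def)
  then show "0 \<le> u \<bullet> ((c *\<^sub>R P) *v u) + 2 * (u \<bullet> ((c *\<^sub>R Q) *v x)) + x \<bullet> ((c *\<^sub>R W) *v x)"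
    by (simp add: scaleR_matrix_vector_assoc[symmetric] algebra_simps)
qed

section \<open>Feasibility through multiples of the identity\<close>

definition scaled_one :: "nat \<Rightarrow> real \<Rightarrow> real mat" where
  "scaled_one d c = c \<cdot>\<^sub>m 1\<^sub>m d"

lemma scaled_one_sym: "scaled_one d c \<in> sym_mats d"
  by (rule sym_matsI) (auto simp: scaled_one_def)

text \<open>The identity as a sum over the standard basis, in the shape that
  \<open>adj_map_quadratic_form\<close> expects.\<close>

lemma scaled_one_entry:
  assumes "a < d" "b < d"
  shows "scaled_one d c $$ (a, b)
    = (\<Sum>k<d. c * ((if a = k then 1 else 0) * (if b = k then 1 else 0)))"
proof -
  have "(\<Sum>k<d. c * ((if a = k then 1 else 0) * (if b = k then 1 else 0)))
      = (\<Sum>k<d. if a = k then (if a = b then c else 0) else 0)"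
    by (intro sum.cong) auto
  then show ?thesis using assms by (simp add: scaled_one_def)
qed

lemma psd_scaled_one:
  assumes "0 \<le> c"
  shows "psd_mat (scaled_one d c)"
proof -
  have "dotn d v (appn d (mat_fun (scaled_one d c)) v) = c * dotn d v v" for v
    by (simp add: dotn_def appn_def mat_fun_def scaled_one_def if_distrib if_distribR sum.delta
        sum_distrib_left mult_ac cong: if_cong)
  then show ?thesis using assms by (simp add: psd_mat_iff[OF scaled_one_sym] dotn_self_nonneg)
qed

lemma trace_scaled_one: "trace_mat (scaled_one d c) = c * real d"
  by (simp add: trace_mat_def scaled_one_def)

lemma adj_map_scaled_one:
  assumes M: "\<And>i. M i \<in> sym_mats d"
  shows "adj_map M (scaled_one d c) = c *\<^sub>R adj_map M (scaled_one d 1)"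
proof -
  have "scaled_one d c $$ (a, b) = c * scaled_one d 1 $$ (a, b)" if "a < d" "b < d" for a b
    using that by (simp add: scaled_one_def)
  then have "adj_map M (scaled_one d c) $ i $ j = c * adj_map M (scaled_one d 1) $ i $ j" for i j
    unfolding adj_map_entry[OF scaled_one_sym M] sum_distrib_left by (intro sum.cong refl) simp
  then show ?thesis by (simp add: Finite_Cartesian_Product.vec_eq_iff)
qed

text \<open>At the identity matrices the form is the sum of the squares of all entries of all
  \<open>lin_comb_mat (d k) (R k) x\<close>. Its positivity is the nondegeneracy condition of the
  spectratope.\<close>

lemma sum_adj_map_one_positive:
  assumes data: "basic_spectratope_data d R T" and "x \<noteq> 0"
  shows "0 < x \<bullet> ((\<Sum>k\<in>UNIV. adj_map (R k) (scaled_one (d k) 1)) *v x)"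
proof -
  note R = basic_spectratope_dataD(2)[OF data]
  define e where "e a = (\<lambda>b. if b = a then 1 else 0 :: real)" for a :: nat
  have entry: "x \<bullet> col_vec (d k) (R k) (e a) c = lin_comb_mat (d k) (R k) x $$ (c, a)"
    if "a < d k" "c < d k" for k a c
    using that by (simp add: col_vec_def e_def inner_vec_def lin_comb_mat_def if_distrib sum.delta cong: if_cong)
  have form: "x \<bullet> (adj_map (R k) (scaled_one (d k) 1) *v x)
      = (\<Sum>a<d k. 1 * (\<Sum>c<d k. (x \<bullet> col_vec (d k) (R k) (e a) c)\<^sup>2))" for k
    by (rule adj_map_quadratic_form[OF scaled_one_sym R]) (simp add: scaled_one_entry e_def)
  obtain k where k: "lin_comb_mat (d k) (R k) x \<noteq> 0\<^sub>m (d k) (d k)"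
    using data \<open>x \<noteq> 0\<close> by (auto simp: basic_spectratope_data_def)
  have "\<exists>c<d k. \<exists>a<d k. lin_comb_mat (d k) (R k) x $$ (c, a) \<noteq> 0"
  proof (rule ccontr)
    assume "\<not> ?thesis"
    then have "lin_comb_mat (d k) (R k) x = 0\<^sub>m (d k) (d k)"
      by (intro eq_matI) (auto simp: lin_comb_mat_def)
    then show False using k by contradiction
  qed
  then obtain c a where ca: "c < d k" "a < d k" "x \<bullet> col_vec (d k) (R k) (e a) c \<noteq> 0"
    using entry by metis
  have "0 < (x \<bullet> col_vec (d k) (R k) (e a) c)\<^sup>2" using ca(3) by simp
  also have "\<dots> \<le> (\<Sum>c<d k. (x \<bullet> col_vec (d k) (R k) (e a) c)\<^sup>2)"
    by (rule member_le_sum) (use ca in auto)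
  also have "\<dots> \<le> (\<Sum>a<d k. \<Sum>c<d k. (x \<bullet> col_vec (d k) (R k) (e a) c)\<^sup>2)"
    by (rule member_le_sum) (use ca in \<open>auto intro: sum_nonneg\<close>)
  also have "\<dots> \<le> (\<Sum>k\<in>UNIV. \<Sum>a<d k. \<Sum>c<d k. (x \<bullet> col_vec (d k) (R k) (e a) c)\<^sup>2)"
    by (rule member_le_sum) (auto intro!: sum_nonneg)
  also have "\<dots> = x \<bullet> ((\<Sum>k\<in>UNIV. adj_map (R k) (scaled_one (d k) 1)) *v x)"
    by (simp add: inner_outer[symmetric] inner_sum_left) (simp add: inner_outer form)
  finally show ?thesis .
qed

text \<open>Even \<open>H = 0\<close> is feasible once the multipliers are large multiples of the
  identity.\<close>

lemma sdp_feasible_nonempty: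
  fixes R :: "'k::finite \<Rightarrow> 'n::finite \<Rightarrow> real mat" and S :: "'l::finite \<Rightarrow> 'v::finite \<Rightarrow> real mat"
    and A :: "real^'n^'m::finite" and B :: "real^'n^'v"
  assumes R: "basic_spectratope_data d R T" and S: "basic_spectratope_data f S Rset"
  shows "sdp_feasible d R f S A B \<noteq> {}"
proof -
  define P where "P = (\<Sum>l\<in>UNIV. adj_map (S l) (scaled_one (f l) 1))"
  define W where "W = (\<Sum>k\<in>UNIV. adj_map (R k) (scaled_one (d k) 1))"
  obtain e where e: "e > 0" "\<And>P' Q W'. norm P' \<le> e \<and> norm Q \<le> e \<and> norm W' \<le> e \<Longrightarrow> form_nonneg (P + P') Q (W + W')"
    using form_nonneg_interior[of P W] sum_adj_map_one_positive[OF S] sum_adj_map_one_positive[OF R]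
    unfolding P_def W_def by blast
  \<comment> \<open>Large enough that \<open>B / (2 * c)\<close> lies within the tolerance
    \<open>e\<close>; scaling the cone by \<open>c\<close> then restores
    \<open>B / 2\<close>.\<close>
  define c where "c = norm ((1/2) *\<^sub>R B) / e + 1"
  have c: "c > 0" using e(1) by (auto simp: c_def intro: add_nonneg_pos)
  have "norm ((1 / c) *\<^sub>R (1/2) *\<^sub>R B) \<le> e"
    using c e(1) by (simp add: c_def field_simps)
  then have "form_nonneg (P + 0) ((1 / c) *\<^sub>R (1/2) *\<^sub>R B) (W + 0)" using e by (intro e(2)) auto
  from form_nonneg_scaleR[OF this, of c]
  have form: "form_nonneg (c *\<^sub>R P) ((1/2) *\<^sub>R B) (c *\<^sub>R W)" using c by simp
  have "transpose (0 :: real^'v^'m) ** A = 0"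
    by (simp add: Finite_Cartesian_Product.vec_eq_iff Finite_Cartesian_Product.transpose_def
        matrix_matrix_mult_def)
  moreover have "(\<Sum>l\<in>UNIV. adj_map (S l) (scaled_one (f l) c)) = c *\<^sub>R P"
    unfolding P_def scaleR_right.sum
    by (intro sum.cong refl adj_map_scaled_one) (rule basic_spectratope_dataD(2)[OF S])
  moreover have "(\<Sum>k\<in>UNIV. adj_map (R k) (scaled_one (d k) c)) = c *\<^sub>R W"
    unfolding W_def scaleR_right.sum
    by (intro sum.cong refl adj_map_scaled_one) (rule basic_spectratope_dataD(2)[OF R])
  ultimately have "(0, \<lambda>l. scaled_one (f l) c, \<lambda>k. scaled_one (d k) c) \<in> sdp_feasible d R f S A B"
    unfolding sdp_feasible_iff[of R d S f, OF basic_spectratope_dataD(2)[OF R] basic_spectratope_dataD(2)[OF S]]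
    using form c by (simp add: scaled_one_sym psd_scaled_one)
  then show ?thesis by blast
qed

section \<open>Compactness of minimizing sequences\<close>

lemma adj_map_tendsto:
  assumes X: "\<And>n. X n \<in> sym_mats d" "X' \<in> sym_mats d" and M: "\<And>i. M i \<in> sym_mats d"
    and lim: "\<And>a b. a < d \<Longrightarrow> b < d \<Longrightarrow> (\<lambda>n. X n $$ (a, b)) \<longlonglongrightarrow> X' $$ (a, b)"
  shows "(\<lambda>n. adj_map M (X n)) \<longlonglongrightarrow> adj_map M X'"
  by (intro vec_tendstoI, unfold adj_map_entry[OF X(1) M] adj_map_entry[OF X(2) M])
    (intro tendsto_sum tendsto_mult lim tendsto_const, auto)

lemma trace_mat_tendsto:
  assumes X: "\<And>n. X n \<in> sym_mats d" "X' \<in> sym_mats d"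
    and lim: "\<And>a b. a < d \<Longrightarrow> b < d \<Longrightarrow> (\<lambda>n. X n $$ (a, b)) \<longlonglongrightarrow> X' $$ (a, b)"
  shows "(\<lambda>n. trace_mat (X n)) \<longlonglongrightarrow> trace_mat X'"
  unfolding trace_mat_def sym_matsD(2)[OF X(1)] sym_matsD(2)[OF X(2)]
  by (intro tendsto_sum lim) auto

lemma psd_family_convergent_subseq:
  fixes X :: "nat \<Rightarrow> 'l::finite \<Rightarrow> real mat"
  assumes X: "\<And>n l. X n l \<in> sym_mats (f l)" "\<And>n l. psd_mat (X n l)"
    and tr: "\<And>n l. trace_mat (X n l) \<le> C l"
  shows "\<exists>r X'. strict_mono (r :: nat \<Rightarrow> nat) \<and> (\<forall>l. X' l \<in> sym_mats (f l)) \<and> (\<forall>l. psd_mat (X' l)) \<and>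
    (\<forall>l. \<forall>a<f l. \<forall>b<f l. (\<lambda>n. X (r n) l $$ (a, b)) \<longlonglongrightarrow> X' l $$ (a, b))"
proof -
  define I where "I = (SIGMA l:UNIV. {..<f l} \<times> {..<f l})"
  define x where "x n = (\<lambda>(l, a, b). X n l $$ (a, b))" for n
  have C: "0 \<le> C l" for l using trace_psd_nonneg[OF X] tr by (rule order_trans)
  have "finite I" by (simp add: I_def)
  moreover have "\<bar>x n i\<bar> \<le> (\<Sum>l\<in>UNIV. C l)" if "i \<in> I" for n i
  proof -
    obtain l a b where i: "i = (l, a, b)" by (cases i)
    then have ab: "a < f l" "b < f l" using that by (auto simp: I_def)
    have "\<bar>x n i\<bar> \<le> trace_mat (X n l)" using psd_entry_le_trace[OF X ab] by (simp add: x_def i)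
    also have "\<dots> \<le> C l" by (rule tr)
    also have "\<dots> \<le> (\<Sum>l\<in>UNIV. C l)" by (rule member_le_sum) (use C in auto)
    finally show ?thesis .
  qed
  ultimately obtain r y where r: "strict_mono (r :: nat \<Rightarrow> nat)"
    and y: "\<forall>i\<in>I. (\<lambda>n. x (r n) i) \<longlonglongrightarrow> y i"
    using bounded_family_convergent_subseq[of I x] by blast
  define X' where "X' l = Matrix.mat (f l) (f l) (\<lambda>(a, b). y (l, a, b))" for l
  have lim: "(\<lambda>n. X (r n) l $$ (a, b)) \<longlonglongrightarrow> X' l $$ (a, b)" if "a < f l" "b < f l" for l a b
  proof -
    have "(l, a, b) \<in> I" using that by (simp add: I_def)
    then have "(\<lambda>n. x (r n) (l, a, b)) \<longlonglongrightarrow> y (l, a, b)" using y by blast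
    then show ?thesis using that by (simp add: x_def X'_def)
  qed
  have sym: "X' l \<in> sym_mats (f l)" for l
  proof (rule sym_matsI)
    show "X' l \<in> carrier_mat (f l) (f l)" by (simp add: X'_def)
    show "X' l $$ (a, b) = X' l $$ (b, a)" if ab: "a < f l" "b < f l" for a b
    proof (rule LIMSEQ_unique[OF lim[OF ab]])
      show "(\<lambda>n. X (r n) l $$ (a, b)) \<longlonglongrightarrow> X' l $$ (b, a)"
        using lim[OF ab(2,1)] sym_matsD(4)[OF X(1) ab] by simp
    qed
  qed
  have "psd_mat (X' l)" for l
    unfolding psd_mat_iff[OF sym]
  proof
    fix v
    have "(\<lambda>n. dotn (f l) v (appn (f l) (mat_fun (X (r n) l)) v)) \<longlonglongrightarrow> dotn (f l) v (appn (f l) (mat_fun (X' l)) v)"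
      unfolding dotn_def appn_def mat_fun_def
      by (intro tendsto_sum tendsto_mult lim tendsto_const) auto
    moreover have "0 \<le> dotn (f l) v (appn (f l) (mat_fun (X (r n) l)) v)" for n
      using X(2) unfolding psd_mat_iff[OF X(1)] by blast
    ultimately show "0 \<le> dotn (f l) v (appn (f l) (mat_fun (X' l)) v)"
      by (intro LIMSEQ_le_const) auto
  qed
  then show ?thesis using r sym lim by blast
qed

lemma trace_vec_inner_nonneg:
  assumes "basic_spectratope_data d R T" "t \<in> T"
    and "\<And>k. X k \<in> sym_mats (d k)" "\<And>k. psd_mat (X k)"
  shows "0 \<le> trace_vec X \<bullet> t"
  unfolding trace_vec_def inner_vec_def
  by (intro sum_nonneg)
    (simp add: trace_psd_nonneg[OF assms(3,4)] basic_spectratope_dataD(7)[OF assms(1,2)])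

lemma support_fun_trace_vec_nonneg:
  assumes "basic_spectratope_data d R T"
    and "\<And>k. X k \<in> sym_mats (d k)" "\<And>k. psd_mat (X k)"
  shows "0 \<le> support_fun T (trace_vec X)"
proof -
  obtain t where t: "t \<in> T" using basic_spectratope_dataD(6)[OF assms(1)] by blast
  have "0 \<le> trace_vec X \<bullet> t" by (rule trace_vec_inner_nonneg[OF assms(1) t assms(2,3)])
  also have "\<dots> \<le> support_fun T (trace_vec X)"
    by (rule support_fun_upper[OF basic_spectratope_dataD(5)[OF assms(1)] t])
  finally show ?thesis .
qed

text \<open>The point of \<open>T\<close> with positive entries makes the support function of a
  nonnegative vector dominate each of its entries, so a bounded objective bounds every
  trace.\<close>

lemma trace_le_support_fun:
  assumes "basic_spectratope_data d R T"
  shows "\<exists>t. (\<forall>k. 0 < t $ k) \<and> (\<forall>X k. (\<forall>k. X k \<in> sym_mats (d k) \<and> psd_mat (X k)) \<longrightarrow>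
    trace_mat (X k) \<le> support_fun T (trace_vec X) / t $ k)"
proof -
  obtain t where t: "t \<in> T" "\<forall>k. 0 < t $ k"
    using basic_spectratope_dataD(3)[OF assms] unfolding monotonic_set_def by metis
  have "trace_mat (X k) \<le> support_fun T (trace_vec X) / t $ k"
    if X: "\<forall>k. X k \<in> sym_mats (d k) \<and> psd_mat (X k)" for X k
  proof -
    have "trace_mat (X k) * t $ k \<le> (\<Sum>k\<in>UNIV. trace_mat (X k) * t $ k)"
      by (rule member_le_sum)
        (use X t(2) in \<open>auto intro!: mult_nonneg_nonneg intro: trace_psd_nonneg less_imp_le\<close>)
    also have "\<dots> = trace_vec X \<bullet> t" by (simp add: trace_vec_def inner_vec_def)
    also have "\<dots> \<le> support_fun T (trace_vec X)"
      by (rule support_fun_upper[OF basic_spectratope_dataD(5)[OF assms] t(1)])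
    finally show ?thesis using t(2) by (simp add: field_simps)
  qed
  then show ?thesis using t(2) by blast
qed

lemma axis_inner_matrix: "axis i 1 \<bullet> (M *v axis j 1) = (M :: real^'n^'m) $ i $ j"
  by (simp add: matrix_vector_mult_basis column_def inner_axis' )

text \<open>Testing on \<open>(axis i 1, axis j 1)\<close> and with the second vector negated bounds
  both signs. It controls \<open>B - transpose H ** A\<close> by the diagonal blocks.\<close>

lemma form_nonneg_entry_bound:
  fixes P :: "real^'p^'p" and Q :: "real^'q^'p" and W :: "real^'q^'q"
  assumes "form_nonneg P Q W"
  shows "2 * \<bar>Q $ i $ j\<bar> \<le> P $ i $ i + W $ j $ j"
proof -
  have "0 \<le> axis i 1 \<bullet> (P *v axis i 1) + 2 * (axis i 1 \<bullet> (Q *v axis j 1)) + axis j 1 \<bullet> (W *v axis j 1)"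
    using assms unfolding form_nonneg_def by blast
  moreover have "0 \<le> axis i 1 \<bullet> (P *v axis i 1) + 2 * (axis i 1 \<bullet> (Q *v (- axis j 1)))
      + (- axis j 1) \<bullet> (W *v (- axis j 1))"
    using assms unfolding form_nonneg_def by blast
  ultimately show ?thesis by (simp add: matrix_vector_mult_uminus axis_inner_matrix)
qed

lemma form_nonneg_limit:
  assumes "\<And>n. form_nonneg (P n) (Q n) (W n)"
    and "P \<longlonglongrightarrow> P'" "Q \<longlonglongrightarrow> Q'" "W \<longlonglongrightarrow> W'"
  shows "form_nonneg P' Q' W'"
  unfolding form_nonneg_def
proof (intro allI)
  fix u x
  have "(\<lambda>n. u \<bullet> (P n *v u) + 2 * (u \<bullet> (Q n *v x)) + x \<bullet> (W n *v x))
      \<longlonglongrightarrow> u \<bullet> (P' *v u) + 2 * (u \<bullet> (Q' *v x)) + x \<bullet> (W' *v x)"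
    unfolding inner_outer[symmetric] by (intro tendsto_intros assms)
  then show "0 \<le> u \<bullet> (P' *v u) + 2 * (u \<bullet> (Q' *v x)) + x \<bullet> (W' *v x)"
    using assms(1) unfolding form_nonneg_def by (intro LIMSEQ_le_const) auto
qed

text \<open>A minimizing sequence may have unbounded \<open>H\<close>, since \<open>H\<close> enters
  only through this product. Closedness of the range supplies an \<open>H\<close> for the limit of
  the products.\<close>

lemma closed_range_transpose_mult:
  "closed (range (\<lambda>H :: real^'v^'m. transpose H ** (A :: real^'n^'m)))"
proof (rule closed_subspace)
  have "linear (\<lambda>H :: real^'v^'m. transpose H ** A)"
    by (rule linearI)
      (simp_all add: Finite_Cartesian_Product.vec_eq_iff Finite_Cartesian_Product.transpose_def
        matrix_matrix_mult_def distrib_right sum.distrib sum_distrib_left mult.assoc)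
  then show "subspace (range (\<lambda>H :: real^'v^'m. transpose H ** A))"
    by (intro linear_subspace_image subspace_UNIV)
qed

lemma bounded_matrix_seq_convergent_subseq:
  fixes G :: "nat \<Rightarrow> real^'n^'m"
  assumes "\<And>n i j. \<bar>G n $ i $ j\<bar> \<le> c"
  shows "\<exists>r G'. strict_mono (r :: nat \<Rightarrow> nat) \<and> (\<lambda>n. G (r n)) \<longlonglongrightarrow> G'"
proof -
  obtain r y where r: "strict_mono (r :: nat \<Rightarrow> nat)"
    and y: "\<forall>p\<in>UNIV. (\<lambda>n. (\<lambda>(i, j). G (r n) $ i $ j) p) \<longlonglongrightarrow> y p"
    using bounded_family_convergent_subseq[of "UNIV :: ('m \<times> 'n) set" "\<lambda>n (i, j). G n $ i $ j" c] assms
    by auto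
  have "(\<lambda>n. G (r n)) \<longlonglongrightarrow> (\<chi> i j. y (i, j))"
  proof (intro vec_tendstoI)
    fix i j
    have "(\<lambda>n. (\<lambda>(i, j). G (r n) $ i $ j) (i, j)) \<longlonglongrightarrow> y (i, j)" using y by blast
    then show "(\<lambda>n. G (r n) $ i $ j) \<longlonglongrightarrow> (\<chi> i j. y (i, j)) $ i $ j" by simp
  qed
  then show ?thesis using r by blast
qed

lemma LIMSEQ_entry_bounded:
  assumes "(P :: nat \<Rightarrow> real^'p^'p) \<longlonglongrightarrow> P'"
  shows "\<exists>K. \<forall>n i. \<bar>P n $ i $ i\<bar> \<le> K"
proof -
  obtain K where K: "\<And>n. norm (P n) \<le> K"
    using convergent_imp_Bseq[of P] assms by (auto simp: convergent_def Bseq_def)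
  have "\<bar>P n $ i $ i\<bar> \<le> K" for n i
    using component_le_norm_cart[of "P n $ i" i] Finite_Cartesian_Product.norm_nth_le[of "P n" i] K[of n] by linarith
  then show ?thesis by blast
qed

text \<open>Bounded objectives bound the traces, these bound the matrix variables, and the diagonal
  blocks bound the off-diagonal one. Everything but \<open>H\<close> itself therefore converges
  along a subsequence.\<close>

lemma sdp_optimal_exists:
  fixes R :: "'k::finite \<Rightarrow> 'n::finite \<Rightarrow> real mat" and S :: "'l::finite \<Rightarrow> 'v::finite \<Rightarrow> real mat"
    and A :: "real^'n^'m::finite" and B :: "real^'n^'v"
  assumes R: "basic_spectratope_data d R T" and S: "basic_spectratope_data f S Rset"
  shows "\<exists>H Ups Lam. sdp_optimal d R T f S Rset A B H Ups Lam"
proof -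
  let ?F = "sdp_feasible d R f S A B" and ?o = "sdp_objective T Rset"
  note feasible_iff = sdp_feasible_iff[of R d S f, OF basic_spectratope_dataD(2)[OF R] basic_spectratope_dataD(2)[OF S]]
  have nonneg: "0 \<le> ?o z" if "z \<in> ?F" for z
  proof -
    obtain H U L where z: "z = (H, U, L)" by (cases z)
    show ?thesis
      using that unfolding z feasible_iff sdp_objective_def
      by (auto intro!: add_nonneg_nonneg support_fun_trace_vec_nonneg[OF R] support_fun_trace_vec_nonneg[OF S])
  qed
  define g where "g = Inf (?o ` ?F)"
  have bdd: "bdd_below (?o ` ?F)" using nonneg by (intro bdd_belowI2)
  have ne: "?o ` ?F \<noteq> {}" using sdp_feasible_nonempty[OF R S] by simp
  have "\<exists>H U L. (H, U, L) \<in> ?F \<and> ?o (H, U, L) < g + 1 / real (Suc n)" for n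
  proof -
    obtain y where "y \<in> ?o ` ?F" "y < g + 1 / real (Suc n)"
      using cInf_lessD[OF ne, of "g + 1 / real (Suc n)"] by (auto simp: g_def)
    then show ?thesis by auto
  qed
  then obtain H U L where feas: "\<And>n. (H n, U n, L n) \<in> ?F"
    and obj: "\<And>n. ?o (H n, U n, L n) < g + 1 / real (Suc n)"
    by metis
  have U: "\<And>n l. U n l \<in> sym_mats (f l)" "\<And>n l. psd_mat (U n l)"
    and L: "\<And>n k. L n k \<in> sym_mats (d k)" "\<And>n k. psd_mat (L n k)"
    and form: "\<And>n. form_nonneg (\<Sum>l\<in>UNIV. adj_map (S l) (U n l)) ((1/2) *\<^sub>R (B - transpose (H n) ** A))
      (\<Sum>k\<in>UNIV. adj_map (R k) (L n k))"
    using feas unfolding feasible_iff by auto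
  have sum_le: "support_fun Rset (trace_vec (U n)) + support_fun T (trace_vec (L n)) \<le> g + 1" for n
  proof -
    have "1 / real (Suc n) \<le> 1" by simp
    then show ?thesis using obj[of n] unfolding sdp_objective_def prod.case by linarith
  qed
  have supL0: "0 \<le> support_fun T (trace_vec (L n))" for n
    by (rule support_fun_trace_vec_nonneg[OF R L])
  have supU0: "0 \<le> support_fun Rset (trace_vec (U n))" for n
    by (rule support_fun_trace_vec_nonneg[OF S U])
  have supU: "support_fun Rset (trace_vec (U n)) \<le> g + 1" and supL: "support_fun T (trace_vec (L n)) \<le> g + 1" for n
    using sum_le[of n] supL0[of n] supU0[of n] by linarith+
  obtain q where q: "\<forall>l. 0 < q $ l" "\<forall>X l. (\<forall>l. X l \<in> sym_mats (f l) \<and> psd_mat (X l)) \<longrightarrow>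
    trace_mat (X l) \<le> support_fun Rset (trace_vec X) / q $ l"
    using trace_le_support_fun[OF S] by blast
  obtain p where p: "\<forall>k. 0 < p $ k" "\<forall>X k. (\<forall>k. X k \<in> sym_mats (d k) \<and> psd_mat (X k)) \<longrightarrow>
    trace_mat (X k) \<le> support_fun T (trace_vec X) / p $ k"
    using trace_le_support_fun[OF R] by blast
  have trU: "trace_mat (U n l) \<le> (g + 1) / q $ l" for n l
  proof -
    have "trace_mat (U n l) \<le> support_fun Rset (trace_vec (U n)) / q $ l" using q(2) U by blast
    also have "\<dots> \<le> (g + 1) / q $ l" by (rule divide_right_mono[OF supU]) (use q(1) in \<open>auto intro: less_imp_le\<close>)
    finally show ?thesis .
  qed
  have trL: "trace_mat (L n k) \<le> (g + 1) / p $ k" for n k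
  proof -
    have "trace_mat (L n k) \<le> support_fun T (trace_vec (L n)) / p $ k" using p(2) L by blast
    also have "\<dots> \<le> (g + 1) / p $ k" by (rule divide_right_mono[OF supL]) (use p(1) in \<open>auto intro: less_imp_le\<close>)
    finally show ?thesis .
  qed
  obtain r1 U' where r1: "strict_mono (r1 :: nat \<Rightarrow> nat)" and U': "\<forall>l. U' l \<in> sym_mats (f l)" "\<forall>l. psd_mat (U' l)"
    and limU: "\<forall>l. \<forall>a<f l. \<forall>b<f l. (\<lambda>n. U (r1 n) l $$ (a, b)) \<longlonglongrightarrow> U' l $$ (a, b)"
    using psd_family_convergent_subseq[of U f, OF U trU] by blast
  obtain r2 L' where r2: "strict_mono (r2 :: nat \<Rightarrow> nat)" and L': "\<forall>k. L' k \<in> sym_mats (d k)" "\<forall>k. psd_mat (L' k)"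
    and limL: "\<forall>k. \<forall>a<d k. \<forall>b<d k. (\<lambda>n. L (r1 (r2 n)) k $$ (a, b)) \<longlonglongrightarrow> L' k $$ (a, b)"
    using psd_family_convergent_subseq[of "\<lambda>n. L (r1 n)" d, OF L trL] by blast
  define s where "s = r1 \<circ> r2"
  have s: "strict_mono s" unfolding s_def by (rule strict_mono_o[OF r1 r2])
  have limU': "(\<lambda>n. U (s n) l $$ (a, b)) \<longlonglongrightarrow> U' l $$ (a, b)" if "a < f l" "b < f l" for l a b
  proof -
    have "(\<lambda>n. U (r1 n) l $$ (a, b)) \<longlonglongrightarrow> U' l $$ (a, b)" using limU that by blast
    from LIMSEQ_subseq_LIMSEQ[OF this r2] show ?thesis by (simp add: o_def s_def)
  qed
  have limL': "(\<lambda>n. L (s n) k $$ (a, b)) \<longlonglongrightarrow> L' k $$ (a, b)" if "a < d k" "b < d k" for k a b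
    using limL that by (simp add: s_def)
  define P where "P n = (\<Sum>l\<in>UNIV. adj_map (S l) (U (s n) l))" for n
  define W where "W n = (\<Sum>k\<in>UNIV. adj_map (R k) (L (s n) k))" for n
  define P' where "P' = (\<Sum>l\<in>UNIV. adj_map (S l) (U' l))"
  define W' where "W' = (\<Sum>k\<in>UNIV. adj_map (R k) (L' k))"
  define G where "G n = transpose (H (s n)) ** A" for n
  have formG: "form_nonneg (P n) ((1/2) *\<^sub>R (B - G n)) (W n)" for n
    unfolding P_def W_def G_def by (rule form)
  have limP: "P \<longlonglongrightarrow> P'"
    unfolding P_def P'_def
  proof (rule tendsto_sum)
    show "(\<lambda>n. adj_map (S l) (U (s n) l)) \<longlonglongrightarrow> adj_map (S l) (U' l)" for l
      by (rule adj_map_tendsto[OF U(1) U'(1)[rule_format] basic_spectratope_dataD(2)[OF S] limU'])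
  qed
  have limW: "W \<longlonglongrightarrow> W'"
    unfolding W_def W'_def
  proof (rule tendsto_sum)
    show "(\<lambda>n. adj_map (R k) (L (s n) k)) \<longlonglongrightarrow> adj_map (R k) (L' k)" for k
      by (rule adj_map_tendsto[OF L(1) L'(1)[rule_format] basic_spectratope_dataD(2)[OF R] limL'])
  qed
  obtain K1 where K1: "\<And>n i. \<bar>P n $ i $ i\<bar> \<le> K1" using LIMSEQ_entry_bounded[OF limP] by blast
  obtain K2 where K2: "\<And>n i. \<bar>W n $ i $ i\<bar> \<le> K2" using LIMSEQ_entry_bounded[OF limW] by blast
  have bndG: "\<bar>G n $ i $ j\<bar> \<le> norm B + (K1 + K2)" for n i j
  proof -
    have "2 * \<bar>((1/2) *\<^sub>R (B - G n)) $ i $ j\<bar> \<le> P n $ i $ i + W n $ j $ j"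
      by (rule form_nonneg_entry_bound[OF formG])
    then have "\<bar>B $ i $ j - G n $ i $ j\<bar> \<le> K1 + K2"
      using K1[of n i] K2[of n j] by simp
    moreover have "\<bar>B $ i $ j\<bar> \<le> norm B"
      using component_le_norm_cart[of "B $ i" j] Finite_Cartesian_Product.norm_nth_le[of B i] by linarith
    ultimately show ?thesis by linarith
  qed
  obtain r3 G' where r3: "strict_mono (r3 :: nat \<Rightarrow> nat)" and limG: "(\<lambda>n. G (r3 n)) \<longlonglongrightarrow> G'"
    using bounded_matrix_seq_convergent_subseq[of G, OF bndG] by blast
  \<comment> \<open>The limit component \<open>H'\<close> is any preimage of the limit; it need not
    be a limit of the \<open>H n\<close>.\<close>
  have "G' \<in> range (\<lambda>H :: real^'v^'m. transpose H ** A)"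
    by (rule closed_sequentially[OF closed_range_transpose_mult _ limG]) (simp add: G_def)
  then obtain H' :: "real^'v^'m" where H': "G' = transpose H' ** A" by blast
  have "form_nonneg P' ((1/2) *\<^sub>R (B - G')) W'"
  proof (rule form_nonneg_limit)
    show "form_nonneg (P (r3 n)) ((1/2) *\<^sub>R (B - G (r3 n))) (W (r3 n))" for n by (rule formG)
    show "(\<lambda>n. P (r3 n)) \<longlonglongrightarrow> P'" using LIMSEQ_subseq_LIMSEQ[OF limP r3] by (simp add: o_def)
    show "(\<lambda>n. W (r3 n)) \<longlonglongrightarrow> W'" using LIMSEQ_subseq_LIMSEQ[OF limW r3] by (simp add: o_def)
    show "(\<lambda>n. (1/2) *\<^sub>R (B - G (r3 n))) \<longlonglongrightarrow> (1/2) *\<^sub>R (B - G')" by (intro tendsto_intros limG)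
  qed
  then have feas': "(H', U', L') \<in> ?F"
    unfolding feasible_iff P'_def W'_def H' using U' L' by blast
  \<comment> \<open>The objective is a supremum of linear functionals. Passing to the limit for
    fixed points of \<open>Rset\<close> and \<open>T\<close>, with suprema taken afterwards, gives
    lower semicontinuity.\<close>
  have le: "trace_vec U' \<bullet> q + trace_vec L' \<bullet> t \<le> g" if qt: "q \<in> Rset" "t \<in> T" for q t
  proof -
    have "(\<lambda>n. trace_vec (U (s n)) \<bullet> q + trace_vec (L (s n)) \<bullet> t) \<longlonglongrightarrow> trace_vec U' \<bullet> q + trace_vec L' \<bullet> t"
      unfolding trace_vec_def
    proof (intro tendsto_add tendsto_inner tendsto_const vec_tendstoI)
      show "(\<lambda>n. (\<chi> l. trace_mat (U (s n) l)) $ l) \<longlonglongrightarrow> (\<chi> l. trace_mat (U' l)) $ l" for l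
        unfolding vec_lambda_beta by (rule trace_mat_tendsto[OF U(1) U'(1)[rule_format] limU'])
      show "(\<lambda>n. (\<chi> k. trace_mat (L (s n) k)) $ k) \<longlonglongrightarrow> (\<chi> k. trace_mat (L' k)) $ k" for k
        unfolding vec_lambda_beta by (rule trace_mat_tendsto[OF L(1) L'(1)[rule_format] limL'])
    qed
    moreover have "(\<lambda>n. g + 1 / real (Suc (s n))) \<longlonglongrightarrow> g + 0"
      using LIMSEQ_subseq_LIMSEQ[OF LIMSEQ_inverse_real_of_nat s]
      by (intro tendsto_add tendsto_const) (simp add: o_def inverse_eq_divide)
    moreover have "trace_vec (U (s n)) \<bullet> q + trace_vec (L (s n)) \<bullet> t \<le> g + 1 / real (Suc (s n))" for n
      using obj[of "s n"] support_fun_upper[OF basic_spectratope_dataD(5)[OF R] qt(2), of "trace_vec (L (s n))"]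
        support_fun_upper[OF basic_spectratope_dataD(5)[OF S] qt(1), of "trace_vec (U (s n))"]
      unfolding sdp_objective_def by simp
    ultimately show ?thesis using LIMSEQ_le by fastforce
  qed
  have "support_fun T (trace_vec L') \<le> g - support_fun Rset (trace_vec U')"
  proof (rule support_fun_least[OF basic_spectratope_dataD(6)[OF R]])
    fix t assume t: "t \<in> T"
    have "support_fun Rset (trace_vec U') \<le> g - trace_vec L' \<bullet> t"
    proof (rule support_fun_least[OF basic_spectratope_dataD(6)[OF S]])
      show "trace_vec U' \<bullet> q \<le> g - trace_vec L' \<bullet> t" if "q \<in> Rset" for q
        using le[OF that t] by simp
    qed
    then show "trace_vec L' \<bullet> t \<le> g - support_fun Rset (trace_vec U')" by simp
  qed
  then have "?o (H', U', L') \<le> g" by (simp add: sdp_objective_def)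
  moreover have "g \<le> ?o z" if "z \<in> ?F" for z
    unfolding g_def using bdd that by (intro cInf_lower) auto
  ultimately show ?thesis using feas' unfolding sdp_optimal_def by (meson order_trans)
qed

section \<open>Dual solutions by separation\<close>

text \<open>If \<open>V\<close> is the second moment matrix of a random vector, this is the mean
  squared length of \<open>v\<close> multiplied by the random matrix \<open>lin_fun M\<close> of
  that vector.\<close>

definition adj_form :: "nat \<Rightarrow> ('i::finite \<Rightarrow> real mat) \<Rightarrow> real^'i^'i \<Rightarrow> (nat \<Rightarrow> real) \<Rightarrow> real" where
  "adj_form d M V v = (\<Sum>c<d. col_vec d M v c \<bullet> (V *v col_vec d M v c))"

lemma adj_form_nonneg: "(\<And>x. 0 \<le> x \<bullet> (V *v x)) \<Longrightarrow> 0 \<le> adj_form d M V v"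
  unfolding adj_form_def by (rule sum_nonneg)

lemma adj_form_scale: "adj_form d M V (\<lambda>i. s * v i) = s\<^sup>2 * adj_form d M V v"
proof -
  have "col_vec d M (\<lambda>i. s * v i) c = s *\<^sub>R col_vec d M v c" for c
    by (simp add: col_vec_def Finite_Cartesian_Product.vec_eq_iff sum_distrib_left mult_ac)
  then show ?thesis
    by (simp add: adj_form_def matrix_vector_mult_scaleR sum_distrib_left power2_eq_square mult_ac)
qed

lemma adj_form_eq_dotn:
  "adj_form d M V v = dotn d v (appn d (\<lambda>a b. \<Sum>c<d. (\<chi> i. M i $$ (c, a)) \<bullet> (V *v (\<chi> i. M i $$ (c, b)))) v)"
proof -
  define w where "w a c = (\<chi> i. M i $$ (c, a))" for a c
  have cv: "col_vec d M v c = (\<Sum>a<d. v a *\<^sub>R w a c)" for c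
    by (simp add: col_vec_def w_def Finite_Cartesian_Product.vec_eq_iff mult.commute)
  have Vcv: "V *v (\<Sum>b<d. v b *\<^sub>R w b c) = (\<Sum>b<d. v b *\<^sub>R (V *v w b c))" for c
    unfolding linear_sum[OF matrix_vector_mul_linear] by (simp add: matrix_vector_mult_scaleR)
  have "adj_form d M V v = (\<Sum>c<d. \<Sum>a<d. (v a *\<^sub>R w a c) \<bullet> (\<Sum>b<d. v b *\<^sub>R (V *v w b c)))"
    by (simp only: adj_form_def cv Vcv inner_sum_left)
  also have "\<dots> = (\<Sum>c<d. \<Sum>a<d. \<Sum>b<d. v a * (v b * (w a c \<bullet> (V *v w b c))))"
    by (simp only: inner_sum_right inner_scaleR_left inner_scaleR_right sum_distrib_left mult.left_commute)
  also have "\<dots> = (\<Sum>a<d. \<Sum>b<d. \<Sum>c<d. v a * (v b * (w a c \<bullet> (V *v w b c))))"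
    by (rule sum_rotate3[symmetric])
  also have "\<dots> = dotn d v (appn d (\<lambda>a b. \<Sum>c<d. w a c \<bullet> (V *v w b c)) v)"
    by (simp add: dotn_def appn_def sum_distrib_left sum_distrib_right mult_ac)
  finally show ?thesis by (simp add: w_def)
qed

text \<open>The maximizing unit vector realizes the largest eigenvalue, and homogeneity extends the
  bound to all vectors.\<close>

lemma exists_max_adj_form:
  assumes "0 < d"
  shows "\<exists>v. dotn d v v = 1 \<and> (\<forall>w. adj_form d M V w \<le> adj_form d M V v * dotn d w w)"
proof -
  obtain v where v: "dotn d v v = 1" "\<forall>w. dotn d w w = 1 \<longrightarrow> adj_form d M V w \<le> adj_form d M V v"
    using exists_constrained_max[OF assms, of "\<lambda>_ _. 0"
      "\<lambda>a b. \<Sum>c<d. (\<chi> i. M i $$ (c, a)) \<bullet> (V *v (\<chi> i. M i $$ (c, b)))"]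
    unfolding adj_form_eq_dotn by auto
  have "adj_form d M V w \<le> adj_form d M V v * dotn d w w" for w
  proof (cases "dotn d w w = 0")
    case True
    then have "\<forall>i<d. w i = 0" by (simp only: dotn_self_eq_0_iff)
    then have "col_vec d M w c = 0" for c by (simp add: col_vec_def Finite_Cartesian_Product.vec_eq_iff)
    then have "adj_form d M V w = 0" by (simp add: adj_form_def)
    then show ?thesis using True by simp
  next
    case False
    then have pos: "0 < dotn d w w" using dotn_self_nonneg[of d w] by linarith
    define s where "s = 1 / sqrt (dotn d w w)"
    have s: "s\<^sup>2 * dotn d w w = 1" "0 < s\<^sup>2" using pos by (auto simp: s_def power_divide)
    have "adj_form d M V (\<lambda>i. s * w i) \<le> adj_form d M V v"
      using v(2) s(1) by (simp add: dotn_scale_left dotn_scale_right power2_eq_square mult.assoc)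
    then have "s\<^sup>2 * adj_form d M V w \<le> adj_form d M V v * (s\<^sup>2 * dotn d w w)"
      by (simp add: adj_form_scale s(1))
    then have "s\<^sup>2 * adj_form d M V w \<le> s\<^sup>2 * (adj_form d M V v * dotn d w w)"
      by (simp add: mult_ac)
    then show ?thesis using s(2) by (simp add: mult_le_cancel_left_pos)
  qed
  then show ?thesis using v(1) by blast
qed

text \<open>Testing nonnegative directions suffices. The normal of a separating hyperplane may be
  truncated to the sign pointing out of \<open>T\<close>, because setting the other coordinates of a
  point to 0 stays in \<open>T\<close> by monotonicity.\<close>

lemma monotonic_set_mem_if_support_bound:
  fixes T :: "(real^'k) set"
  assumes T: "monotonic_set T" and \<tau>: "\<And>k. 0 \<le> \<tau> $ k"
    and le: "\<And>y. (\<And>k. 0 \<le> y $ k) \<Longrightarrow> y \<bullet> \<tau> \<le> support_fun T y"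
  shows "\<tau> \<in> T"
proof (rule ccontr)
  assume "\<tau> \<notin> T"
  note T' = T[unfolded monotonic_set_def]
  have conv: "convex T" by (rule T'[THEN conjunct1])
  have comp: "compact T" by (rule T'[THEN conjunct2, THEN conjunct1])
  have nonneg: "0 \<le> t $ k" if "t \<in> T" for t k
    using T'[THEN conjunct2, THEN conjunct2, THEN conjunct1] that by simp
  have ne: "T \<noteq> {}" using T'[THEN conjunct2, THEN conjunct2, THEN conjunct2, THEN conjunct1] by auto
  have down: "t' \<in> T" if "t \<in> T" "\<forall>k. 0 \<le> t' $ k \<and> t' $ k \<le> t $ k" for t t'
    using T'[THEN conjunct2, THEN conjunct2, THEN conjunct2, THEN conjunct2] that by blast
  obtain a b where ab: "a \<bullet> \<tau> < b" "\<forall>t\<in>T. b < a \<bullet> t"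
    using separating_hyperplane_closed_point[OF conv compact_imp_closed[OF comp] \<open>\<tau> \<notin> T\<close>] by blast
  define y where "y = (\<chi> k. max 0 (- (a $ k)))"
  have "y \<bullet> t \<le> - b" if t: "t \<in> T" for t
  proof -
    define t' where "t' = (\<chi> k. if 0 \<le> a $ k then 0 else t $ k)"
    have "t' \<in> T" by (rule down[OF t]) (use nonneg[OF t] in \<open>simp add: t'_def\<close>)
    moreover have "y \<bullet> t = - (a \<bullet> t')"
      unfolding inner_vec_def y_def t'_def sum_negf[symmetric] by (intro sum.cong) (auto simp: max_def)
    ultimately show ?thesis using ab(2) by force
  qed
  then have "support_fun T y \<le> - b" by (rule support_fun_least[OF ne])
  moreover have "y \<bullet> \<tau> \<le> support_fun T y" by (rule le) (simp add: y_def)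
  moreover have "- (a \<bullet> \<tau>) \<le> y \<bullet> \<tau>"
    unfolding inner_vec_def y_def sum_negf[symmetric]
  proof (rule sum_mono)
    show "- (a $ k \<bullet> \<tau> $ k) \<le> (\<chi> k. max 0 (- (a $ k))) $ k \<bullet> \<tau> $ k" for k
      using mult_right_mono[of "- (a $ k)" "max 0 (- (a $ k))" "\<tau> $ k"] \<tau>[of k] by simp
  qed
  ultimately show False using ab(1) by linarith
qed

section \<open>Sublinearity of support functions and the dual slack vectors\<close>

lemma support_fun_scaleR_le:
  assumes "compact T" "T \<noteq> {}" "0 \<le> c"
  shows "support_fun T (c *\<^sub>R g) \<le> c * support_fun T g"
  by (rule support_fun_least[OF assms(2)])
    (simp add: mult_left_mono support_fun_upper assms)

lemma support_fun_add_le: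
  assumes "compact T" "T \<noteq> {}"
  shows "support_fun T (g + h) \<le> support_fun T g + support_fun T h"
  by (rule support_fun_least[OF assms(2)])
    (simp add: inner_add_left add_mono support_fun_upper assms)

lemma support_fun_nonneg:
  assumes "basic_spectratope_data d R T" "\<And>k. 0 \<le> y $ k"
  shows "0 \<le> support_fun T y"
proof -
  obtain t where t: "t \<in> T" using basic_spectratope_dataD(6)[OF assms(1)] by blast
  have "0 \<le> y \<bullet> t"
    unfolding inner_vec_def
    using assms(2) basic_spectratope_dataD(7)[OF assms(1) t] by (auto intro!: sum_nonneg)
  also have "\<dots> \<le> support_fun T y" by (rule support_fun_upper[OF basic_spectratope_dataD(5)[OF assms(1)] t])
  finally show ?thesis .
qed

text \<open>The test matrices \<open>rank_one (d k) (y $ k) (v k)\<close>, with \<open>v k\<close> a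
  top eigenvector of block \<open>k\<close>, have trace vector \<open>y\<close> and extract the
  largest eigenvalues \<open>\<sigma>\<close>. Varying \<open>y \<ge> 0\<close> bounds
  \<open>\<sigma>\<close> in all nonnegative directions by the support function of \<open>T\<close>,
  which places a multiple of \<open>\<sigma>\<close> in \<open>T\<close>.\<close>

lemma dual_slack_in_monotonic_set:
  fixes V :: "real^'n^'n" and R :: "'k::finite \<Rightarrow> 'n::finite \<Rightarrow> real mat"
  assumes data: "basic_spectratope_data d R T" and "0 < \<gamma>" "0 < \<beta>"
    and V: "\<And>x. 0 \<le> x \<bullet> (V *v x)"
    and bound: "\<And>L. (\<And>k. L k \<in> sym_mats (d k)) \<Longrightarrow> (\<And>k. psd_mat (L k)) \<Longrightarrow>
      support_fun T (trace_vec L) \<le> \<gamma> \<Longrightarrow> V \<bullet> (\<Sum>k\<in>UNIV. adj_map (R k) (L k)) \<le> \<beta>"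
  shows "\<exists>t\<in>T. \<forall>k v. adj_form (d k) (R k) V v \<le> (\<beta> / \<gamma>) * (t $ k) * dotn (d k) v v"
proof -
  have "\<forall>k. \<exists>v. dotn (d k) v v = 1 \<and> (\<forall>w. adj_form (d k) (R k) V w \<le> adj_form (d k) (R k) V v * dotn (d k) w w)"
    using exists_max_adj_form basic_spectratope_dataD(1)[OF data] by blast
  then obtain v where v: "\<And>k. dotn (d k) (v k) (v k) = 1"
    "\<And>k w. adj_form (d k) (R k) V w \<le> adj_form (d k) (R k) V (v k) * dotn (d k) w w"
    by metis
  define \<sigma> where "\<sigma> = (\<chi> k. adj_form (d k) (R k) V (v k))"
  have small: "y \<bullet> \<sigma> \<le> \<beta>" if y: "\<And>k. 0 \<le> y $ k" "support_fun T y \<le> \<gamma>" for y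
  proof -
    define L where "L k = rank_one (d k) (y $ k) (v k)" for k
    have L_sym: "L k \<in> sym_mats (d k)" and L_psd: "psd_mat (L k)" for k
      by (simp_all add: L_def rank_one_sym psd_rank_one y)
    have "trace_vec L = y"
      by (simp add: trace_vec_def L_def trace_rank_one v(1) Finite_Cartesian_Product.vec_eq_iff)
    then have "V \<bullet> (\<Sum>k\<in>UNIV. adj_map (R k) (L k)) \<le> \<beta>"
      using y by (intro bound) (simp_all add: L_sym L_psd)
    moreover have "V \<bullet> adj_map (R k) (L k) = y $ k * \<sigma> $ k" for k
      unfolding L_def \<sigma>_def adj_form_def vec_lambda_beta
      by (rule inner_adj_map_rank_one) (rule basic_spectratope_dataD(2)[OF data])
    ultimately show ?thesis by (simp add: inner_sum_right inner_vec_def[of y \<sigma>])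
  qed
  \<comment> \<open>Homogeneity, stated with a positive upper bound \<open>s\<close> because the
    support function may be 0 at \<open>y\<close> and cannot be divided by; the excess is removed by
    letting it tend to 0.\<close>
  have hom: "\<gamma> * (y \<bullet> \<sigma>) \<le> \<beta> * s" if y: "\<And>k. 0 \<le> y $ k" and s: "0 < s" "support_fun T y \<le> s" for y s
  proof -
    have "support_fun T ((\<gamma> / s) *\<^sub>R y) \<le> (\<gamma> / s) * support_fun T y"
      by (rule support_fun_scaleR_le[OF basic_spectratope_dataD(5,6)[OF data]]) (use \<open>0 < \<gamma>\<close> s in simp)
    also have "\<dots> \<le> (\<gamma> / s) * s" by (intro mult_left_mono s) (use \<open>0 < \<gamma>\<close> s in simp)
    finally have "((\<gamma> / s) *\<^sub>R y) \<bullet> \<sigma> \<le> \<beta>"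
      using y s \<open>0 < \<gamma>\<close> by (intro small) auto
    then show ?thesis using s by (simp add: field_simps)
  qed
  have "(\<gamma> / \<beta>) *\<^sub>R \<sigma> \<in> T"
  proof (rule monotonic_set_mem_if_support_bound[OF basic_spectratope_dataD(3)[OF data]])
    show "0 \<le> ((\<gamma> / \<beta>) *\<^sub>R \<sigma>) $ k" for k
      using \<open>0 < \<gamma>\<close> \<open>0 < \<beta>\<close> adj_form_nonneg[OF V] by (simp add: \<sigma>_def)
  next
    fix y :: "real^'k" assume y: "\<And>k. 0 \<le> y $ k"
    have "0 \<le> support_fun T y" by (rule support_fun_nonneg[OF data y])
    show "y \<bullet> ((\<gamma> / \<beta>) *\<^sub>R \<sigma>) \<le> support_fun T y"
    proof (rule field_le_epsilon)
      fix e :: real assume "0 < e"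
      have "\<gamma> * (y \<bullet> \<sigma>) \<le> \<beta> * (support_fun T y + e)"
        by (rule hom[OF y]) (use \<open>0 < e\<close> \<open>0 \<le> support_fun T y\<close> in auto)
      then show "y \<bullet> ((\<gamma> / \<beta>) *\<^sub>R \<sigma>) \<le> support_fun T y + e"
        using \<open>0 < \<beta>\<close> by (simp add: field_simps)
    qed
  qed
  moreover have "adj_form (d k) (R k) V w \<le> (\<beta> / \<gamma>) * (((\<gamma> / \<beta>) *\<^sub>R \<sigma>) $ k) * dotn (d k) w w" for k w
    using v(2)[of k w] \<open>0 < \<gamma>\<close> \<open>0 < \<beta>\<close> by (simp add: \<sigma>_def)
  ultimately show ?thesis by blast
qed

section \<open>Convex combinations of feasible points\<close>

definition mat_comb :: "real \<Rightarrow> real \<Rightarrow> real mat \<Rightarrow> real mat \<Rightarrow> real mat" where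
  "mat_comb s t X Y = s \<cdot>\<^sub>m X + t \<cdot>\<^sub>m Y"

lemma mat_comb_entry:
  assumes "X \<in> sym_mats d" "Y \<in> sym_mats d" "a < d" "b < d"
  shows "mat_comb s t X Y $$ (a, b) = s * X $$ (a, b) + t * Y $$ (a, b)"
  using assms sym_matsD(2,3) by (simp add: mat_comb_def)

lemma mat_comb_sym:
  assumes "X \<in> sym_mats d" "Y \<in> sym_mats d"
  shows "mat_comb s t X Y \<in> sym_mats d"
proof (rule sym_matsI)
  show "mat_comb s t X Y \<in> carrier_mat d d"
    using sym_matsD(1)[OF assms(1)] sym_matsD(1)[OF assms(2)] by (simp add: mat_comb_def)
  show "mat_comb s t X Y $$ (a, b) = mat_comb s t X Y $$ (b, a)" if "a < d" "b < d" for a b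
    using that sym_matsD(4)[OF assms(1) that] sym_matsD(4)[OF assms(2) that]
    by (simp add: mat_comb_entry[OF assms])
qed

lemma psd_mat_comb:
  assumes XY: "X \<in> sym_mats d" "Y \<in> sym_mats d" and "psd_mat X" "psd_mat Y" "0 \<le> s" "0 \<le> t"
  shows "psd_mat (mat_comb s t X Y)"
proof -
  have "dotn d v (appn d (mat_fun (mat_comb s t X Y)) v)
      = s * dotn d v (appn d (mat_fun X) v) + t * dotn d v (appn d (mat_fun Y) v)" for v
  proof -
    have "appn d (mat_fun (mat_comb s t X Y)) v a = s * appn d (mat_fun X) v a + t * appn d (mat_fun Y) v a"
      if "a < d" for a
      using that by (simp add: appn_def mat_fun_def mat_comb_entry[OF XY] distrib_right distrib_left sum.distrib sum_distrib_left mult_ac)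
    then have "dotn d v (appn d (mat_fun (mat_comb s t X Y)) v)
        = dotn d v (\<lambda>a. s * appn d (mat_fun X) v a + t * appn d (mat_fun Y) v a)"
      by (intro dotn_cong) auto
    then show ?thesis by (simp add: dotn_add_right dotn_scale_right)
  qed
  then show ?thesis
    using assms psd_mat_iff[OF XY(1)] psd_mat_iff[OF XY(2)] by (simp add: psd_mat_iff[OF mat_comb_sym[OF XY]])
qed

lemma adj_map_mat_comb:
  assumes "X \<in> sym_mats d" "Y \<in> sym_mats d" and M: "\<And>i. M i \<in> sym_mats d"
  shows "adj_map M (mat_comb s t X Y) = s *\<^sub>R adj_map M X + t *\<^sub>R adj_map M Y"
proof -
  have "adj_map M (mat_comb s t X Y) $ i $ j = s * adj_map M X $ i $ j + t * adj_map M Y $ i $ j" for i j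
    unfolding adj_map_entry[OF mat_comb_sym[OF assms(1,2)] M] adj_map_entry[OF assms(1) M]
      adj_map_entry[OF assms(2) M] sum_distrib_left sum.distrib[symmetric]
    by (intro sum.cong refl) (simp add: mat_comb_entry[OF assms(1,2)] algebra_simps)
  then show ?thesis by (simp add: Finite_Cartesian_Product.vec_eq_iff)
qed

lemma trace_mat_comb:
  assumes "X \<in> sym_mats d" "Y \<in> sym_mats d"
  shows "trace_mat (mat_comb s t X Y) = s * trace_mat X + t * trace_mat Y"
  using sym_matsD(2)[OF mat_comb_sym[OF assms]] sym_matsD(2)[OF assms(1)] sym_matsD(2)[OF assms(2)]
  by (simp add: trace_mat_def mat_comb_entry[OF assms] sum.distrib sum_distrib_left)

lemma support_fun_trace_mat_comb_le:
  assumes data: "basic_spectratope_data d R T"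
    and "\<And>k. X k \<in> sym_mats (d k)" "\<And>k. Y k \<in> sym_mats (d k)" and st: "0 \<le> s" "0 \<le> t"
  shows "support_fun T (trace_vec (\<lambda>k. mat_comb s t (X k) (Y k)))
    \<le> s * support_fun T (trace_vec X) + t * support_fun T (trace_vec Y)"
proof -
  note c = basic_spectratope_dataD(5,6)[OF data]
  have "trace_vec (\<lambda>k. mat_comb s t (X k) (Y k)) = s *\<^sub>R trace_vec X + t *\<^sub>R trace_vec Y"
    using trace_mat_comb[OF assms(2,3)] by (simp add: trace_vec_def Finite_Cartesian_Product.vec_eq_iff)
  then have "support_fun T (trace_vec (\<lambda>k. mat_comb s t (X k) (Y k)))
      \<le> support_fun T (s *\<^sub>R trace_vec X) + support_fun T (t *\<^sub>R trace_vec Y)"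
    using support_fun_add_le[OF c] by simp
  also have "\<dots> \<le> s * support_fun T (trace_vec X) + t * support_fun T (trace_vec Y)"
    by (intro add_mono support_fun_scaleR_le c st)
  finally show ?thesis .
qed

lemma sum_adj_map_mat_comb:
  assumes data: "basic_spectratope_data d R T"
    and "\<And>k. X k \<in> sym_mats (d k)" "\<And>k. Y k \<in> sym_mats (d k)"
  shows "(\<Sum>k\<in>UNIV. adj_map (R k) (mat_comb s t (X k) (Y k)))
    = s *\<^sub>R (\<Sum>k\<in>UNIV. adj_map (R k) (X k)) + t *\<^sub>R (\<Sum>k\<in>UNIV. adj_map (R k) (Y k))"
  unfolding scaleR_right.sum sum.distrib[symmetric]
  by (rule sum.cong[OF refl]) (rule adj_map_mat_comb[OF assms(2,3) basic_spectratope_dataD(2)[OF data]])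

lemma form_nonneg_add:
  assumes "form_nonneg P Q W" "form_nonneg P' Q' W'"
  shows "form_nonneg (P + P') (Q + Q') (W + W')"
  unfolding form_nonneg_def
proof (intro allI)
  fix u x
  have "0 \<le> (u \<bullet> (P *v u) + 2 * (u \<bullet> (Q *v x)) + x \<bullet> (W *v x))
      + (u \<bullet> (P' *v u) + 2 * (u \<bullet> (Q' *v x)) + x \<bullet> (W' *v x))"
    by (rule add_nonneg_nonneg) (use assms in \<open>simp_all add: form_nonneg_def\<close>)
  then show "0 \<le> u \<bullet> ((P + P') *v u) + 2 * (u \<bullet> ((Q + Q') *v x)) + x \<bullet> ((W + W') *v x)"
    by (simp add: matrix_vector_mult_add_rdistrib inner_add_right)
qed

text \<open>These rank one members of the cone translate nonnegativity of a dual functional into a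
  statement about its quadratic form.\<close>

lemma form_nonneg_outer: "form_nonneg (outer u u) (outer u x) (outer x x)"
  unfolding form_nonneg_def
proof (intro allI)
  fix u' x'
  have "0 \<le> (u \<bullet> u' + x \<bullet> x')\<^sup>2" by simp
  then show "0 \<le> u' \<bullet> (outer u u *v u') + 2 * (u' \<bullet> (outer u x *v x')) + x' \<bullet> (outer x x *v x')"
    by (simp add: outer_matrix_vector inner_commute power2_eq_square algebra_simps)
qed

text \<open>The separated set keeps the bound on the objective and drops the matrix inequality. Each
  property of the functional comes from one group of points: members of the cone give nonnegativity,
  free \<open>H\<close> gives the kernel condition, and admissible multipliers give the two slack
  bounds.\<close>

lemma sdp_dual_witness:
  fixes R :: "'k::finite \<Rightarrow> 'n::finite \<Rightarrow> real mat" and S :: "'l::finite \<Rightarrow> 'v::finite \<Rightarrow> real mat"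
    and A :: "real^'n^'m::finite" and B :: "real^'n^'v"
  assumes R: "basic_spectratope_data d R T" and S: "basic_spectratope_data f S Rset"
    and "0 < \<gamma>" and lower: "\<And>z. z \<in> sdp_feasible d R f S A B \<Longrightarrow> \<gamma> < sdp_objective T Rset z"
  shows "\<exists>U Z V. form_nonneg U Z V \<and> (\<forall>i. A *v (Z $ i) = 0) \<and> Z \<bullet> B = \<gamma> \<and>
    (\<exists>q\<in>Rset. \<forall>l v. adj_form (f l) (S l) U v \<le> q $ l * dotn (f l) v v) \<and>
    (\<exists>t\<in>T. \<forall>k v. adj_form (d k) (R k) V v \<le> t $ k * dotn (d k) v v)"
proof -
  define adm where "adm U L \<longleftrightarrow> (\<forall>l. U l \<in> sym_mats (f l)) \<and> (\<forall>l. psd_mat (U l)) \<and>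
    (\<forall>k. L k \<in> sym_mats (d k)) \<and> (\<forall>k. psd_mat (L k)) \<and>
    support_fun Rset (trace_vec U) + support_fun T (trace_vec L) \<le> \<gamma>" for U L
  define P where "P U = (\<Sum>l\<in>UNIV. adj_map (S l) (U l))" for U
  define W where "W L = (\<Sum>k\<in>UNIV. adj_map (R k) (L k))" for L
  define pt where "pt H U L = (P U, (1/2) *\<^sub>R (B - transpose H ** A), W L)" for H :: "real^'v^'m" and U L
  define \<Gamma> where "\<Gamma> = {z. \<exists>H U L. adm U L \<and> z = pt H U L}"
  define \<K> where "\<K> = {(P :: real^'v^'v, Q :: real^'n^'v, W :: real^'n^'n). form_nonneg P Q W}"
  have feasible_iff: "(H, U, L) \<in> sdp_feasible d R f S A B \<longleftrightarrow>
      (\<forall>l. U l \<in> sym_mats (f l) \<and> psd_mat (U l)) \<and> (\<forall>k. L k \<in> sym_mats (d k) \<and> psd_mat (L k)) \<and>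
      form_nonneg (P U) ((1/2) *\<^sub>R (B - transpose H ** A)) (W L)" for H U L
    unfolding P_def W_def by (rule sdp_feasible_iff) (rule basic_spectratope_dataD(2)[OF R] basic_spectratope_dataD(2)[OF S])+
  have one_sup: "support_fun T (trace_vec (\<lambda>k. scaled_one (d k) c)) \<le> c * support_fun T (trace_vec (\<lambda>k. scaled_one (d k) 1))"
    if "0 \<le> c" for c
  proof -
    have "trace_vec (\<lambda>k. scaled_one (d k) c) = c *\<^sub>R trace_vec (\<lambda>k. scaled_one (d k) 1)"
      by (simp add: trace_vec_def trace_scaled_one Finite_Cartesian_Product.vec_eq_iff)
    then show ?thesis using support_fun_scaleR_le[OF basic_spectratope_dataD(5,6)[OF R] that] by simp
  qed
  have one_sup': "support_fun Rset (trace_vec (\<lambda>l. scaled_one (f l) c)) \<le> c * support_fun Rset (trace_vec (\<lambda>l. scaled_one (f l) 1))"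
    if "0 \<le> c" for c
  proof -
    have "trace_vec (\<lambda>l. scaled_one (f l) c) = c *\<^sub>R trace_vec (\<lambda>l. scaled_one (f l) 1)"
      by (simp add: trace_vec_def trace_scaled_one Finite_Cartesian_Product.vec_eq_iff)
    then show ?thesis using support_fun_scaleR_le[OF basic_spectratope_dataD(5,6)[OF S] that] by simp
  qed
  \<comment> \<open>The objective at the identity matrices. Multiples \<open>c\<close> of them are
    admissible as long as \<open>c * o1 \<le> \<gamma>\<close>, which provides both a zero and a
    positive definite reference point.\<close>
  define o1 where "o1 = support_fun Rset (trace_vec (\<lambda>l. scaled_one (f l) 1)) + support_fun T (trace_vec (\<lambda>k. scaled_one (d k) 1))"
  have "0 \<le> o1"
    unfolding o1_def
    by (intro add_nonneg_nonneg support_fun_trace_vec_nonneg[OF R] support_fun_trace_vec_nonneg[OF S])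
      (auto simp: scaled_one_sym psd_scaled_one)
  define U1 where "U1 c = (\<lambda>l. scaled_one (f l) c)" for c
  define L1 where "L1 c = (\<lambda>k. scaled_one (d k) c)" for c
  have adm1: "adm (U1 c) (L1 c)" if "0 \<le> c" "c * o1 \<le> \<gamma>" for c
    using that one_sup[of c] one_sup'[of c]
    by (simp add: adm_def U1_def L1_def scaled_one_sym psd_scaled_one o1_def distrib_left)
  have P1: "P (U1 c) = c *\<^sub>R P (U1 1)" for c
    unfolding P_def U1_def scaleR_right.sum
    by (rule sum.cong[OF refl]) (rule adj_map_scaled_one[OF basic_spectratope_dataD(2)[OF S]])
  have W1: "W (L1 c) = c *\<^sub>R W (L1 1)" for c
    unfolding W_def L1_def scaleR_right.sum
    by (rule sum.cong[OF refl]) (rule adj_map_scaled_one[OF basic_spectratope_dataD(2)[OF R]])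
  have "convex \<Gamma>"
    unfolding convex_def
  proof (intro ballI allI impI)
    fix z z' and s t :: real assume z: "z \<in> \<Gamma>" "z' \<in> \<Gamma>" and st: "0 \<le> s" "0 \<le> t" "s + t = 1"
    obtain H U L where z1: "adm U L" "z = pt H U L" using z(1) by (auto simp: \<Gamma>_def)
    obtain H' U' L' where z2: "adm U' L'" "z' = pt H' U' L'" using z(2) by (auto simp: \<Gamma>_def)
    define U2 where "U2 l = mat_comb s t (U l) (U' l)" for l
    define L2 where "L2 k = mat_comb s t (L k) (L' k)" for k
    have U: "\<And>l. U l \<in> sym_mats (f l)" "\<And>l. psd_mat (U l)" "\<And>l. U' l \<in> sym_mats (f l)" "\<And>l. psd_mat (U' l)"
      and L: "\<And>k. L k \<in> sym_mats (d k)" "\<And>k. psd_mat (L k)" "\<And>k. L' k \<in> sym_mats (d k)" "\<And>k. psd_mat (L' k)"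
      and o: "support_fun Rset (trace_vec U) + support_fun T (trace_vec L) \<le> \<gamma>"
        "support_fun Rset (trace_vec U') + support_fun T (trace_vec L') \<le> \<gamma>"
      using z1(1) z2(1) by (simp_all add: adm_def)
    have "support_fun Rset (trace_vec U2) \<le> s * support_fun Rset (trace_vec U) + t * support_fun Rset (trace_vec U')"
      unfolding U2_def by (rule support_fun_trace_mat_comb_le[OF S U(1,3) st(1,2)])
    moreover have "support_fun T (trace_vec L2) \<le> s * support_fun T (trace_vec L) + t * support_fun T (trace_vec L')"
      unfolding L2_def by (rule support_fun_trace_mat_comb_le[OF R L(1,3) st(1,2)])
    moreover have "s * (support_fun Rset (trace_vec U) + support_fun T (trace_vec L))
        + t * (support_fun Rset (trace_vec U') + support_fun T (trace_vec L')) \<le> s * \<gamma> + t * \<gamma>"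
      by (intro add_mono mult_left_mono o st)
    moreover have "s * \<gamma> + t * \<gamma> = \<gamma>" by (simp add: st(3) flip: distrib_right)
    ultimately have "support_fun Rset (trace_vec U2) + support_fun T (trace_vec L2) \<le> \<gamma>"
      by (simp add: distrib_left)
    then have "adm U2 L2"
      unfolding adm_def U2_def L2_def
      using mat_comb_sym[OF U(1,3)] mat_comb_sym[OF L(1,3)] psd_mat_comb[OF U(1,3,2,4) st(1,2)]
        psd_mat_comb[OF L(1,3,2,4) st(1,2)] by blast
    moreover have "s *\<^sub>R z + t *\<^sub>R z' = pt (s *\<^sub>R H + t *\<^sub>R H') U2 L2"
    proof -
      have "transpose (s *\<^sub>R H + t *\<^sub>R H') ** A = s *\<^sub>R (transpose H ** A) + t *\<^sub>R (transpose H' ** A)"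
        by (simp add: Finite_Cartesian_Product.vec_eq_iff Finite_Cartesian_Product.transpose_def
          matrix_matrix_mult_def distrib_right sum.distrib sum_distrib_left mult.assoc)
      moreover have "s *\<^sub>R B + t *\<^sub>R B = B" by (simp add: st(3) flip: scaleR_left_distrib)
      ultimately have Q: "s *\<^sub>R (B - transpose H ** A) + t *\<^sub>R (B - transpose H' ** A)
          = B - transpose (s *\<^sub>R H + t *\<^sub>R H') ** A"
        by (simp add: scaleR_right_diff_distrib)
      moreover have "P U2 = s *\<^sub>R P U + t *\<^sub>R P U'"
        unfolding P_def U2_def by (rule sum_adj_map_mat_comb[OF S U(1,3)])
      moreover have "W L2 = s *\<^sub>R W L + t *\<^sub>R W L'"
        unfolding W_def L2_def by (rule sum_adj_map_mat_comb[OF R L(1,3)])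
      moreover have "s *\<^sub>R (1/2) *\<^sub>R X + t *\<^sub>R (1/2) *\<^sub>R Y = (1/2) *\<^sub>R (s *\<^sub>R X + t *\<^sub>R Y)"
        for X Y :: "real^'n^'v" by (simp add: scaleR_right_distrib)
      ultimately show ?thesis unfolding z1(2) z2(2) pt_def by (simp only: scaleR_Pair add_Pair)
    qed
    ultimately show "s *\<^sub>R z + t *\<^sub>R z' \<in> \<Gamma>" unfolding \<Gamma>_def by blast
  qed
  moreover have "convex \<K>"
    unfolding convex_def \<K>_def by (auto intro!: form_nonneg_add form_nonneg_scaleR)
  moreover have "\<Gamma> \<noteq> {}"
  proof -
    have "adm (U1 0) (L1 0)" by (rule adm1) (use \<open>0 < \<gamma>\<close> in auto)
    then have "pt 0 (U1 0) (L1 0) \<in> \<Gamma>" unfolding \<Gamma>_def by blast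
    then show ?thesis by blast
  qed
  moreover have K0: "0 \<in> \<K>" by (simp add: \<K>_def form_nonneg_def zero_prod_def)
  moreover have "\<Gamma> \<inter> \<K> = {}"
  proof (rule ccontr)
    assume "\<Gamma> \<inter> \<K> \<noteq> {}"
    then obtain H U L where adm: "adm U L" and form: "form_nonneg (P U) ((1/2) *\<^sub>R (B - transpose H ** A)) (W L)"
      by (auto simp: \<Gamma>_def \<K>_def pt_def)
    then have "(H, U, L) \<in> sdp_feasible d R f S A B" unfolding feasible_iff adm_def by blast
    from lower[OF this] show False using adm by (simp add: adm_def sdp_objective_def)
  qed
  ultimately obtain a b where a0: "a \<noteq> 0" and aG: "\<forall>z\<in>\<Gamma>. a \<bullet> z \<le> b" and aK: "\<forall>z\<in>\<K>. b \<le> a \<bullet> z"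
    using separating_hyperplane_sets[of \<Gamma> \<K>] by blast
  have "b \<le> 0" using aK K0 by force
  \<comment> \<open>A functional bounded below on a cone is nonnegative on it. Together with
    \<open>b \<le> 0\<close> this replaces the separating level by 0 on both sides.\<close>
  have aK': "0 \<le> a \<bullet> z" if "z \<in> \<K>" for z
  proof (rule ccontr)
    assume "\<not> 0 \<le> a \<bullet> z"
    then have neg: "a \<bullet> z < 0" by simp
    define c where "c = (b - 1) / (a \<bullet> z)"
    have "0 \<le> c" using neg \<open>b \<le> 0\<close> by (simp add: c_def divide_nonpos_nonpos)
    then have "c *\<^sub>R z \<in> \<K>" using that by (auto simp: \<K>_def intro!: form_nonneg_scaleR)
    then have "b \<le> a \<bullet> (c *\<^sub>R z)" using aK by blast
    also have "\<dots> = b - 1" using neg by (simp add: c_def)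
    finally show False by simp
  qed
  obtain U0 Z0 V0 where a: "a = (U0, Z0, V0)" by (cases a)
  have G0: "U0 \<bullet> P U + (1/2) * (Z0 \<bullet> (B - transpose H ** A)) + V0 \<bullet> W L \<le> 0" if "adm U L" for H U L
  proof -
    have "a \<bullet> pt H U L \<le> b" using aG that unfolding \<Gamma>_def by blast
    then show ?thesis using \<open>b \<le> 0\<close> by (simp add: a pt_def)
  qed
  have ZH: "Z0 \<bullet> (transpose H ** A) = 0" for H :: "real^'v^'m"
  proof (rule ccontr)
    assume nz: "Z0 \<bullet> (transpose H ** A) \<noteq> 0"
    \<comment> \<open>Chosen so that the cross term of the separating inequality takes the value 1
      at zero multipliers, against its bound 0.\<close>
    define c where "c = (Z0 \<bullet> B - 1) / (Z0 \<bullet> (transpose H ** A))"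
    have "transpose (c *\<^sub>R H) ** A = c *\<^sub>R (transpose H ** A)"
      by (simp add: Finite_Cartesian_Product.vec_eq_iff Finite_Cartesian_Product.transpose_def
        matrix_matrix_mult_def sum_distrib_left mult.assoc)
    then have "Z0 \<bullet> (B - transpose (c *\<^sub>R H) ** A) = 1"
      using nz by (simp add: inner_diff_right c_def)
    moreover have "U0 \<bullet> P (U1 0) + (1/2) * (Z0 \<bullet> (B - transpose (c *\<^sub>R H) ** A)) + V0 \<bullet> W (L1 0) \<le> 0"
      by (rule G0[OF adm1]) (use \<open>0 < \<gamma>\<close> in auto)
    ultimately show False by (simp add: P1[of 0] W1[of 0])
  qed
  have AZ: "A *v (Z0 $ i) = 0" for i
  proof -
    \<comment> \<open>Testing with the \<open>H\<close> built from \<open>w\<close> turns the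
      orthogonality into \<open>w \<bullet> w = 0\<close>.\<close>
    define w where "w = A *v (Z0 $ i)"
    have "transpose (outer w (axis i 1)) ** A = outer (axis i 1) (transpose A *v w)"
      by (simp add: Finite_Cartesian_Product.vec_eq_iff Finite_Cartesian_Product.transpose_def
        matrix_matrix_mult_def outer_def matrix_vector_mult_def sum_distrib_left mult_ac)
    then have "0 = axis i 1 \<bullet> (Z0 *v (transpose A *v w))"
      using ZH[of "outer w (axis i 1)"] by (simp add: inner_outer)
    also have "\<dots> = Z0 $ i \<bullet> (transpose A *v w)"
      by (simp add: inner_axis' matrix_vector_mul_component)
    also have "\<dots> = (A *v (Z0 $ i)) \<bullet> w"
      by (metis dot_lmul_matrix inner_commute transpose_matrix_vector)
    finally show ?thesis by (simp add: w_def)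
  qed
  define \<beta> where "\<beta> = - (1/2) * (Z0 \<bullet> B)"
  have bound: "U0 \<bullet> P U + V0 \<bullet> W L \<le> \<beta>" if "adm U L" for U L
    using G0[OF that, of 0] ZH[of 0] by (simp add: \<beta>_def inner_diff_right)
  have cone: "0 \<le> u \<bullet> (U0 *v u) + u \<bullet> (Z0 *v x) + x \<bullet> (V0 *v x)" for u x
    using aK'[of "(outer u u, outer u x, outer x x)"] form_nonneg_outer[of u x]
    by (simp add: a \<K>_def inner_outer)
  \<comment> \<open>From the interior point given by the identity matrices one may move slightly in
    direction \<open>- a\<close> within the cone, so \<open>a\<close> is strictly positive there. A
    small admissible multiple of this point transfers positivity to \<open>\<beta>\<close>, without
    which the functional could not be normalized.\<close>
  have "0 < \<beta>"
  proof -
    obtain e where e: "e > 0" "\<And>P' Q W'. norm P' \<le> e \<and> norm Q \<le> e \<and> norm W' \<le> e \<Longrightarrow>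
        form_nonneg (P (U1 1) + P') (Q :: real^'n^'v) (W (L1 1) + W')"
      using form_nonneg_interior[of "P (U1 1)" "W (L1 1)"] sum_adj_map_one_positive[OF S] sum_adj_map_one_positive[OF R]
      unfolding P_def W_def U1_def L1_def by blast
    define s where "s = e / (norm U0 + norm Z0 + norm V0 + 1)"
    have den: "0 < norm U0 + norm Z0 + norm V0 + 1" by (intro add_nonneg_pos add_nonneg_nonneg) auto
    then have s: "0 < s" using e(1) by (simp add: s_def)
    have es: "e = s * (norm U0 + norm Z0 + norm V0 + 1)" using den by (simp add: s_def)
    have "norm (- s *\<^sub>R U0) \<le> e" "norm (- s *\<^sub>R Z0) \<le> e" "norm (- s *\<^sub>R V0) \<le> e"
      using s by (auto simp: es algebra_simps)
    then have "form_nonneg (P (U1 1) + - s *\<^sub>R U0) (- s *\<^sub>R Z0) (W (L1 1) + - s *\<^sub>R V0)"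
      by (intro e(2)) blast
    then have "0 \<le> a \<bullet> (P (U1 1) + - s *\<^sub>R U0, - s *\<^sub>R Z0, W (L1 1) + - s *\<^sub>R V0)"
      by (intro aK') (simp add: \<K>_def)
    also have "\<dots> = U0 \<bullet> P (U1 1) + V0 \<bullet> W (L1 1) - s * (a \<bullet> a)"
      by (simp add: a inner_add_right algebra_simps)
    finally have pos: "0 < U0 \<bullet> P (U1 1) + V0 \<bullet> W (L1 1)"
      using s a0 by (smt (verit) inner_gt_zero_iff mult_pos_pos)
    define c where "c = \<gamma> / (o1 + 1)"
    have c: "0 < c" "c * o1 \<le> \<gamma>" using \<open>0 \<le> o1\<close> \<open>0 < \<gamma>\<close> by (auto simp: c_def field_simps)
    have "c * (U0 \<bullet> P (U1 1) + V0 \<bullet> W (L1 1)) = U0 \<bullet> P (U1 c) + V0 \<bullet> W (L1 c)"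
      by (simp add: P1[of c] W1[of c] distrib_left)
    also have "\<dots> \<le> \<beta>" by (rule bound[OF adm1]) (use c in auto)
    finally show "0 < \<beta>" using mult_pos_pos[OF c(1) pos] by linarith
  qed
  have zeroU: "P (U1 0) = 0" and zeroL: "W (L1 0) = 0" using P1[of 0] W1[of 0] by simp_all
  have adm0: "adm (U1 0) (L1 0)" using adm1[of 0] \<open>0 < \<gamma>\<close> by simp
  have supU0: "support_fun Rset (trace_vec (U1 0)) \<le> 0" using one_sup'[of 0] by (simp add: U1_def)
  have supL0: "support_fun T (trace_vec (L1 0)) \<le> 0" using one_sup[of 0] by (simp add: L1_def)
  \<comment> \<open>With the other family set to zero, the whole budget \<open>\<gamma>\<close> is
    available to this one. The two slack bounds are obtained independently.\<close>
  have "\<exists>t\<in>T. \<forall>k v. adj_form (d k) (R k) V0 v \<le> (\<beta> / \<gamma>) * (t $ k) * dotn (d k) v v"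
  proof (rule dual_slack_in_monotonic_set[OF R \<open>0 < \<gamma>\<close> \<open>0 < \<beta>\<close>])
    show "0 \<le> x \<bullet> (V0 *v x)" for x using cone[of 0 x] by simp
    show "V0 \<bullet> (\<Sum>k\<in>UNIV. adj_map (R k) (L k)) \<le> \<beta>"
      if "\<And>k. L k \<in> sym_mats (d k)" "\<And>k. psd_mat (L k)" "support_fun T (trace_vec L) \<le> \<gamma>" for L
    proof -
      have "adm (U1 0) L" using that adm0 supU0 by (simp add: adm_def)
      from bound[OF this] show ?thesis by (simp add: zeroU) (simp add: W_def)
    qed
  qed
  then obtain t where t: "t \<in> T" "\<And>k v. adj_form (d k) (R k) V0 v \<le> (\<beta> / \<gamma>) * (t $ k) * dotn (d k) v v"
    by blast
  have "\<exists>q\<in>Rset. \<forall>l v. adj_form (f l) (S l) U0 v \<le> (\<beta> / \<gamma>) * (q $ l) * dotn (f l) v v"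
  proof (rule dual_slack_in_monotonic_set[OF S \<open>0 < \<gamma>\<close> \<open>0 < \<beta>\<close>])
    show "0 \<le> u \<bullet> (U0 *v u)" for u using cone[of u 0] by simp
    show "U0 \<bullet> (\<Sum>l\<in>UNIV. adj_map (S l) (U l)) \<le> \<beta>"
      if "\<And>l. U l \<in> sym_mats (f l)" "\<And>l. psd_mat (U l)" "support_fun Rset (trace_vec U) \<le> \<gamma>" for U
    proof -
      have "adm U (L1 0)" using that adm0 supL0 by (simp add: adm_def)
      from bound[OF this] show ?thesis by (simp add: zeroL) (simp add: P_def)
    qed
  qed
  then obtain q where q: "q \<in> Rset" "\<And>l v. adj_form (f l) (S l) U0 v \<le> (\<beta> / \<gamma>) * (q $ l) * dotn (f l) v v"
    by blast
  \<comment> \<open>Normalizes the slack factor \<open>\<beta> / \<gamma>\<close> to 1 and the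
    pairing with \<open>B\<close> to \<open>\<gamma>\<close>. The off-diagonal block is halved
    because \<open>form_nonneg\<close> carries the cross term twice, and changes sign by replacing
    \<open>x\<close> with \<open>- x\<close>.\<close>
  define \<kappa> where "\<kappa> = \<gamma> / \<beta>"
  have \<kappa>: "0 < \<kappa>" "\<kappa> * (\<beta> / \<gamma>) = 1" using \<open>0 < \<gamma>\<close> \<open>0 < \<beta>\<close> by (auto simp: \<kappa>_def)
  have sc: "adj_form n M (\<kappa> *\<^sub>R V) v = \<kappa> * adj_form n M V v" for n and M :: "'i::finite \<Rightarrow> real mat" and V v
    by (simp add: adj_form_def scaleR_matrix_vector_assoc[symmetric] sum_distrib_left)
  have sc_le: "\<kappa> * x \<le> y * z" if "x \<le> (\<beta> / \<gamma>) * y * z" for x y z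
  proof -
    have "\<kappa> * x \<le> \<kappa> * ((\<beta> / \<gamma>) * y * z)" using that \<kappa>(1) by (intro mult_left_mono) auto
    also have "\<dots> = y * z" using \<kappa>(2) by (metis mult.assoc mult_1)
    finally show ?thesis .
  qed
  have "form_nonneg (\<kappa> *\<^sub>R U0) (- (\<kappa> / 2) *\<^sub>R Z0) (\<kappa> *\<^sub>R V0)"
    unfolding form_nonneg_def
  proof (intro allI)
    fix u x
    have "0 \<le> \<kappa> * (u \<bullet> (U0 *v u) + u \<bullet> (Z0 *v (- x)) + (- x) \<bullet> (V0 *v (- x)))"
      using cone[of u "- x"] \<kappa>(1) by (intro mult_nonneg_nonneg) auto
    then show "0 \<le> u \<bullet> ((\<kappa> *\<^sub>R U0) *v u) + 2 * (u \<bullet> ((- (\<kappa> / 2) *\<^sub>R Z0) *v x)) + x \<bullet> ((\<kappa> *\<^sub>R V0) *v x)"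
      by (simp only: scaleR_matrix_vector_assoc[symmetric] matrix_vector_mult_uminus inner_scaleR_right
        inner_minus_left inner_minus_right) (simp add: algebra_simps)
  qed
  moreover have "A *v ((- (\<kappa> / 2) *\<^sub>R Z0) $ i) = 0" for i
    using AZ[of i] by (simp only: vector_scaleR_component matrix_vector_mult_scaleR) simp
  moreover have "(- (\<kappa> / 2) *\<^sub>R Z0) \<bullet> B = \<gamma>"
  proof -
    have "(- (\<kappa> / 2) *\<^sub>R Z0) \<bullet> B = \<kappa> * \<beta>" by (simp add: \<beta>_def)
    then show ?thesis using \<open>0 < \<beta>\<close> by (simp add: \<kappa>_def)
  qed
  moreover have "\<forall>l v. adj_form (f l) (S l) (\<kappa> *\<^sub>R U0) v \<le> q $ l * dotn (f l) v v"
    unfolding sc using q(2) sc_le by blast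
  moreover have "\<forall>k v. adj_form (d k) (R k) (\<kappa> *\<^sub>R V0) v \<le> t $ k * dotn (d k) v v"
    unfolding sc using t(2) sc_le by blast
  ultimately show ?thesis using q(1) t(1) by blast
qed

section \<open>The lower bound on the minimax risk\<close>

lemma sum_orthonormal_trace:
  fixes e :: "'i::finite \<Rightarrow> 'i \<Rightarrow> real" and c :: "'i \<Rightarrow> 'i \<Rightarrow> real"
  assumes "\<And>i j. (\<Sum>k\<in>UNIV. e k i * e k j) = (if i = j then 1 else 0)"
  shows "(\<Sum>k\<in>UNIV. \<Sum>i\<in>UNIV. \<Sum>j\<in>UNIV. e k i * e k j * c i j) = (\<Sum>i\<in>UNIV. c i i)"
proof -
  have "(\<Sum>k\<in>UNIV. \<Sum>i\<in>UNIV. \<Sum>j\<in>UNIV. e k i * e k j * c i j)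
      = (\<Sum>i\<in>UNIV. \<Sum>j\<in>UNIV. \<Sum>k\<in>UNIV. e k i * e k j * c i j)"
    by (rule sum_rotate3[symmetric])
  also have "\<dots> = (\<Sum>i\<in>UNIV. \<Sum>j\<in>UNIV. (if i = j then 1 else 0) * c i j)"
    unfolding sum_distrib_right[symmetric] assms ..
  also have "\<dots> = (\<Sum>i\<in>UNIV. \<Sum>j\<in>UNIV. if i = j then c i i else 0)"
    by (intro sum.cong refl) auto
  finally show ?thesis by simp
qed

lemma sum_orthonormal_square:
  fixes e :: "'i::finite \<Rightarrow> 'i \<Rightarrow> real"
  assumes "\<And>i j. (\<Sum>k\<in>UNIV. e k i * e k j) = (if i = j then 1 else 0)"
  shows "(\<Sum>k\<in>UNIV. (\<Sum>i\<in>UNIV. e k i * g i)\<^sup>2) = (\<Sum>i\<in>UNIV. (g i)\<^sup>2)"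
proof -
  have "(\<Sum>k\<in>UNIV. (\<Sum>i\<in>UNIV. e k i * g i)\<^sup>2)
      = (\<Sum>k\<in>UNIV. \<Sum>i\<in>UNIV. \<Sum>j\<in>UNIV. e k i * e k j * (g i * g j))"
    by (simp only: power2_eq_square sum_product) (simp add: mult_ac)
  also have "\<dots> = (\<Sum>i\<in>UNIV. g i * g i)" by (rule sum_orthonormal_trace[OF assms])
  finally show ?thesis by (simp add: power2_eq_square)
qed

lemma scaled_sum_product:
  "c * ((\<Sum>p\<in>P. f p) * (\<Sum>q\<in>Q. g q)) = (\<Sum>p\<in>P. \<Sum>q\<in>Q. c * (f p * g q :: real))"
  by (subst sum_product) (simp only: sum_distrib_left)

text \<open>Dual blocks need not be symmetric. Only their quadratic forms matter, and these are
  diagonalized by the symmetric part.\<close>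

lemma spectral_decomposition_matrix:
  fixes U :: "real^'v^'v"
  shows "\<exists>(e :: 'v \<Rightarrow> real^'v) mu. (\<forall>k l. e k \<bullet> e l = (if k = l then 1 else 0)) \<and>
    (\<forall>i j. (\<Sum>k\<in>UNIV. e k $ i * e k $ j) = (if i = j then 1 else 0)) \<and>
    (\<forall>y. y \<bullet> (U *v y) = (\<Sum>k\<in>UNIV. mu k * (y \<bullet> e k)\<^sup>2))"
proof -
  define a where "a i j = (U $ i $ j + U $ j $ i) / 2" for i j
  obtain w mu where w1: "\<forall>k l. (\<Sum>i\<in>UNIV. w k i * w l i) = (if k = (l::'v) then 1 else 0)"
    and w2: "\<forall>i j. (\<Sum>k\<in>UNIV. w k i * w k j) = (if i = (j::'v) then 1 else 0)"
    and w3: "\<forall>i j. a i j = (\<Sum>k\<in>UNIV. mu k * (w k i * w k j))"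
    using spectral_decomposition_finite[of a] by (auto simp: a_def add.commute)
  define e where "e k = (\<chi> i. w k i)" for k
  have "y \<bullet> (U *v y) = (\<Sum>k\<in>UNIV. mu k * (y \<bullet> e k)\<^sup>2)" for y
  proof -
    have "y \<bullet> (U *v y) = (\<Sum>i\<in>UNIV. \<Sum>j\<in>UNIV. y $ i * y $ j * U $ i $ j)"
      by (simp add: inner_vec_def matrix_vector_mult_def sum_distrib_left mult_ac)
    moreover have "(\<Sum>i\<in>UNIV. \<Sum>j\<in>UNIV. y $ i * y $ j * U $ i $ j) = (\<Sum>i\<in>UNIV. \<Sum>j\<in>UNIV. y $ i * y $ j * U $ j $ i)"
      by (subst sum.swap) (simp add: mult_ac)
    ultimately have "2 * (y \<bullet> (U *v y)) = (\<Sum>i\<in>UNIV. \<Sum>j\<in>UNIV. y $ i * y $ j * U $ i $ j)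
        + (\<Sum>i\<in>UNIV. \<Sum>j\<in>UNIV. y $ i * y $ j * U $ j $ i)" by simp
    also have "\<dots> = (\<Sum>i\<in>UNIV. \<Sum>j\<in>UNIV. 2 * (y $ i * y $ j * a i j))"
      unfolding sum.distrib[symmetric] by (intro sum.cong refl) (simp add: a_def algebra_simps)
    finally have "y \<bullet> (U *v y) = (\<Sum>i\<in>UNIV. \<Sum>j\<in>UNIV. y $ i * y $ j * a i j)"
      by (simp add: sum_distrib_left[symmetric])
    also have "\<dots> = (\<Sum>i\<in>UNIV. \<Sum>j\<in>UNIV. \<Sum>k\<in>UNIV. mu k * ((y $ i * w k i) * (y $ j * w k j)))"
      by (intro sum.cong refl) (simp add: w3 sum_distrib_left mult_ac)
    also have "\<dots> = (\<Sum>k\<in>UNIV. \<Sum>i\<in>UNIV. \<Sum>j\<in>UNIV. mu k * ((y $ i * w k i) * (y $ j * w k j)))"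
      by (rule sum_rotate3)
    also have "\<dots> = (\<Sum>k\<in>UNIV. mu k * (y \<bullet> e k)\<^sup>2)"
      by (simp only: power2_eq_square inner_vec_def e_def vec_lambda_beta inner_real_def
          scaled_sum_product)
    finally show ?thesis .
  qed
  moreover have "e k \<bullet> e l = (if k = l then 1 else 0)" for k l
    using w1 by (simp add: e_def inner_vec_def)
  moreover have "(\<Sum>k\<in>UNIV. e k $ i * e k $ j) = (if i = j then 1 else 0)" for i j
    using w2 by (simp add: e_def)
  ultimately show ?thesis by blast
qed

text \<open>A Schur complement argument: \<open>x\<^sub>a\<close> plays the role of the conditional expectation of the signal
  given the \<open>a\<close>-th principal component, which moves the signal into the kernel of \<open>A\<close> without
  increasing its covariance.\<close>

lemma kernel_factorization:
  fixes U :: "real^'v^'v" and Z B :: "real^'n^'v" and V :: "real^'n^'n" and A :: "real^'n^'m"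
  assumes form: "form_nonneg U Z V" and AZ: "\<And>i. A *v (Z $ i) = 0"
  shows "\<exists>(u :: 'v \<Rightarrow> real^'v) (x :: 'v \<Rightarrow> real^'n). (\<forall>a. A *v x a = 0) \<and>
    (\<Sum>a\<in>UNIV. u a \<bullet> (B *v x a)) = Z \<bullet> B \<and>
    (\<forall>y. (\<Sum>a\<in>UNIV. (y \<bullet> u a)\<^sup>2) \<le> y \<bullet> (U *v y)) \<and> (\<forall>y. (\<Sum>a\<in>UNIV. (y \<bullet> x a)\<^sup>2) \<le> y \<bullet> (V *v y))"
proof -
  have f: "0 \<le> u \<bullet> (U *v u) + 2 * (u \<bullet> (Z *v x)) + x \<bullet> (V *v x)" for u x
    using form by (simp add: form_nonneg_def)
  obtain e :: "'v \<Rightarrow> real^'v" and mu where e1: "\<And>k l. e k \<bullet> e l = (if k = l then 1 else 0)"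
    and e2: "\<And>i j. (\<Sum>k\<in>UNIV. e k $ i * e k $ j) = (if i = j then 1 else 0)"
    and eU: "\<And>y. y \<bullet> (U *v y) = (\<Sum>k\<in>UNIV. mu k * (y \<bullet> e k)\<^sup>2)"
    using spectral_decomposition_matrix[of U] by blast
  have mu: "e k \<bullet> (U *v e k) = mu k" for k
  proof -
    have "mu l * (e k \<bullet> e l)\<^sup>2 = (if k = l then mu k else 0)" for l by (simp add: e1)
    then show ?thesis by (simp add: eU)
  qed
  have mu0: "0 \<le> mu k" for k using f[of "e k" 0] by (simp add: mu)
  define s where "s k = sqrt (mu k)" for k
  have s2: "s k * s k = mu k" for k using mu0[of k] by (simp add: s_def)
  define z where "z k = (\<Sum>i\<in>UNIV. e k $ i *\<^sub>R Z $ i)" for k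
  have ze: "e k \<bullet> (Z *v x) = z k \<bullet> x" for k x
    by (simp add: z_def inner_sum_left matrix_vector_mul_component inner_vec_def[of "e k"])
  have z0: "z k = 0" if "s k = 0" for k
  proof (rule ccontr)
    assume "z k \<noteq> 0"
    then have pos: "0 < z k \<bullet> z k" by simp
    \<comment> \<open>In a direction with eigenvalue 0 the form is affine in the multiple
      \<open>t\<close> of \<open>e k\<close>; this value of \<open>t\<close> would make it equal to
      -1.\<close>
    define t where "t = - (z k \<bullet> (V *v z k) + 1) / (2 * (z k \<bullet> z k))"
    have "mu k = 0" using that s2[of k] by simp
    then have "0 \<le> 2 * (t * (z k \<bullet> z k)) + z k \<bullet> (V *v z k)"
      using f[of "t *\<^sub>R e k" "z k"] by (simp add: matrix_vector_mult_scaleR mu ze)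
    moreover have "2 * (t * (z k \<bullet> z k)) = - (z k \<bullet> (V *v z k) + 1)"
      using pos by (simp add: t_def)
    ultimately show False by simp
  qed
  define u where "u k = s k *\<^sub>R e k" for k
  define x where "x k = (1 / s k) *\<^sub>R z k" for k
  \<comment> \<open>When \<open>s k = 0\<close>, division by zero makes \<open>x k\<close> zero, and
    \<open>z k\<close> vanishes as well, so the relation survives.\<close>
  have sx: "s k *\<^sub>R x k = z k" for k using z0[of k] by (cases "s k = 0") (simp_all add: x_def)
  have "A *v z k = 0" for k
    unfolding z_def linear_sum[OF matrix_vector_mul_linear] by (simp add: matrix_vector_mult_scaleR AZ)
  then have Ax: "A *v x k = 0" for k by (simp add: x_def matrix_vector_mult_scaleR)
  have "u k \<bullet> (B *v x k) = e k \<bullet> (B *v z k)" for k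
    unfolding sx[symmetric] by (simp add: u_def matrix_vector_mult_scaleR)
  moreover have "e k \<bullet> (B *v z k) = (\<Sum>i\<in>UNIV. \<Sum>j\<in>UNIV. e k $ i * e k $ j * (B $ j \<bullet> Z $ i))" for k
    unfolding z_def linear_sum[OF matrix_vector_mul_linear]
    by (simp add: inner_vec_def[of "e k"] matrix_vector_mul_component matrix_vector_mult_scaleR
        inner_sum_right sum_distrib_left mult_ac)
  ultimately have "(\<Sum>k\<in>UNIV. u k \<bullet> (B *v x k)) = (\<Sum>i\<in>UNIV. B $ i \<bullet> Z $ i)"
    using sum_orthonormal_trace[of "\<lambda>k i. e k $ i" "\<lambda>i j. B $ j \<bullet> Z $ i", OF e2] by simp
  then have uBx: "(\<Sum>k\<in>UNIV. u k \<bullet> (B *v x k)) = Z \<bullet> B"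
    by (simp add: inner_vec_def[of B Z] inner_commute[of Z B])
  have "(\<Sum>k\<in>UNIV. (y \<bullet> u k)\<^sup>2) \<le> y \<bullet> (U *v y)" for y
    unfolding eU by (simp add: u_def power_mult_distrib power2_eq_square[of "s _"] s2)
  moreover have "(\<Sum>k\<in>UNIV. (y \<bullet> x k)\<^sup>2) \<le> y \<bullet> (V *v y)" for y
  proof -
    \<comment> \<open>For fixed \<open>y\<close> this minimizes the block form in its first
      argument. The minimal value is the Schur complement, whose nonnegativity is the claim.\<close>
    define w where "w = (\<Sum>k\<in>UNIV. (- ((y \<bullet> x k) / s k)) *\<^sub>R e k)"
    have we: "w \<bullet> e k = - ((y \<bullet> x k) / s k)" for k
      by (simp add: w_def inner_sum_left e1 if_distrib sum.delta cong: if_cong)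
    have "mu k * (w \<bullet> e k)\<^sup>2 = (y \<bullet> x k)\<^sup>2" for k
      unfolding we s2[symmetric] by (cases "s k = 0") (simp_all add: x_def power2_eq_square)
    then have "w \<bullet> (U *v w) = (\<Sum>k\<in>UNIV. (y \<bullet> x k)\<^sup>2)" unfolding eU by simp
    moreover have "w \<bullet> (Z *v y) = - (\<Sum>k\<in>UNIV. (y \<bullet> x k)\<^sup>2)"
    proof -
      have "(y \<bullet> x k) / s k * (z k \<bullet> y) = (y \<bullet> x k)\<^sup>2" for k
        by (simp add: x_def power2_eq_square inner_commute)
      then show ?thesis
        by (simp add: w_def inner_sum_left ze sum_negf)
    qed
    ultimately show ?thesis using f[of w y] by simp
  qed
  ultimately show ?thesis using Ax uBx by blast
qed

text \<open>One orthogonal matrix must act on both families, as both will carry the same signs. It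
  preserves the second moments and the trace; it can diagonalize only the symmetric part of the
  pairing, which suffices because products of two signs are symmetric in the indices.\<close>

lemma diagonalizing_rotation:
  fixes u :: "'v::finite \<Rightarrow> real^'v" and x :: "'v \<Rightarrow> real^'n" and B :: "real^'n^'v" and A :: "real^'n^'m"
  assumes Ax: "\<And>a. A *v x a = 0"
  shows "\<exists>(u' :: 'v \<Rightarrow> real^'v) x'. (\<forall>a. A *v x' a = 0) \<and>
    (\<Sum>a\<in>UNIV. u' a \<bullet> (B *v x' a)) = (\<Sum>a\<in>UNIV. u a \<bullet> (B *v x a)) \<and>
    (\<forall>k l. k \<noteq> l \<longrightarrow> u' k \<bullet> (B *v x' l) + u' l \<bullet> (B *v x' k) = 0) \<and>
    (\<forall>y. (\<Sum>a\<in>UNIV. (y \<bullet> u' a)\<^sup>2) = (\<Sum>a\<in>UNIV. (y \<bullet> u a)\<^sup>2)) \<and>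
    (\<forall>y. (\<Sum>a\<in>UNIV. (y \<bullet> x' a)\<^sup>2) = (\<Sum>a\<in>UNIV. (y \<bullet> x a)\<^sup>2))"
proof -
  define b where "b p q = u p \<bullet> (B *v x q)" for p q
  obtain e lam where e1: "\<forall>k l. (\<Sum>i\<in>UNIV. e k i * e l i) = (if k = (l::'v) then 1 else 0)"
    and e2: "\<forall>i j. (\<Sum>k\<in>UNIV. e k i * e k j) = (if i = (j::'v) then 1 else 0)"
    and e3: "\<forall>p q. b p q + b q p = (\<Sum>k\<in>UNIV. lam k * (e k p * e k q))"
    using spectral_decomposition_finite[of "\<lambda>p q. b p q + b q p"] by (auto simp: add.commute)
  have e2': "(\<Sum>k\<in>UNIV. e k i * e k j) = (if i = j then 1 else 0)" for i j using e2 by blast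
  define u' where "u' k = (\<Sum>p\<in>UNIV. e k p *\<^sub>R u p)" for k
  define x' where "x' k = (\<Sum>p\<in>UNIV. e k p *\<^sub>R x p)" for k
  have "A *v x' k = 0" for k
    unfolding x'_def linear_sum[OF matrix_vector_mul_linear] by (simp add: matrix_vector_mult_scaleR Ax)
  moreover have ub: "u' k \<bullet> (B *v x' l) = (\<Sum>p\<in>UNIV. \<Sum>q\<in>UNIV. e k p * e l q * b p q)" for k l
    unfolding x'_def u'_def linear_sum[OF matrix_vector_mul_linear] inner_sum_left b_def
    by (simp add: inner_sum_right matrix_vector_mult_scaleR sum_distrib_left mult_ac)
  moreover have "(\<Sum>k\<in>UNIV. u' k \<bullet> (B *v x' k)) = (\<Sum>p\<in>UNIV. u p \<bullet> (B *v x p))"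
    unfolding ub sum_orthonormal_trace[OF e2'] b_def ..
  moreover have "u' k \<bullet> (B *v x' l) + u' l \<bullet> (B *v x' k) = 0" if "k \<noteq> l" for k l
  proof -
    have "u' l \<bullet> (B *v x' k) = (\<Sum>p\<in>UNIV. \<Sum>q\<in>UNIV. e k p * e l q * b q p)"
      unfolding ub by (subst sum.swap) (simp add: mult_ac)
    then have "u' k \<bullet> (B *v x' l) + u' l \<bullet> (B *v x' k)
        = (\<Sum>p\<in>UNIV. \<Sum>q\<in>UNIV. e k p * e l q * (b p q + b q p))"
      unfolding ub by (simp add: sum.distrib distrib_left)
    also have "\<dots> = (\<Sum>p\<in>UNIV. \<Sum>q\<in>UNIV. \<Sum>m\<in>UNIV. lam m * ((e k p * e m p) * (e l q * e m q)))"
      unfolding e3[rule_format] by (intro sum.cong refl) (simp add: sum_distrib_left mult_ac)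
    also have "\<dots> = (\<Sum>m\<in>UNIV. \<Sum>p\<in>UNIV. \<Sum>q\<in>UNIV. lam m * ((e k p * e m p) * (e l q * e m q)))"
      by (rule sum_rotate3)
    also have "\<dots> = (\<Sum>m\<in>UNIV. lam m * ((\<Sum>p\<in>UNIV. e k p * e m p) * (\<Sum>q\<in>UNIV. e l q * e m q)))"
      by (simp only: scaled_sum_product)
    also have "\<dots> = 0"
      unfolding e1[rule_format] by (rule sum.neutral) (use that in auto)
    finally show ?thesis .
  qed
  moreover have "(\<Sum>k\<in>UNIV. (y \<bullet> u' k)\<^sup>2) = (\<Sum>p\<in>UNIV. (y \<bullet> u p)\<^sup>2)" for y
    using sum_orthonormal_square[OF e2', of "\<lambda>p. y \<bullet> u p"] by (simp add: u'_def inner_sum_right)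
  moreover have "(\<Sum>k\<in>UNIV. (y \<bullet> x' k)\<^sup>2) = (\<Sum>p\<in>UNIV. (y \<bullet> x p)\<^sup>2)" for y
    using sum_orthonormal_square[OF e2', of "\<lambda>p. y \<bullet> x p"] by (simp add: x'_def inner_sum_right)
  ultimately show ?thesis by blast
qed

lemma bilinear_sign_sum_constant:
  fixes u :: "'v::finite \<Rightarrow> real^'v" and x :: "'v \<Rightarrow> real^'n" and B :: "real^'n^'v"
  assumes "\<And>k l. k \<noteq> l \<Longrightarrow> u k \<bullet> (B *v x l) + u l \<bullet> (B *v x k) = 0"
  shows "(\<Sum>k\<in>UNIV. set_sign E k *\<^sub>R u k) \<bullet> (B *v (\<Sum>k\<in>UNIV. set_sign E k *\<^sub>R x k))
    = (\<Sum>k\<in>UNIV. u k \<bullet> (B *v x k))"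
proof -
  define b where "b k l = u k \<bullet> (B *v x l)" for k l
  let ?s = "set_sign E"
  have ss: "?s k * ?s k = 1" for k by (simp add: set_sign_def)
  have "(\<Sum>k\<in>UNIV. ?s k *\<^sub>R u k) \<bullet> (B *v (\<Sum>k\<in>UNIV. ?s k *\<^sub>R x k)) = (\<Sum>k\<in>UNIV. \<Sum>l\<in>UNIV. ?s k * ?s l * b k l)"
    (is "?L = _")
    unfolding linear_sum[OF matrix_vector_mul_linear] inner_sum_left b_def
    by (simp add: inner_sum_right matrix_vector_mult_scaleR sum_distrib_left mult_ac)
  moreover have "(\<Sum>k\<in>UNIV. \<Sum>l\<in>UNIV. ?s k * ?s l * b k l) = (\<Sum>k\<in>UNIV. \<Sum>l\<in>UNIV. ?s k * ?s l * b l k)"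
    by (subst sum.swap) (simp add: mult_ac)
  ultimately have "2 * ?L = (\<Sum>k\<in>UNIV. \<Sum>l\<in>UNIV. ?s k * ?s l * b k l) + (\<Sum>k\<in>UNIV. \<Sum>l\<in>UNIV. ?s k * ?s l * b l k)"
    by simp
  also have "\<dots> = (\<Sum>k\<in>UNIV. \<Sum>l\<in>UNIV. ?s k * ?s l * (b k l + b l k))"
    by (simp add: sum.distrib distrib_left)
  also have "\<dots> = (\<Sum>k\<in>UNIV. \<Sum>l\<in>UNIV. if k = l then 2 * b k k else 0)"
    by (intro sum.cong refl) (use assms ss in \<open>auto simp: b_def\<close>)
  also have "\<dots> = 2 * (\<Sum>k\<in>UNIV. b k k)" by (simp add: sum_distrib_left)
  finally show ?thesis by (simp add: b_def)
qed

section \<open>From signed sums to points of the spectratopes\<close>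

lemma sign_sum_lin_fun:
  "sign_sum (\<lambda>j. lin_fun M (x j)) E = lin_fun M (\<Sum>j\<in>UNIV. set_sign E j *\<^sub>R x j)"
proof (intro ext)
  fix a b
  have "(\<Sum>j\<in>UNIV. set_sign E j * (\<Sum>i\<in>UNIV. x j $ i * M i $$ (a, b)))
      = (\<Sum>i\<in>UNIV. \<Sum>j\<in>UNIV. set_sign E j * (x j $ i * M i $$ (a, b)))"
    unfolding sum_distrib_left by (rule sum.swap)
  then show "sign_sum (\<lambda>j. lin_fun M (x j)) E a b = lin_fun M (\<Sum>j\<in>UNIV. set_sign E j *\<^sub>R x j) a b"
    by (simp add: sign_sum_def lin_fun_def sum_distrib_left sum_distrib_right mult_ac)
qed

lemma sum_forms_le_adj_form:
  fixes x :: "'j::finite \<Rightarrow> real^'i"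
  assumes "\<And>y. (\<Sum>j\<in>UNIV. (y \<bullet> x j)\<^sup>2) \<le> y \<bullet> (V *v y)"
  shows "(\<Sum>j\<in>UNIV. dotn d (appn d (lin_fun M (x j)) v) (appn d (lin_fun M (x j)) v)) \<le> adj_form d M V v"
proof -
  have "(\<Sum>j\<in>UNIV. dotn d (appn d (lin_fun M (x j)) v) (appn d (lin_fun M (x j)) v))
      = (\<Sum>c<d. \<Sum>j\<in>UNIV. (col_vec d M v c \<bullet> x j)\<^sup>2)"
    unfolding dotn_appn_lin_fun by (subst sum.swap) (simp add: inner_commute)
  also have "\<dots> \<le> adj_form d M V v" unfolding adj_form_def by (intro sum_mono assms)
  finally show ?thesis .
qed

lemma scaled_mem_basic_spectratope:
  assumes data: "basic_spectratope_data d R T" and t: "t \<in> T" and "0 < c"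
    and le: "\<And>k v. dotn (d k) (appn (d k) (lin_fun (R k) x) v) (appn (d k) (lin_fun (R k) x) v)
      \<le> c * t $ k * dotn (d k) v v"
  shows "(1 / sqrt c) *\<^sub>R x \<in> basic_spectratope d R T"
proof -
  have "(\<Sum>i<d k. (((1 / sqrt c) *\<^sub>R x) \<bullet> col_vec (d k) (R k) v i)\<^sup>2) \<le> t $ k * dotn (d k) v v" for k v
  proof -
    have "(\<Sum>i<d k. (((1 / sqrt c) *\<^sub>R x) \<bullet> col_vec (d k) (R k) v i)\<^sup>2)
        = (1 / c) * (\<Sum>i<d k. (x \<bullet> col_vec (d k) (R k) v i)\<^sup>2)"
      using \<open>0 < c\<close> by (simp add: power_divide sum_divide_distrib)
    also have "\<dots> \<le> (1 / c) * (c * t $ k * dotn (d k) v v)"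
      using le[of k v] \<open>0 < c\<close> unfolding dotn_appn_lin_fun by (intro mult_left_mono) auto
    finally show ?thesis using \<open>0 < c\<close> by simp
  qed
  then show ?thesis
    unfolding basic_spectratope_iff[of R d, OF basic_spectratope_dataD(2)[OF data]] using t by blast
qed

text \<open>Signs that are good for \<open>u\<close> and \<open>x\<close> separately would not keep
  the bilinear form at \<open>\<gamma>\<close>; the same signs must serve both, and this is why
  \<open>D\<close> counts the blocks of both spectratopes.\<close>

lemma kernel_signal_lower_bound:
  fixes R :: "'k::finite \<Rightarrow> 'n::finite \<Rightarrow> real mat" and S :: "'l::finite \<Rightarrow> 'v::finite \<Rightarrow> real mat"
    and A :: "real^'n^'m::finite" and B :: "real^'n^'v"
  assumes R: "basic_spectratope_data d R T" and S: "basic_spectratope_data f S Rset"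
    and N: "is_norm N" and ball: "{u. conj_norm N u \<le> 1} = basic_spectratope f S Rset"
    and D: "D = (\<Sum>k\<in>UNIV. d k) + (\<Sum>l\<in>UNIV. f l)"
    and \<gamma>: "0 < \<gamma>" "\<And>z. z \<in> sdp_feasible d R f S A B \<Longrightarrow> \<gamma> < sdp_objective T Rset z"
  shows "\<exists>x\<in>basic_spectratope d R T. A *v x = 0 \<and> \<gamma> \<le> 2 * ln (2 * real D) * N (B *v x)"
proof -
  obtain U Z V q t where form: "form_nonneg U Z V" and AZ: "\<And>i. A *v (Z $ i) = 0" and ZB: "Z \<bullet> B = \<gamma>"
    and q: "q \<in> Rset" "\<And>l v. adj_form (f l) (S l) U v \<le> q $ l * dotn (f l) v v"
    and t: "t \<in> T" "\<And>k v. adj_form (d k) (R k) V v \<le> t $ k * dotn (d k) v v"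
    using sdp_dual_witness[OF R S \<gamma>] by blast
  obtain u0 :: "'v \<Rightarrow> real^'v" and x0 where x0: "\<And>a. A *v x0 a = 0"
    and "(\<Sum>a\<in>UNIV. u0 a \<bullet> (B *v x0 a)) = Z \<bullet> B"
    and "\<And>y. (\<Sum>a\<in>UNIV. (y \<bullet> u0 a)\<^sup>2) \<le> y \<bullet> (U *v y)" "\<And>y. (\<Sum>a\<in>UNIV. (y \<bullet> x0 a)\<^sup>2) \<le> y \<bullet> (V *v y)"
    using kernel_factorization[where B = B, OF form AZ] by blast
  moreover obtain u :: "'v \<Rightarrow> real^'v" and x where Ax: "\<And>a. A *v x a = 0"
    and "(\<Sum>a\<in>UNIV. u a \<bullet> (B *v x a)) = (\<Sum>a\<in>UNIV. u0 a \<bullet> (B *v x0 a))"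
    and off: "\<And>k l. k \<noteq> l \<Longrightarrow> u k \<bullet> (B *v x l) + u l \<bullet> (B *v x k) = 0"
    and "\<And>y. (\<Sum>a\<in>UNIV. (y \<bullet> u a)\<^sup>2) = (\<Sum>a\<in>UNIV. (y \<bullet> u0 a)\<^sup>2)"
      "\<And>y. (\<Sum>a\<in>UNIV. (y \<bullet> x a)\<^sup>2) = (\<Sum>a\<in>UNIV. (y \<bullet> x0 a)\<^sup>2)"
    using diagonalizing_rotation[where B = B and u = u0 and x = x0 and A = A, OF x0] by blast
  ultimately have diag: "(\<Sum>a\<in>UNIV. u a \<bullet> (B *v x a)) = \<gamma>"
    and u: "\<And>y. (\<Sum>a\<in>UNIV. (y \<bullet> u a)\<^sup>2) \<le> y \<bullet> (U *v y)" and x: "\<And>y. (\<Sum>a\<in>UNIV. (y \<bullet> x a)\<^sup>2) \<le> y \<bullet> (V *v y)"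
    using ZB by simp_all
  \<comment> \<open>The blocks of both spectratopes form one family over the sum type, with
    \<open>x j\<close> generating the left blocks and \<open>u j\<close> the right ones, so that a
    single choice of signs covers all of them.\<close>
  define dd where "dd = case_sum d f"
  define M where "M b j = (case b of Inl k \<Rightarrow> lin_fun (R k) (x j) | Inr l \<Rightarrow> lin_fun (S l) (u j))" for b j
  define \<rho> where "\<rho> = case_sum (\<lambda>k. t $ k) (\<lambda>l. q $ l)"
  have sum_type: "(\<Sum>b\<in>UNIV. dd b) = (\<Sum>k\<in>UNIV. d k) + (\<Sum>l\<in>UNIV. f l)"
    by (simp add: dd_def UNIV_Plus_UNIV[symmetric] sum.Plus del: UNIV_Plus_UNIV)
  have "d k \<le> (\<Sum>k\<in>UNIV. d k)" for k by (rule member_le_sum) auto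
  then have D1: "1 \<le> D" unfolding D using basic_spectratope_dataD(1)[OF R]
    by (metis One_nat_def Suc_leI add_leD1 le_add1 le_trans)
  have "\<exists>E. \<forall>b v. dotn (dd b) (appn (dd b) (sign_sum (M b) E) v) (appn (dd b) (sign_sum (M b) E) v)
    \<le> 2 * ln (2 * real D) * \<rho> b * dotn (dd b) v v"
  proof (rule exists_signs_blocks_bounded)
    show "M b j i l = M b j l i" if "i < dd b" "l < dd b" for b j i l
      using that sym_matsD(4)[OF basic_spectratope_dataD(2)[OF R]] sym_matsD(4)[OF basic_spectratope_dataD(2)[OF S]]
      by (cases b) (auto simp: M_def lin_fun_def dd_def intro!: sum.cong)
    show "(\<Sum>j\<in>UNIV. dotn (dd b) (appn (dd b) (M b j) v) (appn (dd b) (M b j) v)) \<le> \<rho> b * dotn (dd b) v v" for b v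
    proof (cases b)
      case (Inl k)
      show ?thesis
        using order_trans[OF sum_forms_le_adj_form[OF x] t(2)] by (simp add: Inl M_def dd_def \<rho>_def)
    next
      case (Inr l)
      show ?thesis
        using order_trans[OF sum_forms_le_adj_form[OF u] q(2)] by (simp add: Inr M_def dd_def \<rho>_def)
    qed
    show "0 \<le> \<rho> b" for b
      using basic_spectratope_dataD(7)[OF R t(1)] basic_spectratope_dataD(7)[OF S q(1)]
      by (cases b) (simp_all add: \<rho>_def)
    show "D = (\<Sum>b\<in>UNIV. dd b)" by (simp add: sum_type D)
    show "0 < D" using D1 by simp
  qed
  then obtain E where E: "\<And>b v. dotn (dd b) (appn (dd b) (sign_sum (M b) E) v) (appn (dd b) (sign_sum (M b) E) v)
    \<le> 2 * ln (2 * real D) * \<rho> b * dotn (dd b) v v" by blast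
  define c where "c = 2 * ln (2 * real D)"
  have "1 < 2 * real D" using D1 by simp
  then have c: "0 < c" by (simp add: c_def ln_gt_zero)
  have MR: "M (Inl k) = (\<lambda>j. lin_fun (R k) (x j))" and MS: "M (Inr l) = (\<lambda>j. lin_fun (S l) (u j))" for k l
    by (simp_all add: M_def fun_eq_iff)
  define xE where "xE = (\<Sum>j\<in>UNIV. set_sign E j *\<^sub>R x j)"
  define uE where "uE = (\<Sum>j\<in>UNIV. set_sign E j *\<^sub>R u j)"
  have xX: "(1 / sqrt c) *\<^sub>R xE \<in> basic_spectratope d R T"
  proof (rule scaled_mem_basic_spectratope[OF R t(1) c])
    show "dotn (d k) (appn (d k) (lin_fun (R k) xE) v) (appn (d k) (lin_fun (R k) xE) v)
      \<le> c * t $ k * dotn (d k) v v" for k v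
      using E[of "Inl k" v] by (simp add: dd_def MR \<rho>_def sign_sum_lin_fun xE_def c_def)
  qed
  have uB: "(1 / sqrt c) *\<^sub>R uE \<in> basic_spectratope f S Rset"
  proof (rule scaled_mem_basic_spectratope[OF S q(1) c])
    show "dotn (f l) (appn (f l) (lin_fun (S l) uE) v) (appn (f l) (lin_fun (S l) uE) v)
      \<le> c * q $ l * dotn (f l) v v" for l v
      using E[of "Inr l" v] by (simp add: dd_def MS \<rho>_def sign_sum_lin_fun uE_def c_def)
  qed
  have "uE \<bullet> (B *v xE) = \<gamma>"
    using bilinear_sign_sum_constant[of u B x E, OF off] diag by (simp add: uE_def xE_def)
  then have "((1 / sqrt c) *\<^sub>R uE) \<bullet> (B *v ((1 / sqrt c) *\<^sub>R xE)) = \<gamma> / c"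
    using c by (simp add: matrix_vector_mult_scaleR)
  moreover have "((1 / sqrt c) *\<^sub>R uE) \<bullet> (B *v ((1 / sqrt c) *\<^sub>R xE)) \<le> N (B *v ((1 / sqrt c) *\<^sub>R xE))"
    using uB unfolding ball[symmetric] by (intro inner_le_is_norm_if_conj_norm_le_1[OF N]) simp
  ultimately have "\<gamma> / c \<le> N (B *v ((1 / sqrt c) *\<^sub>R xE))" by linarith
  then have "\<gamma> \<le> c * N (B *v ((1 / sqrt c) *\<^sub>R xE))" using c by (simp add: pos_divide_le_eq mult.commute)
  moreover have "A *v ((1 / sqrt c) *\<^sub>R xE) = 0"
    unfolding xE_def matrix_vector_mult_scaleR linear_sum[OF matrix_vector_mul_linear]
    by (simp add: matrix_vector_mult_scaleR Ax)
  ultimately show ?thesis using xX unfolding c_def by blast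
qed

theorem proposition4p1:
  fixes d :: "'k::finite \<Rightarrow> nat" and R :: "'k \<Rightarrow> 'n::finite \<Rightarrow> real mat" and T :: "(real^'k) set"
    and f :: "'l::finite \<Rightarrow> nat" and S :: "'l \<Rightarrow> 'v::finite \<Rightarrow> real mat" and Rset :: "(real^'l) set"
    and N :: "real^'v \<Rightarrow> real"
    and A :: "real^'n^'m::finite" and B :: "real^'n^'v"
    and X :: "(real^'n) set" and D :: nat
  assumes signal_data: "basic_spectratope_data d R T"
    and signal_set: "X = basic_spectratope d R T"
    and norm: "is_norm N"
    and ball_data: "basic_spectratope_data f S Rset"
    and ball_set: "{u. conj_norm N u \<le> 1} = basic_spectratope f S Rset"
    and D_eq: "D = (\<Sum>k\<in>UNIV. d k) + (\<Sum>l\<in>UNIV. f l)"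
  shows
    "(\<exists>H Ups Lam. sdp_optimal d R T f S Rset A B H Ups Lam) \<and>
     (\<forall>H Ups Lam. sdp_optimal d R T f S Rset A B H Ups Lam \<longrightarrow>
        risk N A B X (linear_estimate H) \<le> sdp_opt d R T f S Rset A B) \<and>
     (\<forall>H Ups Lam. sdp_optimal d R T f S Rset A B H Ups Lam \<longrightarrow>
        risk N A B X (linear_estimate H) \<le> sdp_opt d R T f S Rset A B \<and>
        sdp_opt d R T f S Rset A B \<le> ereal (2 * ln (2 * real D)) * risk_opt N A B X)"
proof -
  have upper: "risk N A B X (linear_estimate H) \<le> sdp_opt d R T f S Rset A B"
    if opt: "sdp_optimal d R T f S Rset A B H Ups Lam" for H Ups Lam
  proof -
    have "risk N A B X (linear_estimate H) \<le> ereal (sdp_objective T Rset (H, Ups, Lam))"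
      unfolding signal_set
      by (rule risk_linear_estimate_le[OF signal_data ball_data norm ball_set])
        (use opt in \<open>simp add: sdp_optimal_def\<close>)
    also have "\<dots> \<le> sdp_opt d R T f S Rset A B"
      unfolding sdp_opt_def using opt unfolding sdp_optimal_def by (intro INF_greatest) simp
    finally show ?thesis .
  qed
  have "(\<Sum>k\<in>UNIV. d k) > 0"
    using basic_spectratope_dataD(1)[OF signal_data] by (intro sum_pos) auto
  then have "1 \<le> D" by (simp add: D_eq)
  then have "1 < 2 * real D" by simp
  then have c: "0 < 2 * ln (2 * real D)" using ln_gt_zero by simp
  have kernel: "ereal (N (B *v x)) \<le> risk_opt N A B X" if "x \<in> X" "A *v x = 0" for x
    unfolding risk_opt_def using that unfolding signal_set
    by (intro INF_greatest risk_ge_kernel_signal[OF signal_data norm])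
  have risk_nonneg: "0 \<le> risk_opt N A B X"
    using kernel[of 0] zero_mem_basic_spectratope[OF signal_data]
    by (simp add: signal_set is_normD(3)[OF norm] zero_ereal_def)
  have lower: "sdp_opt d R T f S Rset A B \<le> ereal (2 * ln (2 * real D)) * risk_opt N A B X"
    if opt: "sdp_optimal d R T f S Rset A B H Ups Lam" for H Ups Lam
  proof (rule ccontr)
    define o' where "o' = sdp_objective T Rset (H, Ups, Lam)"
    assume "\<not> ?thesis"
    moreover have "sdp_opt d R T f S Rset A B \<le> ereal o'"
      unfolding sdp_opt_def o'_def using opt unfolding sdp_optimal_def by (intro INF_lower) simp
    ultimately have less: "ereal (2 * ln (2 * real D)) * risk_opt N A B X < ereal o'" by simp
    \<comment> \<open>An infinite minimax risk, times the positive factor, could not lie below a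
      real number.\<close>
    then obtain r where r: "risk_opt N A B X = ereal r"
      using risk_nonneg c by (cases "risk_opt N A B X") auto
    have r0: "0 \<le> r" using risk_nonneg by (simp add: r)
    define p where "p = 2 * ln (2 * real D) * r"
    have po: "p < o'" using less by (simp add: r p_def)
    have p0: "0 \<le> p" unfolding p_def using c r0 by (intro mult_nonneg_nonneg) auto
    \<comment> \<open>Strictly between the claimed bound and the optimal value, and positive even
      when the minimax risk is 0, as the dual argument requires.\<close>
    define \<gamma> where "\<gamma> = (p + o') / 2"
    have \<gamma>0: "0 < \<gamma>" and \<gamma>o: "\<gamma> < o'" and \<gamma>p: "p < \<gamma>" using p0 po by (auto simp: \<gamma>_def)
    have "\<gamma> < sdp_objective T Rset z" if "z \<in> sdp_feasible d R f S A B" for z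
      using opt that \<gamma>o unfolding sdp_optimal_def o'_def by force
    then obtain x where x: "x \<in> X" "A *v x = 0" "\<gamma> \<le> 2 * ln (2 * real D) * N (B *v x)"
      using kernel_signal_lower_bound[OF signal_data ball_data norm ball_set D_eq \<gamma>0]
      unfolding signal_set by blast
    have "N (B *v x) \<le> r" using kernel[OF x(1,2)] by (simp add: r)
    then have "2 * ln (2 * real D) * N (B *v x) \<le> p"
      unfolding p_def using c by (intro mult_left_mono) auto
    then show False using x(3) \<gamma>p by linarith
  qed
  show ?thesis using sdp_optimal_exists[OF signal_data ball_data] upper lower by blast
qed

end
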